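(* Let $p=(n_1,\dots,n_k)$ be an integer partition with only odd parts and $s(p)\ge 2$. Then \[ d(p)=\sum_{i=2}^k n_i\, d(p_{n_1\odot n_i})+\sum_{\substack{1\le a\le n_1-2\\ a\equiv 1 \ (\mathrm{mod}\ 2)}} d(p_{n_1|a}). \]
   Context: Partitions are multisets; $s(p)$ is the sum of the parts. For a part $m$ and $a\in\{1,\dots,m-2\}$, $p_{m|a}=(a,m-a-1)\uplus(p\setminus(m))$; for two parts $m_l,m_r$ at different positions, $p_{m_l\odot m_r}=(m_l+m_r-1)\uplus(p\setminus(m_l,m_r))$. For a partition $p$ of $N$ with only odd parts: fix $\sigma\in S_N$ of cycle type $p$ and $*\in\{1,\dots,N\}$; to each pair $(\tau_t,\tau_b)$ of $N$-cycles with $\tau_t\tau_b^{-1}=\sigma$ associate the standard labeled permutation on $(\{1,\dots,N\}\setminus\{*\})\cup\{r_t,r_b\}$ with top row $r_t,\tau_t( * ),\dots,\tau_t^{N-1}( * ),r_b$ and bottom row $r_b,\tau_b( * ),\dots,\tau_b^{N-1}( * ),r_t$; $c_s(p)$ is the number of pairs whose associated permutation has spin parity $s$ (Kontsevich–Zorich spin parity of its Veech suspension: Arf invariant of $\gamma\mapsto \mathrm{ind}(\gamma)+1 \bmod 2$ on $H_1(\cdot;\mathbb Z/2)$), and $d(p)=c_1(p)-c_0(p)$. *)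

theory Defs
  imports Complex_Main "HOL-Library.Multiset" "HOL-Library.Z2" "HOL-Combinatorics.Combinatorics"
begin

section \<open>Labeled permutations and their Veech suspension\<close>

text \<open>
  A labeled permutation is a pair (top row, bottom row) of duplicate-free lists with the same
  set of labels.
\<close>

type_synonym 'a lperm = "'a list \<times> 'a list"

datatype row = Top | Bottom

fun opposite :: "row \<Rightarrow> row" where
  "opposite Top = Bottom"
| "opposite Bottom = Top"

fun labels_of :: "'a lperm \<Rightarrow> row \<Rightarrow> 'a list" where
  "labels_of \<pi> Top = fst \<pi>"
| "labels_of \<pi> Bottom = snd \<pi>"

definition alphabet :: "'a lperm \<Rightarrow> 'a set" where
  "alphabet \<pi> = set (fst \<pi>)"

definition pos :: "'a lperm \<Rightarrow> row \<Rightarrow> 'a \<Rightarrow> nat" where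
  "pos \<pi> r \<alpha> = length (takeWhile (\<lambda>\<beta>. \<beta> \<noteq> \<alpha>) (labels_of \<pi> r))"

text \<open>
  The suspension is the one with data
  \<open>\<zeta>\<^sub>\<alpha> = 1 + \<i> (pos \<pi> Bottom \<alpha> - pos \<pi> Top \<alpha>)\<close>: with \<open>n\<close> labels, the polygon \<open>P\<close> is bounded by
  two broken lines from a common left end to a common right end, the upper one with successive
  sides \<open>\<zeta>\<^sub>\<alpha>\<close> in the order of the top row, the lower one in the order of the bottom row, and the two
  sides labeled \<open>\<alpha>\<close> are identified by translation.  All sides have horizontal extent 1, so
  the corners of each broken line have abscissas \<open>0, \<dots>, n\<close>; the pair \<open>(r, k)\<close> stands for the
  corner of abscissa \<open>k\<close> of the broken line \<open>r\<close>.
\<close>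

definition corners :: "'a lperm \<Rightarrow> (row \<times> nat) set" where
  "corners \<pi> = UNIV \<times> {0..length (fst \<pi>)}"

definition corner_glue :: "'a lperm \<Rightarrow> ((row \<times> nat) \<times> (row \<times> nat)) set" where
  "corner_glue \<pi> =
     {((Top, 0), (Bottom, 0)),
      ((Top, length (fst \<pi>)), (Bottom, length (fst \<pi>)))}
     \<union> {((Top, pos \<pi> Top \<alpha>), (Bottom, pos \<pi> Bottom \<alpha>)) | \<alpha>. \<alpha> \<in> alphabet \<pi>}
     \<union> {((Top, Suc (pos \<pi> Top \<alpha>)), (Bottom, Suc (pos \<pi> Bottom \<alpha>))) | \<alpha>. \<alpha> \<in> alphabet \<pi>}"

text \<open>The points of the closed surface that come from corners of \<open>P\<close>; these include all conical singularities.\<close>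

definition singularities :: "'a lperm \<Rightarrow> (row \<times> nat) set set" where
  "singularities \<pi> = corners \<pi> // (corner_glue \<pi> \<union> (corner_glue \<pi>)\<inverse>)\<^sup>*"


section \<open>Homology mod 2 and the intersection form\<close>

text \<open>
  \<open>H\<^sub>1(\<cdot>; \<int>/2)\<close> of the closed surface is computed from the cell structure dual to the polygon:
  one vertex (the centre of \<open>P\<close>), for each label \<open>\<alpha>\<close> the loop \<open>c\<^sub>\<alpha>\<close> crossing the side \<open>\<alpha>\<close> once,
  and one 2-cell around each singularity, whose boundary crosses a side once for each end of that
  side at the singularity.  Having one vertex, every 1-chain is a cycle.
  A function on \<open>H\<^sub>1\<close> is represented by a function of cycles that is constant modulo
  boundaries.
\<close>

definition cycles :: "'a lperm \<Rightarrow> ('a \<Rightarrow> bit) set" where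
  "cycles \<pi> = {x. \<forall>\<alpha>. \<alpha> \<notin> alphabet \<pi> \<longrightarrow> x \<alpha> = 0}"

definition boundary_of :: "'a lperm \<Rightarrow> (row \<times> nat) set \<Rightarrow> 'a \<Rightarrow> bit" where
  "boundary_of \<pi> v \<alpha> =
     (if \<alpha> \<in> alphabet \<pi>
      then of_bool ((Top, pos \<pi> Top \<alpha>) \<in> v) + of_bool ((Top, Suc (pos \<pi> Top \<alpha>)) \<in> v)
      else 0)"

definition boundaries :: "'a lperm \<Rightarrow> ('a \<Rightarrow> bit) set" where
  "boundaries \<pi> = {\<lambda>\<alpha>. \<Sum>v\<in>V. boundary_of \<pi> v \<alpha> | V. V \<subseteq> singularities \<pi>}"

definition homologous :: "'a lperm \<Rightarrow> ('a \<Rightarrow> bit) \<Rightarrow> ('a \<Rightarrow> bit) \<Rightarrow> bool" where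
  "homologous \<pi> x y \<longleftrightarrow> (\<lambda>\<alpha>. x \<alpha> + y \<alpha>) \<in> boundaries \<pi>"

text \<open>
  Inside \<open>P\<close> the loop \<open>c\<^sub>\<alpha>\<close> is a segment joining the two sides \<open>\<alpha>\<close>; the segments of \<open>c\<^sub>\<alpha>\<close> and
  \<open>c\<^sub>\<beta>\<close> cross (once) exactly if \<open>\<alpha>\<close> and \<open>\<beta>\<close> come in different orders in the two rows.
\<close>

definition loops_cross :: "'a lperm \<Rightarrow> 'a \<Rightarrow> 'a \<Rightarrow> bool" where
  "loops_cross \<pi> \<alpha> \<beta> \<longleftrightarrow>
     (pos \<pi> Top \<alpha> < pos \<pi> Top \<beta>) \<noteq> (pos \<pi> Bottom \<alpha> < pos \<pi> Bottom \<beta>)"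

definition intersection_form :: "'a lperm \<Rightarrow> ('a \<Rightarrow> bit) \<Rightarrow> ('a \<Rightarrow> bit) \<Rightarrow> bit" where
  "intersection_form \<pi> x y =
     (\<Sum>\<alpha>\<in>alphabet \<pi>. \<Sum>\<beta>\<in>alphabet \<pi>. x \<alpha> * y \<beta> * of_bool (loops_cross \<pi> \<alpha> \<beta>))"


section \<open>Simple closed curves and their index\<close>

text \<open>
  A smooth closed curve in the complement of the singularities and transverse to the sides is
  recorded by the cyclic list of its side crossings.  The crossing \<open>(r, \<alpha>, t)\<close> leaves \<open>P\<close> through
  the copy of the side \<open>\<alpha>\<close> in row \<open>r\<close>, at the point which is a fraction \<open>t\<close> of the way along the side,
  and enters \<open>P\<close> again at the corresponding point of the other copy.  A point of the boundary of \<open>P\<close>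
  is given by its row and its abscissa.

  Between two successive crossings the curve runs along an arc in \<open>P\<close>.  Two arcs in the disc \<open>P\<close> can
  be made disjoint if and only if their end points do not separate each other on the boundary circle, so
  up to isotopy these diagrams are all the simple closed curves that cross some side.  (A simple
  closed curve crossing no side bounds a disc in \<open>P\<close>, so it has index \<open>\<plusminus>1\<close> and imposes nothing
  beyond the value 0 on the zero class.)
\<close>

type_synonym 'a crossing = "row \<times> 'a \<times> real"

fun exit_point :: "'a lperm \<Rightarrow> 'a crossing \<Rightarrow> row \<times> real" where
  "exit_point \<pi> (r, \<alpha>, t) = (r, real (pos \<pi> r \<alpha>) + t)"

fun entry_point :: "'a lperm \<Rightarrow> 'a crossing \<Rightarrow> row \<times> real" where
  "entry_point \<pi> (r, \<alpha>, t) = (opposite r, real (pos \<pi> (opposite r) \<alpha>) + t)"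

definition curve_arc :: "'a lperm \<Rightarrow> 'a crossing list \<Rightarrow> nat \<Rightarrow> (row \<times> real) \<times> (row \<times> real)" where
  "curve_arc \<pi> \<gamma> i =
     (entry_point \<pi> (\<gamma> ! i), exit_point \<pi> (\<gamma> ! (Suc i mod length \<gamma>)))"

text \<open>Clockwise coordinate on the boundary of \<open>P\<close>, starting from the left end.\<close>

fun circ :: "'a lperm \<Rightarrow> row \<times> real \<Rightarrow> real" where
  "circ \<pi> (Top, s) = s"
| "circ \<pi> (Bottom, s) = 2 * real (length (fst \<pi>)) - s"

definition strictly_between :: "real \<Rightarrow> real \<Rightarrow> real \<Rightarrow> bool" where
  "strictly_between u v w \<longleftrightarrow> min u v < w \<and> w < max u v"

definition arcs_cross ::
  "'a lperm \<Rightarrow> (row \<times> real) \<times> (row \<times> real) \<Rightarrow> (row \<times> real) \<times> (row \<times> real) \<Rightarrow> bool" where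
  "arcs_cross \<pi> A B \<longleftrightarrow>
     strictly_between (circ \<pi> (fst A)) (circ \<pi> (snd A)) (circ \<pi> (fst B)) \<noteq>
     strictly_between (circ \<pi> (fst A)) (circ \<pi> (snd A)) (circ \<pi> (snd B))"

definition simple_closed_curve :: "'a lperm \<Rightarrow> 'a crossing list \<Rightarrow> bool" where
  "simple_closed_curve \<pi> \<gamma> \<longleftrightarrow>
     \<gamma> \<noteq> []
     \<and> (\<forall>(r, \<alpha>, t) \<in> set \<gamma>. \<alpha> \<in> alphabet \<pi> \<and> 0 < t \<and> t < 1)
     \<and> distinct (map snd \<gamma>)
     \<and> (\<forall>i < length \<gamma>. \<forall>j < length \<gamma>. i \<noteq> j \<longrightarrow> \<not> arcs_cross \<pi> (curve_arc \<pi> \<gamma> i) (curve_arc \<pi> \<gamma> j))"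

definition cycle_of_curve :: "'a crossing list \<Rightarrow> 'a \<Rightarrow> bit" where
  "cycle_of_curve \<gamma> \<alpha> = of_nat (length (filter (\<lambda>(r, \<beta>, t). \<beta> = \<alpha>) \<gamma>))"

text \<open>
  Number of counterclockwise half turns of the tangent vector along an embedded arc.  By an isotopy
  through curves transverse to the sides, the tangent vector is vertical at every crossing: upwards
  when entering at the bottom or leaving at the top, downwards when entering at the top or leaving at
  the bottom.  An arc joining opposite rows does not turn; an arc entering and leaving through
  the same row makes a U-turn, whose sense depends on whether it goes to the left or to the right.
\<close>

fun half_turns :: "(row \<times> real) \<times> (row \<times> real) \<Rightarrow> int" where
  "half_turns ((Bottom, s), (Top, t)) = 0"
| "half_turns ((Top, s), (Bottom, t)) = 0"
| "half_turns ((Bottom, s), (Bottom, t)) = (if t < s then 1 else -1)"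
| "half_turns ((Top, s), (Top, t)) = (if s < t then 1 else -1)"

text \<open>
  The gluings are translations, so the turning adds up along the curve; around a closed curve the
  number of half turns is even.
\<close>

definition ind :: "'a lperm \<Rightarrow> 'a crossing list \<Rightarrow> int" where
  "ind \<pi> \<gamma> = (\<Sum>i<length \<gamma>. half_turns (curve_arc \<pi> \<gamma> i)) div 2"


section \<open>Spin parity\<close>

text \<open>
  The quadratic form on \<open>H\<^sub>1(\<cdot>; \<int>/2)\<close> that refines the intersection form and takes the value
  \<open>ind(\<gamma>) + 1\<close> on the class of every simple closed curve \<open>\<gamma>\<close>.
\<close>

definition spin_form :: "'a lperm \<Rightarrow> (('a \<Rightarrow> bit) \<Rightarrow> bit) \<Rightarrow> bool" where
  "spin_form \<pi> \<phi> \<longleftrightarrow>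
     (\<forall>x\<in>cycles \<pi>. \<forall>y\<in>cycles \<pi>. homologous \<pi> x y \<longrightarrow> \<phi> x = \<phi> y)
     \<and> (\<forall>x\<in>cycles \<pi>. \<forall>y\<in>cycles \<pi>.
          \<phi> (\<lambda>\<alpha>. x \<alpha> + y \<alpha>) = \<phi> x + \<phi> y + intersection_form \<pi> x y)
     \<and> (\<forall>\<gamma>. simple_closed_curve \<pi> \<gamma> \<longrightarrow> \<phi> (cycle_of_curve \<gamma>) = of_int (ind \<pi> \<gamma> + 1))"

text \<open>Linear independence in \<open>H\<^sub>1\<close> follows from the intersection numbers.\<close>

definition symplectic_basis ::
  "'a lperm \<Rightarrow> nat \<Rightarrow> (nat \<Rightarrow> 'a \<Rightarrow> bit) \<Rightarrow> (nat \<Rightarrow> 'a \<Rightarrow> bit) \<Rightarrow> bool" where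
  "symplectic_basis \<pi> g a b \<longleftrightarrow>
     (\<forall>i<g. a i \<in> cycles \<pi> \<and> b i \<in> cycles \<pi>)
     \<and> (\<forall>i<g. \<forall>j<g.
          intersection_form \<pi> (a i) (a j) = 0
          \<and> intersection_form \<pi> (b i) (b j) = 0
          \<and> intersection_form \<pi> (a i) (b j) = of_bool (i = j))
     \<and> (\<forall>x\<in>cycles \<pi>. \<exists>I J. I \<subseteq> {..<g} \<and> J \<subseteq> {..<g}
          \<and> homologous \<pi> x (\<lambda>\<alpha>. (\<Sum>i\<in>I. a i \<alpha>) + (\<Sum>j\<in>J. b j \<alpha>)))"

definition has_arf_invariant :: "'a lperm \<Rightarrow> (('a \<Rightarrow> bit) \<Rightarrow> bit) \<Rightarrow> bit \<Rightarrow> bool" where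
  "has_arf_invariant \<pi> \<phi> s \<longleftrightarrow>
     (\<exists>g a b. symplectic_basis \<pi> g a b \<and> s = (\<Sum>i<g. \<phi> (a i) * \<phi> (b i)))"

definition spin_parity :: "'a lperm \<Rightarrow> bit" where
  "spin_parity \<pi> = (THE s. \<exists>\<phi>. spin_form \<pi> \<phi> \<and> has_arf_invariant \<pi> \<phi> s)"


section \<open>Integer partitions and the numbers \<open>c\<^sub>s(p)\<close>, \<open>d(p)\<close>\<close>

definition part_split :: "nat multiset \<Rightarrow> nat \<Rightarrow> nat \<Rightarrow> nat multiset" where
  "part_split p m a = {#a, m - a - 1#} + (p - {#m#})"

definition part_merge :: "nat multiset \<Rightarrow> nat \<Rightarrow> nat \<Rightarrow> nat multiset" where
  "part_merge p ml mr = {#ml + mr - 1#} + (p - {#ml, mr#})"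

text \<open>Cycle type of a permutation of \<open>S\<close>; fixed points contribute parts equal to 1.\<close>

definition cycle_type :: "(nat \<Rightarrow> nat) \<Rightarrow> nat set \<Rightarrow> nat multiset" where
  "cycle_type \<sigma> S = image_mset card (mset_set (orbit \<sigma> ` S))"

definition full_cycle :: "nat \<Rightarrow> (nat \<Rightarrow> nat) \<Rightarrow> bool" where
  "full_cycle N \<tau> \<longleftrightarrow> \<tau> permutes {1..N} \<and> cyclic_on \<tau> {1..N}"

datatype label = R_top | R_bot | Lab nat

definition standard_perm ::
  "nat \<Rightarrow> nat \<Rightarrow> (nat \<Rightarrow> nat) \<Rightarrow> (nat \<Rightarrow> nat) \<Rightarrow> label lperm" where
  "standard_perm N star \<tau>t \<tau>b =
     (R_top # map (\<lambda>k. Lab ((\<tau>t ^^ k) star)) [1..<N] @ [R_bot],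
      R_bot # map (\<lambda>k. Lab ((\<tau>b ^^ k) star)) [1..<N] @ [R_top])"

text \<open>The fixed permutation of cycle type \<open>p\<close> and the fixed element \<open>*\<close>.\<close>

definition base_choice :: "nat multiset \<Rightarrow> (nat \<Rightarrow> nat) \<times> nat" where
  "base_choice p =
     (SOME (\<sigma>, star). \<sigma> permutes {1..sum_mset p}
        \<and> cycle_type \<sigma> {1..sum_mset p} = p \<and> star \<in> {1..sum_mset p})"

definition spin_count :: "bit \<Rightarrow> nat multiset \<Rightarrow> nat" where
  "spin_count s p =
     (let N = sum_mset p; (\<sigma>, star) = base_choice p in
      card {(\<tau>t, \<tau>b). full_cycle N \<tau>t \<and> full_cycle N \<tau>b \<and> \<tau>t \<circ> inv \<tau>b = \<sigma>
              \<and> spin_parity (standard_perm N star \<tau>t \<tau>b) = s})"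

definition spin_diff :: "nat multiset \<Rightarrow> int" where
  "spin_diff p = int (spin_count 1 p) - int (spin_count 0 p)"

end

theory Submission
  imports Defs
begin

text \<open>
  For a labeled permutation, the vectors over \<open>\<int>/2\<close> indexed by the labels carry the quadratic form
  \<open>q(x) = |x| + (number of inverted pairs in the support of x)\<close>. It takes the value \<open>ind(\<gamma>) + 1\<close> on
  every simple closed curve, its radical is the group of boundaries, and it vanishes there if all cone angles
  are odd multiples of \<open>2\<pi>\<close>; so the Arf invariant is the sign of the Gauss sum \<open>\<Sum> (-1)^q(x)\<close>. For a
  standard permutation this sum is \<open>-2 \<theta>\<close>, where \<open>\<theta>\<close> adds up the signs that compare the two cyclic orders
  \<open>\<tau>\<^sub>t\<close>, \<open>\<tau>\<^sub>b\<close> on the subsets of odd size (rotations of an odd set are even, so these signs make sense).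
  Hence \<open>2^((s(p) + k - 2) / 2) d(p)\<close> is the sum of \<open>\<theta>\<close> over the factorizations of \<open>\<sigma>\<close>.

  Deleting an element \<open>x\<close> of the cycle of length \<open>n\<^sub>1\<close> from both long cycles leaves a factorization of a
  permutation \<open>\<sigma>'\<close> whose type is a merge or a split of \<open>p\<close>. The subsets without \<open>x\<close> contribute \<open>\<theta>\<close> of the
  smaller factorization, those with \<open>x\<close> a sum \<open>\<phi>(y, w)\<close>, where \<open>x\<close> was inserted before \<open>y\<close> and \<open>w\<close>. As
  \<open>\<phi>(y, \<sigma>' w) = -\<phi>(y, w)\<close> unless \<open>\<sigma>' w = y\<close>, and \<open>\<phi>(y, w) = \<theta>\<close> if \<open>\<sigma>' w = y\<close>, the contribution \<open>\<phi>\<close> equals \<open>\<theta>\<close>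
  for a merge, since \<open>n\<^sub>1\<close> is odd. For a split, rotating the cycle of \<open>w\<close> alone makes the sum of \<open>\<phi>\<close> over all
  factorizations vanish. The same rule shows \<open>\<theta> = 0\<close> if \<open>\<sigma>'\<close> has a cycle of even length.
\<close>

section \<open>Inversion signs of cyclic orders\<close>

text \<open>The coefficients come from counting. With \<open>N = s(p)\<close> and \<open>k\<close>
  parts, a merge lowers both \<open>N\<close> and \<open>k\<close> by 1, hence the exponent
  \<open>(N + k - 2) / 2\<close> by 1; the two equal contributions \<theta> and \<phi> supply the
  missing factor 2. A split lowers \<open>N\<close> and raises \<open>k\<close>, so the exponent
  stays, and only \<theta> survives. The factor \<open>n_i\<close> counts the elements
  \<open>w\<close> of the i-th cycle, which all lead to the same type; a split at \<open>a\<close>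
  arises from the single element reached from \<open>x\<close> in \<open>a\<close> steps. The
  obstacle is that the rows of a standard permutation have a marked beginning, whereas deleting an
  arbitrary \<open>x\<close> needs a cyclic description. On an odd subset the comparison of the two
  orders ignores where the cycles are cut, and the label \<open>r_t\<close>, inverted with all
  others, cancels the even subsets in the Gauss sum. An even subset together with an inserted
  element is odd again, whence the shape of \<phi>. Finally \<theta> also makes sense for splits
  with even parts, where no spin parity exists; so the recursion runs over all deletions and the
  even parts are discarded afterwards.\<close>

definition sb :: "bool \<Rightarrow> int" where
  "sb c = (if c then - 1 else 1)"

lemma sb_simps [simp]: "sb True = - 1" "sb False = 1" "sb c * sb c = 1" "sb c * (sb c * r) = r"
  by (simp_all add: sb_def)

lemma sb_neq: "sb (a \<noteq> b) = sb a * sb b"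
  by (simp add: sb_def)

text \<open>The product runs over ordered pairs but meets each inverted pair once, in the
  orientation that increases in \<open>P\<close>. For orders injective on \<open>W\<close> it is the
  sign of the permutation comparing them.\<close>

definition inv_sign :: "('a \<Rightarrow> nat) \<Rightarrow> ('a \<Rightarrow> nat) \<Rightarrow> 'a set \<Rightarrow> int" where
  "inv_sign P Q W = (\<Prod>a\<in>W. \<Prod>b\<in>W. sb (P a < P b \<and> Q b < Q a))"

definition crossing_pair :: "('a \<Rightarrow> nat) \<Rightarrow> ('a \<Rightarrow> nat) \<Rightarrow> 'a \<Rightarrow> 'a \<Rightarrow> bool" where
  "crossing_pair P Q a b \<longleftrightarrow> P a < P b \<and> Q b < Q a \<or> P b < P a \<and> Q a < Q b"

lemma inv_sign_empty [simp]: "inv_sign P Q {} = 1"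
  by (simp add: inv_sign_def)

lemma inv_sign_insert:
  assumes "finite W" "x \<notin> W"
  shows "inv_sign P Q (insert x W) = inv_sign P Q W * (\<Prod>b\<in>W. sb (crossing_pair P Q x b))"
proof -
  have *: "sb (crossing_pair P Q x b) = sb (P x < P b \<and> Q b < Q x) * sb (P b < P x \<and> Q x < Q b)" for b
    by (auto simp: crossing_pair_def sb_def)
  show ?thesis
    using assms unfolding inv_sign_def * by (simp add: prod.distrib mult_ac)
qed

lemma inv_sign_cong:
  assumes "finite W"
    and "\<And>a b. a \<in> W \<Longrightarrow> b \<in> W \<Longrightarrow> crossing_pair P Q a b = crossing_pair P' Q' a b"
  shows "inv_sign P Q W = inv_sign P' Q' W"
  using assms
proof (induction W)
  case (insert x W)
  have "(\<Prod>b\<in>W. sb (crossing_pair P Q x b)) = (\<Prod>b\<in>W. sb (crossing_pair P' Q' x b))"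
    using insert.prems by (intro prod.cong) auto
  with insert show ?case by (simp add: inv_sign_insert)
qed simp

lemma inv_sign_commute: "finite W \<Longrightarrow> inv_sign P Q W = inv_sign Q P W"
proof (induction W rule: finite_induct)
  case (insert x W)
  have "crossing_pair P Q x b = crossing_pair Q P x b" for b
    by (auto simp: crossing_pair_def)
  with insert show ?case by (simp add: inv_sign_insert)
qed simp

lemma inv_sign_image:
  assumes "inj_on h W"
  shows "inv_sign P Q (h ` W) = inv_sign (P \<circ> h) (Q \<circ> h) W"
  using assms by (simp add: inv_sign_def prod.reindex)

text \<open>The sign of \<open>Z\<close> together with a further element, placed just before \<open>y\<close> in the order \<open>P\<close> and just
  before \<open>w\<close> in the order \<open>Q\<close>.\<close>

definition ins_sign ::
  "('a \<Rightarrow> nat) \<Rightarrow> ('a \<Rightarrow> nat) \<Rightarrow> 'a \<Rightarrow> 'a \<Rightarrow> 'a set \<Rightarrow> int" where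
  "ins_sign P Q y w Z = inv_sign P Q Z * (\<Prod>b\<in>Z. sb (P b < P y) * sb (Q b < Q w))"

lemma ins_sign_insert:
  assumes "finite Z" "x \<notin> Z"
  shows "ins_sign P Q y w (insert x Z) =
    ins_sign P Q y w Z * sb (P x < P y) * sb (Q x < Q w) * (\<Prod>b\<in>Z. sb (crossing_pair P Q x b))"
  using assms by (simp add: ins_sign_def inv_sign_insert mult_ac)

lemma ins_sign_commute: "finite Z \<Longrightarrow> ins_sign P Q y w Z = ins_sign Q P w y Z"
  by (simp add: ins_sign_def inv_sign_commute mult.commute)

lemma ins_sign_image:
  assumes "inj_on h W"
  shows "ins_sign P Q (h y) (h w) (h ` W) = ins_sign (P \<circ> h) (Q \<circ> h) y w W"
  using assms by (simp add: ins_sign_def inv_sign_image prod.reindex)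

text \<open>A numbering opens the long cycle \<tau> into a linear order on \<open>S\<close>. The
  place of the cut is left free; the lemmas on rotations show which signs ignore it.\<close>

definition numbering :: "('a \<Rightarrow> 'a) \<Rightarrow> 'a set \<Rightarrow> ('a \<Rightarrow> nat) \<Rightarrow> bool" where
  "numbering \<tau> S P \<longleftrightarrow> finite S \<and> S \<noteq> {} \<and> bij_betw P S {..<card S}
     \<and> (\<forall>j\<in>S. \<tau> j \<in> S \<and> P (\<tau> j) = Suc (P j) mod card S)"

lemma numberingD:
  assumes "numbering \<tau> S P"
  shows "finite S" "S \<noteq> {}" "inj_on P S" "P ` S = {..<card S}"
    "\<And>j. j \<in> S \<Longrightarrow> \<tau> j \<in> S" "\<And>j. j \<in> S \<Longrightarrow> P (\<tau> j) = Suc (P j) mod card S"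
    "\<And>j. j \<in> S \<Longrightarrow> P j < card S" "card S > 0"
  using assms unfolding numbering_def bij_betw_def by (auto simp: card_gt_0_iff)

lemma mod_shift_inj:
  fixes a b c n :: nat
  assumes "a < n" "b < n" "(a + c) mod n = (b + c) mod n"
  shows "a = b"
proof -
  have "x = y" if "x \<le> y" "y < n" "(x + c) mod n = (y + c) mod n" for x y
  proof -
    have "n dvd (y + c) - (x + c)" using that mod_eq_dvd_iff_nat[of "x + c" "y + c" n] by simp
    then show ?thesis using that by (auto dest: dvd_imp_le)
  qed
  then show ?thesis using assms by (metis nat_le_linear)
qed

lemma numbering_rotate:
  assumes "numbering \<tau> S P"
  shows "numbering \<tau> S (\<lambda>j. (P j + c) mod card S)"
proof -
  note D = numberingD[OF assms]
  have inj: "inj_on (\<lambda>j. (P j + c) mod card S) S"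
  proof (rule inj_onI)
    fix a b assume "a \<in> S" "b \<in> S" "(P a + c) mod card S = (P b + c) mod card S"
    then have "P a = P b" using D(7) mod_shift_inj by blast
    then show "a = b" using D(3) \<open>a \<in> S\<close> \<open>b \<in> S\<close> by (auto simp: inj_on_def)
  qed
  have sub: "(\<lambda>j. (P j + c) mod card S) ` S \<subseteq> {..<card S}"
    using D(8) by auto
  have "(\<lambda>j. (P j + c) mod card S) ` S = {..<card S}"
    using inj sub by (simp add: card_image card_subset_eq)
  moreover have "\<tau> j \<in> S \<and> (P (\<tau> j) + c) mod card S = Suc ((P j + c) mod card S) mod card S"
    if "j \<in> S" for j
    using D(5,6)[OF that] by (simp add: mod_simps)
  ultimately show ?thesis
    using inj D(1,2) by (simp add: numbering_def bij_betw_def)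
qed

text \<open>Both numberings advance by one along \<tau>, so their difference is constant. It is
  \<open>P' s\<close>, where \<open>s\<close> is the element that \<open>P\<close> numbers
  0.\<close>

lemma numbering_unique_up_to_rotation:
  assumes "numbering \<tau> S P" "numbering \<tau> S P'"
  obtains c where "\<And>j. j \<in> S \<Longrightarrow> P' j = (P j + c) mod card S"
proof -
  note D = numberingD[OF assms(1)] and D' = numberingD[OF assms(2)]
  obtain s where s: "s \<in> S" "P s = 0"
    using D(4) D(8) by (metis image_iff lessThan_iff)
  have "\<forall>j\<in>S. P j = k \<longrightarrow> P' j = (P j + P' s) mod card S" for k
  proof (induction k)
    case 0
    then show ?case using s D(3) D'(7) by (auto simp: inj_on_def)
  next
    case (Suc k)
    show ?case
    proof (intro ballI impI)
      fix j assume j: "j \<in> S" "P j = Suc k"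
      then have "k < card S" using D(7) by fastforce
      then obtain i where i: "i \<in> S" "P i = k" using D(4) by (metis image_iff lessThan_iff)
      have "P (\<tau> i) = Suc k" using D(6)[OF i(1)] i(2) D(7)[OF j(1)] j(2) by simp
      then have ji: "j = \<tau> i" using D(3,5) i(1) j by (auto simp: inj_on_def)
      show "P' j = (P j + P' s) mod card S"
        using Suc i unfolding ji by (simp add: D(6) D'(6) mod_simps)
    qed
  qed
  then show ?thesis using that by blast
qed

lemma numbering_at:
  assumes "numbering \<tau> S P" "s \<in> S" "k < card S"
  obtains P' where "numbering \<tau> S P'" "P' s = k"
proof
  let ?c = "card S - P s + k"
  note D = numberingD[OF assms(1)]
  show "numbering \<tau> S (\<lambda>j. (P j + ?c) mod card S)"
    using assms(1) by (rule numbering_rotate)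
  show "(P s + ?c) mod card S = k"
    using D(7)[OF assms(2)] assms(3) by simp
qed

text \<open>Under a rotation an element passing from the last to the first place changes its order with all
  the others, an even number of times in a set of odd cardinality.\<close>

lemma crossing_pair_rotate:
  assumes P: "inj_on P S" "P ` S \<subseteq> {..<n}" and "inj_on Q S"
    and P': "\<And>j. j \<in> S \<Longrightarrow> P' j = Suc (P j) mod n"
    and ab: "a \<in> S" "b \<in> S" "a \<noteq> b"
  shows "sb (crossing_pair P' Q a b) =
     sb (crossing_pair P Q a b) * sb (Suc (P a) = n) * sb (Suc (P b) = n)"
proof -
  have *: "P a < n" "P b < n" "P a \<noteq> P b" "Q a \<noteq> Q b"
    using assms by (auto simp: inj_on_def)
  have "P' j = (if Suc (P j) = n then 0 else Suc (P j))" if "j \<in> S" for j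
    using that P(2) P' by (auto simp: mod_Suc)
  then have P'a: "P' a = (if Suc (P a) = n then 0 else Suc (P a))"
    and P'b: "P' b = (if Suc (P b) = n then 0 else Suc (P b))"
    using ab by blast+
  have "P' a < P' b \<longleftrightarrow> (P a < P b) \<noteq> ((Suc (P a) = n) \<noteq> (Suc (P b) = n))"
    unfolding P'a P'b using *(1-3) by (cases "Suc (P a) = n"; cases "Suc (P b) = n") auto
  moreover have "crossing_pair R Q a b \<longleftrightarrow> (R a < R b) \<noteq> (Q a < Q b)" if "R a \<noteq> R b" for R
    using that *(4) unfolding crossing_pair_def by linarith
  moreover have "P' a \<noteq> P' b"
    unfolding P'a P'b using *(1-3) by (cases "Suc (P a) = n"; cases "Suc (P b) = n") auto
  ultimately show ?thesis
    using *(3) by (auto simp: sb_def)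
qed

text \<open>Every pair in \<open>Y\<close> acquires the factors of both its elements, so the factor
  of an element occurs once for each other element of \<open>Y\<close>; this is the exponent
  \<open>card Y - 1\<close>.\<close>

lemma inv_sign_rotate1:
  assumes P: "inj_on P S" "P ` S \<subseteq> {..<n}" and Q: "inj_on Q S"
    and P': "\<And>j. j \<in> S \<Longrightarrow> P' j = Suc (P j) mod n"
    and Y: "finite Y" "Y \<subseteq> S"
  shows "inv_sign P' Q Y = inv_sign P Q Y * (\<Prod>a\<in>Y. sb (Suc (P a) = n)) ^ (card Y - 1)"
  using Y
proof (induction Y)
  case (insert x Y)
  have "(\<Prod>b\<in>Y. sb (crossing_pair P' Q x b))
    = (\<Prod>b\<in>Y. sb (crossing_pair P Q x b) * sb (Suc (P x) = n) * sb (Suc (P b) = n))"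
    using insert by (intro prod.cong crossing_pair_rotate[OF P Q P']) auto
  also have "\<dots> = (\<Prod>b\<in>Y. sb (crossing_pair P Q x b)) * sb (Suc (P x) = n) ^ card Y
      * (\<Prod>b\<in>Y. sb (Suc (P b) = n))"
    by (simp add: prod.distrib)
  finally have *: "(\<Prod>b\<in>Y. sb (crossing_pair P' Q x b)) = (\<Prod>b\<in>Y. sb (crossing_pair P Q x b)) *
      sb (Suc (P x) = n) ^ card Y * (\<Prod>b\<in>Y. sb (Suc (P b) = n))" .
  \<comment> \<open>For empty \<open>Y\<close> the truncated exponent is 0 instead of -1, so this
    case is treated apart.\<close>
  have **: "r ^ (card Y - 1) * r = r ^ card Y" if "Y \<noteq> {}" for r :: int
    using insert.hyps that by (cases "card Y") auto
  show ?case
  proof (cases "Y = {}")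
    case False
    have "inv_sign P' Q (insert x Y) = inv_sign P Q (insert x Y) * (sb (Suc (P x) = n) ^ card Y *
       ((\<Prod>a\<in>Y. sb (Suc (P a) = n)) ^ (card Y - 1) * (\<Prod>a\<in>Y. sb (Suc (P a) = n))))"
      using insert by (simp add: inv_sign_insert * mult_ac)
    also have "\<dots> = inv_sign P Q (insert x Y) * (\<Prod>a\<in>insert x Y. sb (Suc (P a) = n)) ^ card Y"
      unfolding **[OF False] using insert by (simp add: power_mult_distrib)
    finally show ?thesis using insert by simp
  qed (simp add: inv_sign_insert)
qed simp

text \<open>For odd \<open>card Y\<close> the exponent \<open>card Y - 1\<close> of the single
  rotation is even and its factor disappears; a general rotation iterates the single one.\<close>

lemma inv_sign_rotate:
  assumes P: "inj_on P S" "P ` S \<subseteq> {..<n}" and Q: "inj_on Q S"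
    and P': "\<And>j. j \<in> S \<Longrightarrow> P' j = (P j + c) mod n"
    and Y: "finite Y" "Y \<subseteq> S" "odd (card Y)"
  shows "inv_sign P' Q Y = inv_sign P Q Y"
  using P'
proof (induction c arbitrary: P')
  case 0
  have "P' j = P j" if "j \<in> Y" for j using 0 that P(2) Y(2) by fastforce
  then show ?case using Y by (intro inv_sign_cong) (simp_all add: crossing_pair_def)
next
  case (Suc c)
  let ?R = "\<lambda>j. (P j + c) mod n"
  have "Y \<noteq> {}" using Y by auto
  then have n: "0 < n" using P(2) Y(2) by auto
  have 1: "inj_on ?R S"
  proof (rule inj_onI)
    fix a b assume ab: "a \<in> S" "b \<in> S" "(P a + c) mod n = (P b + c) mod n"
    then have "P a = P b" using P(2) mod_shift_inj by blast
    then show "a = b" using P(1) ab by (auto simp: inj_on_def)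
  qed
  have 2: "?R ` S \<subseteq> {..<n}" using n by auto
  have "inv_sign P' Q Y = inv_sign ?R Q Y * (\<Prod>a\<in>Y. sb (Suc (?R a) = n)) ^ (card Y - 1)"
    using Suc.prems by (intro inv_sign_rotate1[OF 1 2 Q _ Y(1,2)]) (simp add: mod_simps)
  moreover have "(\<Prod>a\<in>Y. sb (Suc (?R a) = n)) ^ (card Y - 1) = 1"
  proof -
    have "(\<Prod>a\<in>Y. sb (Suc (?R a) = n)) \<in> {1, -1}"
      using Y(1) by (induction Y) (auto simp: sb_def)
    moreover have "even (card Y - 1)" using Y(3) by simp
    ultimately show ?thesis by (auto elim: evenE)
  qed
  ultimately show ?case using Suc.IH[of ?R] by simp
qed

text \<open>The two orders are replaced one after the other, the second by way of the symmetry of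
  the sign. From here on the sign of an odd set belongs to the pair of cycles, not to the places
  where they are cut.\<close>

lemma inv_sign_numbering:
  assumes "numbering \<tau>t S P" "numbering \<tau>t S P'" "numbering \<tau>b S Q" "numbering \<tau>b S Q'"
    and Y: "Y \<subseteq> S" "odd (card Y)"
  shows "inv_sign P Q Y = inv_sign P' Q' Y"
proof -
  have fin: "finite Y" using Y numberingD(1)[OF assms(1)] finite_subset by blast
  have *: "inv_sign P Q Y = inv_sign P' Q Y" if h: "numbering \<tau> S P" "numbering \<tau> S P'" "inj_on Q S"
    for \<tau> P P' Q
  proof -
    obtain c where "\<And>j. j \<in> S \<Longrightarrow> P' j = (P j + c) mod card S"
      using numbering_unique_up_to_rotation[OF h(1,2)] by blast
    then show ?thesis
      using numberingD(3,4)[OF h(1)] h(3) Y fin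
      by (intro inv_sign_rotate[symmetric, of P S "card S"]) simp_all
  qed
  have "inv_sign P Q Y = inv_sign P' Q Y"
    by (rule *[OF assms(1,2) numberingD(3)[OF assms(3)]])
  also have "\<dots> = inv_sign Q P' Y" using fin by (rule inv_sign_commute)
  also have "\<dots> = inv_sign Q' P' Y"
    by (rule *[OF assms(3,4) numberingD(3)[OF assms(2)]])
  also have "\<dots> = inv_sign P' Q' Y" using fin by (rule inv_sign_commute)
  finally show ?thesis .
qed

text \<open>Let \<open>t\<close> be the product of the last-place signs over \<open>Z\<close>. The
  pairs inside a nonempty \<open>Z\<close> contribute \<open>t ^ (card Z - 1)\<close>, and the
  comparisons with \<open>y\<close> contribute \<open>t\<close> once more, the sign of
  \<open>y\<close> itself occurring \<open>card Z\<close> times. All signs therefore cancel: the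
  inserted element makes the set odd.\<close>

lemma ins_sign_rotate1:
  assumes P: "inj_on P S" "P ` S \<subseteq> {..<n}" and Q: "inj_on Q S"
    and P': "\<And>j. j \<in> S \<Longrightarrow> P' j = Suc (P j) mod n"
    and Z: "finite Z" "Z \<subseteq> S" "even (card Z)" and y: "y \<in> S"
  shows "ins_sign P' Q y w Z = ins_sign P Q y w Z"
proof -
  have P'': "P' j = (if Suc (P j) = n then 0 else Suc (P j))" if "j \<in> S" for j
    using that P(2) P' by (auto simp: mod_Suc)
  have sb': "sb (P' b < P' y) = sb (P b < P y) * sb (Suc (P b) = n) * sb (Suc (P y) = n)" if "b \<in> Z" for b
  proof -
    have "b \<in> S" "P b < n" "P y < n" using that Z(2) P(2) y by auto
    moreover have "P b = P y \<longleftrightarrow> b = y" using P(1) y \<open>b \<in> S\<close> by (auto simp: inj_on_def)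
    ultimately show ?thesis using P''[OF y] P''[of b]
      by (cases "Suc (P b) = n"; cases "Suc (P y) = n") (auto simp: sb_def)
  qed
  have "(\<Prod>b\<in>Z. sb (P' b < P' y)) = (\<Prod>b\<in>Z. sb (P b < P y) * sb (Suc (P b) = n) * sb (Suc (P y) = n))"
    by (intro prod.cong sb') auto
  also have "\<dots> = (\<Prod>b\<in>Z. sb (P b < P y)) * (\<Prod>b\<in>Z. sb (Suc (P b) = n))"
    using Z(3) by (auto simp: prod.distrib sb_def elim: evenE)
  finally have *: "(\<Prod>b\<in>Z. sb (P' b < P' y)) = (\<Prod>b\<in>Z. sb (P b < P y)) * (\<Prod>b\<in>Z. sb (Suc (P b) = n))" .
  have **: "inv_sign P' Q Z = inv_sign P Q Z * (\<Prod>b\<in>Z. sb (Suc (P b) = n)) ^ (card Z - 1)"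
    by (rule inv_sign_rotate1[OF P Q P' Z(1,2)])
  show ?thesis
  proof (cases "card Z = 0")
    case False
    have "r ^ (card Z - 1) * r = (1 :: int)" if "r = 1 \<or> r = -1" for r
      using that Z(3) False by (auto simp: uminus_power_if)
    moreover have "(\<Prod>b\<in>Z. sb (Suc (P b) = n)) = 1 \<or> (\<Prod>b\<in>Z. sb (Suc (P b) = n)) = - 1"
      using Z(1) by (induction Z) (auto simp: sb_def)
    ultimately have "(\<Prod>b\<in>Z. sb (Suc (P b) = n)) ^ (card Z - 1) * (\<Prod>b\<in>Z. sb (Suc (P b) = n)) = 1"
      by blast
    then show ?thesis
      unfolding ins_sign_def prod.distrib * ** by (simp add: mult_ac)
  qed (use Z in \<open>simp add: ins_sign_def\<close>)
qed

lemma ins_sign_rotate: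
  assumes P: "inj_on P S" "P ` S \<subseteq> {..<n}" and Q: "inj_on Q S"
    and P': "\<And>j. j \<in> S \<Longrightarrow> P' j = (P j + c) mod n"
    and Z: "finite Z" "Z \<subseteq> S" "even (card Z)" and y: "y \<in> S"
  shows "ins_sign P' Q y w Z = ins_sign P Q y w Z"
  using P'
proof (induction c arbitrary: P')
  case 0
  have "P' j = P j" if "j \<in> S" for j using 0 that P(2) by fastforce
  then have "P' j = P j" if "j \<in> insert y Z" for j using that Z(2) y by blast
  moreover from this have "inv_sign P' Q Z = inv_sign P Q Z"
    using Z(1) by (intro inv_sign_cong) (simp_all add: crossing_pair_def)
  ultimately show ?case by (simp add: ins_sign_def)
next
  case (Suc c)
  let ?R = "\<lambda>j. (P j + c) mod n"
  have n: "0 < n" using P(2) y by auto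
  have 1: "inj_on ?R S"
  proof (rule inj_onI)
    fix a b assume ab: "a \<in> S" "b \<in> S" "(P a + c) mod n = (P b + c) mod n"
    then have "P a = P b" using P(2) mod_shift_inj by blast
    then show "a = b" using P(1) ab by (auto simp: inj_on_def)
  qed
  have 2: "?R ` S \<subseteq> {..<n}" using n by auto
  have "ins_sign P' Q y w Z = ins_sign ?R Q y w Z"
    using Suc.prems by (intro ins_sign_rotate1[OF 1 2 Q _ Z y]) (simp add: mod_simps)
  then show ?case using Suc.IH[of ?R] by simp
qed

lemma ins_sign_numbering:
  assumes "numbering \<tau>t S P" "numbering \<tau>t S P'" "numbering \<tau>b S Q" "numbering \<tau>b S Q'"
    and Z: "Z \<subseteq> S" "even (card Z)" and y: "y \<in> S" "w \<in> S"
  shows "ins_sign P Q y w Z = ins_sign P' Q' y w Z"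
proof -
  have fin: "finite Z" using Z numberingD(1)[OF assms(1)] finite_subset by blast
  have *: "ins_sign P Q y w Z = ins_sign P' Q y w Z"
    if h: "numbering \<tau> S P" "numbering \<tau> S P'" "inj_on Q S" "y \<in> S"
    for \<tau> P P' Q y w
  proof -
    obtain c where "\<And>j. j \<in> S \<Longrightarrow> P' j = (P j + c) mod card S"
      using numbering_unique_up_to_rotation[OF h(1,2)] by blast
    then show ?thesis
      using numberingD(3,4)[OF h(1)] h(3,4) Z fin
      by (intro ins_sign_rotate[symmetric, of P S "card S"]) simp_all
  qed
  have "ins_sign P Q y w Z = ins_sign P' Q y w Z"
    by (rule *[OF assms(1,2) numberingD(3)[OF assms(3)] y(1)])
  also have "\<dots> = ins_sign Q P' w y Z" using fin by (rule ins_sign_commute)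
  also have "\<dots> = ins_sign Q' P' w y Z"
    by (rule *[OF assms(3,4) numberingD(3)[OF assms(2)] y(2)])
  also have "\<dots> = ins_sign P' Q' y w Z" using fin by (rule ins_sign_commute)
  finally show ?thesis .
qed

section \<open>Moving an insertion point along the quotient of the two cycles\<close>

lemma even_card_sym_diff:
  assumes "finite A" "finite B"
  shows "even (card (sym_diff A B)) \<longleftrightarrow> (even (card A) \<longleftrightarrow> even (card B))"
proof -
  have "card (sym_diff A B) = card (A - B) + card (B - A)"
    using assms by (intro card_Un_disjoint) auto
  moreover have "card A = card (A - B) + card (A \<inter> B)" "card B = card (B - A) + card (A \<inter> B)"
    using assms card_Diff_subset_Int card_Int_Diff by (metis add.commute Int_commute)+
  ultimately show ?thesis by presburger
qed

lemma numbering_inj: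
  assumes "numbering \<tau> S P"
  shows "inj_on \<tau> S" "\<tau> ` S = S"
proof -
  note D = numberingD[OF assms]
  show "inj_on \<tau> S"
  proof (rule inj_onI)
    fix a b assume ab: "a \<in> S" "b \<in> S" "\<tau> a = \<tau> b"
    then have "(P a + 1) mod card S = (P b + 1) mod card S" using D(6)[of a] D(6)[of b] by simp
    then have "P a = P b" using mod_shift_inj D(7) ab by blast
    then show "a = b" using D(3) ab by (auto simp: inj_on_def)
  qed
  then show "\<tau> ` S = S"
    using D(1,5) by (intro endo_inj_surj) auto
qed

text \<open>Both cycles are cut just after \<open>m\<close>. Then \<open>m\<close> is last in both
  orders and may be added or removed freely; its membership only keeps the cardinality even.
  Further, \<open>\<tau>t m\<close> is first in the top order and the old insertion point
  \<open>\<tau>b m\<close> is first in the bottom order. Moving that point to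
  \<open>\<tau>t m\<close> changes the sign by the elements below \<open>\<tau>t m\<close> at the
  bottom, and these are exactly the ones inverted with \<open>\<tau>t m\<close>. Toggling
  \<open>\<tau>t m\<close> compensates for them, and the remaining \<open>- 1\<close> compares
  \<open>\<tau>t m\<close> with \<open>y\<close> in the top order.\<close>

lemma ins_sign_step:
  assumes t: "numbering \<tau>t S P" and b: "numbering \<tau>b S Q"
    and y: "y \<in> S" and m: "m \<in> S" and ne: "\<tau>t m \<noteq> y"
    and Z: "Z \<subseteq> S" "even (card Z)"
  shows "ins_sign P Q y (\<tau>t m) (sym_diff Z {m, \<tau>t m}) = - ins_sign P Q y (\<tau>b m) Z"
proof -
  let ?N = "card S" and ?v = "\<tau>t m" and ?w = "\<tau>b m"
  have fin: "finite S" "finite Z" using numberingD(1)[OF t] Z(1) finite_subset by blast+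
  have N: "?N - 1 < ?N" using numberingD(8)[OF t] by simp
  obtain P' where P': "numbering \<tau>t S P'" "P' m = ?N - 1" using numbering_at[OF t m N] .
  obtain Q' where Q': "numbering \<tau>b S Q'" "Q' m = ?N - 1" using numbering_at[OF b m N] .
  note DP = numberingD[OF P'(1)] and DQ = numberingD[OF Q'(1)]
  have in_S: "?v \<in> S" "?w \<in> S" using DP(5) DQ(5) m by auto
  have "card {?v, y} \<le> ?N" using in_S y fin by (intro card_mono) auto
  then have N2: "?N \<ge> 2" using ne by simp
  have v0: "P' ?v = 0" and w0: "Q' ?w = 0" using DP(6)[OF m] DQ(6)[OF m] P'(2) Q'(2) N by simp_all
  have mv: "m \<noteq> ?v" using v0 P'(2) N2 by auto
  have y0: "P' y > 0" using v0 ne y in_S DP(3) by (metis inj_on_eq_iff neq0_conv)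
  have last: "P' b \<le> P' m" "Q' b \<le> Q' m" if "b \<in> S" for b
    using DP(7)[OF that] DQ(7)[OF that] P'(2) Q'(2) by auto
  have ev: "even (card (sym_diff Z {m, ?v}))"
    using even_card_sym_diff[of Z "{m, ?v}"] fin Z(2) mv by simp
  define A where "A = Z - {m, ?v}"
  define c where "c = (\<Prod>b\<in>A. sb (Q' b < Q' ?v))"
  define a where "a = ins_sign P' Q' y ?w A"
  have A: "A \<subseteq> S" "finite A" "m \<notin> A" "?v \<notin> A" using Z(1) fin by (auto simp: A_def)
  have ins_m: "ins_sign P' Q' y u (insert m B) = ins_sign P' Q' y u B"
    if "B \<subseteq> S" "m \<notin> B" "u \<in> S" for u B
  proof -
    have "\<not> crossing_pair P' Q' m b" if "b \<in> B" for b
      using last[of b] that \<open>B \<subseteq> S\<close> by (auto simp: crossing_pair_def)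
    moreover have "finite B" using that(1) fin finite_subset by blast
    ultimately show ?thesis
      using last(1)[OF y] last(2)[OF that(3)] that(2) by (simp add: ins_sign_insert)
  qed
  have pos: "P' b > 0" if "b \<in> A" for b
    using v0 that A in_S DP(3) by (metis inj_on_eq_iff neq0_conv subsetD)
  have f: "ins_sign P' Q' y ?v A = a * c"
    using w0 by (simp add: ins_sign_def a_def c_def prod.distrib)
  have cr: "crossing_pair P' Q' ?v b = (Q' b < Q' ?v)" if "b \<in> A" for b
    using pos[OF that] v0 by (auto simp: crossing_pair_def)
  have cc: "(\<Prod>b\<in>A. sb (crossing_pair P' Q' ?v b)) = c"
    using cr by (simp add: c_def)
  have f1: "ins_sign P' Q' y ?w (insert ?v A) = - (a * c)"
    using A y0 v0 w0 by (simp add: ins_sign_insert cc a_def)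
  have "c * c = 1" unfolding c_def by (simp flip: prod.distrib)
  then have f2: "ins_sign P' Q' y ?v (insert ?v A) = - a"
    using A y0 v0 by (simp add: ins_sign_insert cc f mult.assoc)
  have "ins_sign P' Q' y ?v (sym_diff Z {m, ?v}) = - ins_sign P' Q' y ?w Z"
  proof (cases "m \<in> Z"; cases "?v \<in> Z")
    assume "m \<in> Z" "?v \<in> Z"
    then have "Z = insert m (insert ?v A)" "sym_diff Z {m, ?v} = A" by (auto simp: A_def)
    then show ?thesis using f f1 ins_m[of "insert ?v A" ?w] A in_S mv by simp
  next
    assume "m \<in> Z" "?v \<notin> Z"
    then have "Z = insert m A" "sym_diff Z {m, ?v} = insert ?v A" using mv by (auto simp: A_def)
    then show ?thesis using f2 ins_m[of A ?w] A in_S by (simp add: a_def)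
  next
    assume "m \<notin> Z" "?v \<in> Z"
    then have "Z = insert ?v A" "sym_diff Z {m, ?v} = insert m A" using mv by (auto simp: A_def)
    then show ?thesis using f f1 ins_m[of A ?v] A in_S by simp
  next
    assume "m \<notin> Z" "?v \<notin> Z"
    then have "Z = A" "sym_diff Z {m, ?v} = insert m (insert ?v A)" by (auto simp: A_def)
    then show ?thesis using f2 ins_m[of "insert ?v A" ?v] A in_S mv by (simp add: a_def)
  qed
  moreover have "ins_sign P Q y ?v (sym_diff Z {m, ?v}) = ins_sign P' Q' y ?v (sym_diff Z {m, ?v})"
    using Z(1) m in_S by (intro ins_sign_numbering[OF t P'(1) b Q'(1) _ ev y]) auto
  moreover have "ins_sign P Q y ?w Z = ins_sign P' Q' y ?w Z"
    using Z in_S by (intro ins_sign_numbering[OF t P'(1) b Q'(1) _ _ y]) auto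
  ultimately show ?thesis by simp
qed

lemma inv_sign_toggle:
  assumes "finite Z" and "\<And>b. b \<in> Z \<Longrightarrow> \<not> crossing_pair P Q e b"
  shows "inv_sign P Q (sym_diff Z {e}) = inv_sign P Q Z"
proof (cases "e \<in> Z")
  case True
  then have "Z = insert e (Z - {e})" "sym_diff Z {e} = Z - {e}" by auto
  moreover have "inv_sign P Q (insert e (Z - {e})) = inv_sign P Q (Z - {e})"
    using assms by (subst inv_sign_insert) auto
  ultimately show ?thesis by metis
next
  case False
  then have "sym_diff Z {e} = insert e Z" by auto
  then show ?thesis using assms False by (simp add: inv_sign_insert)
qed

text \<open>With both orders opened at \<open>y\<close>, the inserted element precedes everything
  and \<open>y\<close> is inverted with nothing. Toggling \<open>y\<close> is thus free, and it
  makes the cardinality odd, which permits the return to the given numberings.\<close>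

lemma ins_sign_same:
  assumes t: "numbering \<tau>t S P" and b: "numbering \<tau>b S Q"
    and y: "y \<in> S" and Z: "Z \<subseteq> S" "even (card Z)"
  shows "ins_sign P Q y y Z = inv_sign P Q (sym_diff Z {y})"
proof -
  have N: "0 < card S" using numberingD(8)[OF t] .
  have fin: "finite Z" using numberingD(1)[OF t] Z(1) finite_subset by blast
  obtain P' where P': "numbering \<tau>t S P'" "P' y = 0" using numbering_at[OF t y N] .
  obtain Q' where Q': "numbering \<tau>b S Q'" "Q' y = 0" using numbering_at[OF b y N] .
  have odd: "odd (card (sym_diff Z {y}))" using even_card_sym_diff[of Z "{y}"] fin Z by simp
  have "ins_sign P Q y y Z = ins_sign P' Q' y y Z"
    by (rule ins_sign_numbering[OF t P'(1) b Q'(1) Z y y])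
  also have "\<dots> = inv_sign P' Q' Z" using P' Q' by (simp add: ins_sign_def)
  also have "\<dots> = inv_sign P' Q' (sym_diff Z {y})"
    using P' Q' fin by (intro inv_sign_toggle[symmetric]) (auto simp: crossing_pair_def)
  also have "\<dots> = inv_sign P Q (sym_diff Z {y})"
    using Z y by (intro inv_sign_numbering[OF P'(1) t Q'(1) b _ odd]) auto
  finally show ?thesis .
qed

text \<open>Opened just after \<open>m\<close>, both orders begin at their insertion points, so the
  inserted element is inverted with nothing, while \<open>m\<close> is last in both and may be
  toggled to make the cardinality odd. This covers the case \<open>\<sigma> w = y\<close> that the
  sign rule \<open>ins_sign_step\<close> leaves out.\<close>

lemma ins_sign_succ:
  assumes t: "numbering \<tau>t S P" and b: "numbering \<tau>b S Q"
    and m: "m \<in> S" and Z: "Z \<subseteq> S" "even (card Z)"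
  shows "ins_sign P Q (\<tau>t m) (\<tau>b m) Z = inv_sign P Q (sym_diff Z {m})"
proof -
  have N: "card S - 1 < card S" using numberingD(8)[OF t] by simp
  have fin: "finite Z" using numberingD(1)[OF t] Z(1) finite_subset by blast
  obtain P' where P': "numbering \<tau>t S P'" "P' m = card S - 1" using numbering_at[OF t m N] .
  obtain Q' where Q': "numbering \<tau>b S Q'" "Q' m = card S - 1" using numbering_at[OF b m N] .
  note DP = numberingD[OF P'(1)] and DQ = numberingD[OF Q'(1)]
  have y0: "P' (\<tau>t m) = 0" "Q' (\<tau>b m) = 0" using DP(6)[OF m] DQ(6)[OF m] P'(2) Q'(2) N by simp_all
  have odd: "odd (card (sym_diff Z {m}))" using even_card_sym_diff[of Z "{m}"] fin Z by simp
  have "ins_sign P Q (\<tau>t m) (\<tau>b m) Z = ins_sign P' Q' (\<tau>t m) (\<tau>b m) Z"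
    by (rule ins_sign_numbering[OF t P'(1) b Q'(1) Z DP(5)[OF m] DQ(5)[OF m]])
  also have "\<dots> = inv_sign P' Q' Z" using y0 by (simp add: ins_sign_def)
  also have "\<dots> = inv_sign P' Q' (sym_diff Z {m})"
  proof (intro inv_sign_toggle[symmetric] fin)
    fix b assume "b \<in> Z"
    then show "\<not> crossing_pair P' Q' m b"
      using DP(7)[of b] DQ(7)[of b] P'(2) Q'(2) Z(1) by (auto simp: crossing_pair_def)
  qed
  also have "\<dots> = inv_sign P Q (sym_diff Z {m})"
    using Z m by (intro inv_sign_numbering[OF P'(1) t Q'(1) b _ odd]) auto
  finally show ?thesis .
qed

lemma orbit_enum:
  assumes "permutation f"
  shows "orbit f x = (\<lambda>i. (f ^^ i) x) ` {..<card (orbit f x)}"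
    "inj_on (\<lambda>i. (f ^^ i) x) {..<card (orbit f x)}"
    "(f ^^ card (orbit f x)) x = x" "card (orbit f x) > 0"
proof -
  have x: "x \<in> orbit f x" using assms by (rule permutation_self_in_orbit)
  note * = orbit_conv_funpow_dist1[OF x] inj_on_funpow_dist1[OF x] funpow_dist1_prop[OF x]
  have c: "card (orbit f x) = funpow_dist1 f x x"
    using *(1,2) by (metis card_image card_atLeastLessThan diff_zero)
  show "orbit f x = (\<lambda>i. (f ^^ i) x) ` {..<card (orbit f x)}" 
    unfolding c using *(1) by (simp only: atLeast0LessThan)
  show "inj_on (\<lambda>i. (f ^^ i) x) {..<card (orbit f x)}"
    unfolding c using *(2) by (simp only: atLeast0LessThan)
  show "(f ^^ card (orbit f x)) x = x" unfolding c using *(3) .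
  show "card (orbit f x) > 0" unfolding c by simp
qed

lemma numbering_no_fixpoint:
  assumes "numbering \<tau> S P" "m \<in> S" "y \<in> S" "y \<noteq> m"
  shows "\<tau> m \<noteq> m"
proof
  assume eq: "\<tau> m = m"
  note D = numberingD[OF assms(1)]
  have "card {m, y} \<le> card S" using assms D(1) by (intro card_mono) auto
  then have "card S \<ge> 2" using assms(4) by simp
  moreover have "P m = Suc (P m) mod card S" using D(6)[OF assms(2)] eq by simp
  ultimately show False using D(7)[OF assms(2)] by (cases "Suc (P m) = card S") auto
qed

text \<open>The second insertion point is moved once around the orbit of the first one. Each step is a
  translation of the even subsets that changes the sign, and the translations add up to the set below.\<close>

lemma inv_sign_orbit_shift:
  assumes t: "numbering \<tau>t S P" and b: "numbering \<tau>b S Q"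
    and \<sigma>: "\<sigma> permutes S" "\<And>j. j \<in> S \<Longrightarrow> \<sigma> (\<tau>b j) = \<tau>t j"
    and y: "y \<in> S" and Y: "Y \<subseteq> S" "odd (card Y)"
  shows "inv_sign P Q (sym_diff Y {j\<in>S. (\<tau>b j \<in> orbit \<sigma> y) \<noteq> (j \<in> orbit \<sigma> y)})
    = (- 1) ^ (card (orbit \<sigma> y) - 1) * inv_sign P Q Y"
proof -
  define n where "n = card (orbit \<sigma> y)"
  have finS: "finite S" using numberingD(1)[OF t] .
  have "permutation \<sigma>" using \<sigma>(1) finS permutation_permutes by blast
  note O = orbit_enum[OF this, of y, folded n_def]
  let ?f = "\<lambda>i. (\<sigma> ^^ i) y"
  have fS: "?f i \<in> S" for i using y \<sigma>(1) by (induction i) (auto simp: permutes_in_image)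
  have inj: "?f i = ?f j \<longleftrightarrow> i = j" if "i < n" "j < n" for i j
    using O(2) that by (auto simp: inj_on_def)
  \<comment> \<open>\<open>T\<close> collects the translations made in \<open>k\<close> steps. Step
    \<open>i\<close> toggles the element \<open>m\<close> with
    \<open>\<tau>b m = (\<sigma> ^^ i) y\<close>, and also
    \<open>\<tau>t m = (\<sigma> ^^ Suc i) y\<close>; hence the two ranges of exponents,
    \<open>{..<k}\<close> and \<open>{1..k}\<close>.\<close>
  define good where "good k T \<longleftrightarrow> T \<subseteq> S \<and> even (card T)
      \<and> (\<forall>j\<in>S. j \<in> T \<longleftrightarrow> (\<tau>b j \<in> ?f ` {..<k}) \<noteq> (j \<in> ?f ` {1..k}))
      \<and> (\<forall>Z\<subseteq>S. even (card Z) \<longrightarrow>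
            ins_sign P Q y (?f k) (sym_diff Z T) = (- 1) ^ k * ins_sign P Q y y Z)" for k T
  have goodD: "T \<subseteq> S" "even (card T)"
      "j \<in> S \<Longrightarrow> j \<in> T \<longleftrightarrow> (\<tau>b j \<in> ?f ` {..<k}) \<noteq> (j \<in> ?f ` {1..k})"
      "Z \<subseteq> S \<Longrightarrow> even (card Z) \<Longrightarrow>
            ins_sign P Q y (?f k) (sym_diff Z T) = (- 1) ^ k * ins_sign P Q y y Z"
    if "good k T" for k T j Z
    using that unfolding good_def by simp_all
  have "\<exists>T. good k T" if "k < n" for k
    using that
  proof (induction k)
    case 0
    then show ?case unfolding good_def by (intro exI[of _ "{}"]) simp
  next
    case (Suc k)
    then obtain T where gT: "good k T" by fastforce
    note T = goodD(1,2)[OF gT] and Tm = goodD(3)[OF gT] and Ti = goodD(4)[OF gT]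
    obtain m where m: "m \<in> S" "\<tau>b m = ?f k" using numbering_inj(2)[OF b] fS[of k] by (metis imageE)
    have tm: "\<tau>t m = ?f (Suc k)" using \<sigma>(2)[OF m(1)] m(2) by simp
    have ne: "\<tau>t m \<noteq> y" using inj[of "Suc k" 0] Suc.prems unfolding tm by simp
    have mv: "m \<noteq> \<tau>t m"
      using numbering_no_fixpoint[OF t m(1) y] ne by metis
    have finT: "finite T" using T finS finite_subset by blast
    let ?T = "sym_diff T {m, \<tau>t m}"
    have "even (card ?T)"
      using even_card_sym_diff[of T "{m, \<tau>t m}"] finT T mv by simp
    moreover have "?T \<subseteq> S" using T m numberingD(5)[OF t m(1)] by auto
    moreover have "j \<in> ?T \<longleftrightarrow> (\<tau>b j \<in> ?f ` {..<Suc k}) \<noteq> (j \<in> ?f ` {1..Suc k})" if j: "j \<in> S" for j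
    proof -
      have 1: "\<tau>b j \<in> ?f ` {..<Suc k} \<longleftrightarrow> (\<tau>b j \<in> ?f ` {..<k}) \<noteq> (j = m)"
      proof -
        have "j = m \<longleftrightarrow> \<tau>b j = ?f k" using numbering_inj(1)[OF b] m j by (auto simp: inj_on_def)
        moreover have "?f k \<notin> ?f ` {..<k}"
        proof
          assume "?f k \<in> ?f ` {..<k}"
          then obtain i where "i < k" "?f k = ?f i" by blast
          then show False using inj[of k i] Suc.prems by simp
        qed
        moreover have "?f ` {..<Suc k} = insert (?f k) (?f ` {..<k})" by (simp add: lessThan_Suc)
        ultimately show ?thesis by (metis insert_iff)
      qed
      have 2: "j \<in> ?f ` {1..Suc k} \<longleftrightarrow> (j \<in> ?f ` {1..k}) \<noteq> (j = \<tau>t m)"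
      proof -
        have "?f (Suc k) \<notin> ?f ` {1..k}"
        proof
          assume "?f (Suc k) \<in> ?f ` {1..k}"
          then obtain i where "i \<in> {1..k}" "?f (Suc k) = ?f i" by blast
          then show False using inj[of "Suc k" i] Suc.prems by (simp del: funpow.simps)
        qed
        moreover have "?f ` {1..Suc k} = insert (?f (Suc k)) (?f ` {1..k})"
          by (simp add: atLeastAtMostSuc_conv del: funpow.simps)
        ultimately show ?thesis unfolding tm by (metis insert_iff)
      qed
      show ?thesis unfolding 1 2 using Tm[OF j] mv by auto
    qed
    moreover have "ins_sign P Q y (?f (Suc k)) (sym_diff Z ?T) = (- 1) ^ Suc k * ins_sign P Q y y Z"
      if Z: "Z \<subseteq> S" "even (card Z)" for Z
    proof -
      have "finite Z" using Z finS finite_subset by blast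
      then have "even (card (sym_diff Z T))" using even_card_sym_diff[OF _ finT] T(2) Z(2) by blast
      moreover have "sym_diff Z T \<subseteq> S" using Z T by auto
      ultimately have "ins_sign P Q y (\<tau>t m) (sym_diff (sym_diff Z T) {m, \<tau>t m})
          = - ins_sign P Q y (\<tau>b m) (sym_diff Z T)"
        by (intro ins_sign_step[OF t b y m(1) ne])
      moreover have "sym_diff (sym_diff Z T) {m, \<tau>t m} = sym_diff Z ?T" by auto
      ultimately show ?thesis using Ti[OF Z] m(2) tm by simp
    qed
    ultimately have "good (Suc k) ?T" unfolding good_def by simp
    then show ?case ..
  qed
  \<comment> \<open>One more step would return to \<open>y\<close>, the case excluded by the sign
    rule. The loop is closed instead by the two direct evaluations: \<open>ins_sign_same\<close> at
    its beginning and \<open>ins_sign_succ\<close> at its end.\<close>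
  from this[of "n - 1"] O(4) obtain T where gT: "good (n - 1) T" by auto
  note T = goodD(1,2)[OF gT] and Tm = goodD(3)[OF gT] and Ti = goodD(4)[OF gT]
  obtain m where m: "m \<in> S" "\<tau>b m = ?f (n - 1)" using numbering_inj(2)[OF b] fS[of "n - 1"] by (metis imageE)
  have "\<tau>t m = ?f (Suc (n - 1))" using \<sigma>(2)[OF m(1)] m(2) by simp
  then have tm: "\<tau>t m = y" using O(3,4) by simp
  let ?Z = "sym_diff Y {y}"
  have finY: "finite Y" "finite T" using Y T finS finite_subset by blast+
  have Z: "?Z \<subseteq> S" "even (card ?Z)" using y Y even_card_sym_diff[of Y "{y}"] finY by auto
  have ZT: "sym_diff ?Z T \<subseteq> S" "even (card (sym_diff ?Z T))"
    using Z T even_card_sym_diff[of ?Z T] finY by auto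
  \<comment> \<open>The toggles of \<open>y\<close> at the beginning and of \<open>m\<close> at the
    end supply the exponents 0 and \<open>n - 1\<close> that \<open>T\<close> lacks, so both ranges
    become the whole orbit.\<close>
  have "sym_diff Y {j\<in>S. (\<tau>b j \<in> orbit \<sigma> y) \<noteq> (j \<in> orbit \<sigma> y)} = sym_diff (sym_diff ?Z T) {m}"
  proof -
    have "j \<in> {j\<in>S. (\<tau>b j \<in> orbit \<sigma> y) \<noteq> (j \<in> orbit \<sigma> y)}
       \<longleftrightarrow> j \<in> sym_diff (sym_diff {y} T) {m}" for j
    proof (cases "j \<in> S")
      case True
      have jm: "j = m \<longleftrightarrow> \<tau>b j = ?f (n - 1)" using numbering_inj(1)[OF b] m True by (auto simp: inj_on_def)
      have e: "insert (n - 1) {..<n - 1} = {..<n}" "insert 0 {1..n - 1} = {..<n}" using O(4) by auto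
      have "orbit \<sigma> y = ?f ` insert (n - 1) {..<n - 1}" "orbit \<sigma> y = ?f ` insert 0 {1..n - 1}"
        unfolding e by (rule O(1))+
      then have "orbit \<sigma> y = insert (?f (n - 1)) (?f ` {..<n - 1})" "orbit \<sigma> y = insert (?f 0) (?f ` {1..n - 1})"
        by (simp_all only: image_insert)
      moreover have "?f (n - 1) \<notin> ?f ` {..<n - 1}"
      proof
        assume "?f (n - 1) \<in> ?f ` {..<n - 1}"
        then obtain i where i: "i < n - 1" "?f (n - 1) = ?f i" by blast
        then have "n - 1 < n" "i < n" by simp_all
        then show False using inj i by (metis less_irrefl)
      qed
      moreover have "?f 0 \<notin> ?f ` {1..n - 1}"
      proof
        assume "?f 0 \<in> ?f ` {1..n - 1}"
        then obtain i where i: "i \<in> {1..n - 1}" "?f 0 = ?f i" by blast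
        then have "0 < n" "i < n" "i \<noteq> 0" by auto
        then show False using inj i(2) by metis
      qed
      ultimately have "\<tau>b j \<in> orbit \<sigma> y \<longleftrightarrow> (j = m) \<noteq> (\<tau>b j \<in> ?f ` {..<n - 1})"
        "j \<in> orbit \<sigma> y \<longleftrightarrow> (j = y) \<noteq> (j \<in> ?f ` {1..n - 1})"
        unfolding jm funpow_0 by (metis insert_iff)+
      then show ?thesis using Tm[OF True] True by blast
    qed (use m y T in blast)
    then show ?thesis by blast
  qed
  then have "inv_sign P Q (sym_diff Y {j\<in>S. (\<tau>b j \<in> orbit \<sigma> y) \<noteq> (j \<in> orbit \<sigma> y)})
     = ins_sign P Q (\<tau>t m) (\<tau>b m) (sym_diff ?Z T)"
    using ins_sign_succ[OF t b m(1) ZT] by simp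
  also have "\<dots> = (- 1) ^ (n - 1) * ins_sign P Q y y ?Z"
    unfolding tm m(2) using Ti[OF Z] .
  also have "ins_sign P Q y y ?Z = inv_sign P Q (sym_diff ?Z {y})"
    using ins_sign_same[OF t b y Z] .
  also have "sym_diff ?Z {y} = Y" by auto
  finally show ?thesis unfolding n_def .
qed

section \<open>Signs summed over the odd and over the even subsets\<close>

definition theta :: "('a \<Rightarrow> nat) \<Rightarrow> ('a \<Rightarrow> nat) \<Rightarrow> 'a set \<Rightarrow> int" where
  "theta P Q S = (\<Sum>Y | Y \<subseteq> S \<and> odd (card Y). inv_sign P Q Y)"

definition phi :: "('a \<Rightarrow> nat) \<Rightarrow> ('a \<Rightarrow> nat) \<Rightarrow> 'a set \<Rightarrow> 'a \<Rightarrow> 'a \<Rightarrow> int" where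
  "phi P Q S y w = (\<Sum>Z | Z \<subseteq> S \<and> even (card Z). ins_sign P Q y w Z)"

lemma theta_numbering:
  assumes "numbering \<tau>t S P" "numbering \<tau>t S P'" "numbering \<tau>b S Q" "numbering \<tau>b S Q'"
  shows "theta P Q S = theta P' Q' S"
  unfolding theta_def using inv_sign_numbering[OF assms] by (intro sum.cong) auto

lemma phi_numbering:
  assumes "numbering \<tau>t S P" "numbering \<tau>t S P'" "numbering \<tau>b S Q" "numbering \<tau>b S Q'"
    and "y \<in> S" "w \<in> S"
  shows "phi P Q S y w = phi P' Q' S y w"
  unfolding phi_def using ins_sign_numbering[OF assms(1-4) _ _ assms(5,6)] by (intro sum.cong) auto

lemma sum_subsets_image:
  assumes "inj_on h S"
  shows "(\<Sum>Y | Y \<subseteq> h ` S \<and> R (card Y). f Y) = (\<Sum>Y | Y \<subseteq> S \<and> R (card Y). f (h ` Y))"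
proof -
  have c: "card (h ` Y) = card Y" if "Y \<subseteq> S" for Y
    using that assms by (meson card_image inj_on_subset)
  have "{Y. Y \<subseteq> h ` S \<and> R (card Y)} = image h ` {Y. Y \<subseteq> S \<and> R (card Y)}"
    using c by (auto simp: subset_image_iff)
  moreover have "inj_on (image h) {Y. Y \<subseteq> S \<and> R (card Y)}"
    by (rule inj_on_subset[OF inj_on_image_Pow[OF assms]]) auto
  ultimately show ?thesis by (simp add: sum.reindex)
qed

lemma theta_image:
  assumes "inj_on h S"
  shows "theta P Q (h ` S) = theta (P \<circ> h) (Q \<circ> h) S"
proof -
  have "inv_sign P Q (h ` Y) = inv_sign (P \<circ> h) (Q \<circ> h) Y" if "Y \<subseteq> S" for Y
    using inj_on_subset[OF assms that] by (rule inv_sign_image)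
  then show ?thesis
    unfolding theta_def sum_subsets_image[OF assms, where R = odd] by (intro sum.cong) simp_all
qed

lemma phi_image:
  assumes "inj_on h S"
  shows "phi P Q (h ` S) (h y) (h w) = phi (P \<circ> h) (Q \<circ> h) S y w"
proof -
  have "ins_sign P Q (h y) (h w) (h ` Y) = ins_sign (P \<circ> h) (Q \<circ> h) y w Y" if "Y \<subseteq> S" for Y
    using inj_on_subset[OF assms that] by (rule ins_sign_image)
  then show ?thesis
    unfolding phi_def sum_subsets_image[OF assms, where R = even] by (intro sum.cong) simp_all
qed

text \<open>Toggling the two distinct elements \<open>m\<close> and \<open>\<tau>t m\<close> is an
  involution on the even subsets, so the sign rule for single subsets survives summation.\<close>

lemma phi_step:
  assumes t: "numbering \<tau>t S P" and b: "numbering \<tau>b S Q"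
    and y: "y \<in> S" and m: "m \<in> S" and ne: "\<tau>t m \<noteq> y"
  shows "phi P Q S y (\<tau>t m) = - phi P Q S y (\<tau>b m)"
proof -
  have mv: "m \<noteq> \<tau>t m" using numbering_no_fixpoint[OF t m y] ne by metis
  have tS: "\<tau>t m \<in> S" using numberingD(5)[OF t m] .
  have fin: "finite Z" if "Z \<subseteq> S" for Z using that numberingD(1)[OF t] finite_subset by blast
  have *: "sym_diff Z {m, \<tau>t m} \<subseteq> S \<and> even (card (sym_diff Z {m, \<tau>t m}))"
    if "Z \<subseteq> S" "even (card Z)" for Z
    using even_card_sym_diff[of Z "{m, \<tau>t m}"] fin that m tS mv by auto
  have "phi P Q S y (\<tau>t m) = (\<Sum>Z | Z \<subseteq> S \<and> even (card Z). - ins_sign P Q y (\<tau>b m) Z)"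
    unfolding phi_def
  proof (rule sum.reindex_bij_witness[where i = "\<lambda>Z. sym_diff Z {m, \<tau>t m}" and j = "\<lambda>Z. sym_diff Z {m, \<tau>t m}"])
    fix Z assume Z: "Z \<in> {Z. Z \<subseteq> S \<and> even (card Z)}"
    then have Z': "sym_diff Z {m, \<tau>t m} \<subseteq> S" "even (card (sym_diff Z {m, \<tau>t m}))" using * by blast+
    show e: "sym_diff (sym_diff Z {m, \<tau>t m}) {m, \<tau>t m} = Z" by auto
    show "sym_diff Z {m, \<tau>t m} \<in> {Z. Z \<subseteq> S \<and> even (card Z)}" using Z' by simp
    show "- ins_sign P Q y (\<tau>b m) (sym_diff Z {m, \<tau>t m}) = ins_sign P Q y (\<tau>t m) Z"
      using ins_sign_step[OF t b y m ne Z'] unfolding e by simp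
  qed (use * in blast | auto)+
  then show ?thesis by (simp add: phi_def sum_negf)
qed

text \<open>Toggling \<open>m\<close> exchanges even and odd subsets, which turns the sum over
  insertions into \<open>theta\<close>.\<close>

lemma phi_succ:
  assumes t: "numbering \<tau>t S P" and b: "numbering \<tau>b S Q" and m: "m \<in> S"
  shows "phi P Q S (\<tau>t m) (\<tau>b m) = theta P Q S"
proof -
  have fin: "finite Z" if "Z \<subseteq> S" for Z using that numberingD(1)[OF t] finite_subset by blast
  have *: "even (card (sym_diff Z {m})) \<longleftrightarrow> odd (card Z)" if "Z \<subseteq> S" for Z
    using even_card_sym_diff[of Z "{m}"] fin that by simp
  show ?thesis unfolding phi_def theta_def
  proof (rule sum.reindex_bij_witness[where i = "\<lambda>Z. sym_diff Z {m}" and j = "\<lambda>Z. sym_diff Z {m}"])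
    fix Z assume Z: "Z \<in> {Z. Z \<subseteq> S \<and> even (card Z)}"
    show "inv_sign P Q (sym_diff Z {m}) = ins_sign P Q (\<tau>t m) (\<tau>b m) Z"
      using ins_sign_succ[OF t b m] Z by simp
    show "sym_diff Z {m} \<in> {Y. Y \<subseteq> S \<and> odd (card Y)}" using * Z m by auto
    show "sym_diff (sym_diff Z {m}) {m} = Z" by auto
  next
    fix Z assume Z: "Z \<in> {Z. Z \<subseteq> S \<and> odd (card Z)}"
    show "sym_diff Z {m} \<in> {Y. Y \<subseteq> S \<and> even (card Y)}" using * Z m by auto
    show "sym_diff (sym_diff Z {m}) {m} = Z" by auto
  qed
qed

text \<open>The set is the symmetric difference of \<open>g\<close> and its preimage under the
  bijection \<tau>, two sets of equal size.\<close>

lemma even_card_boundary: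
  assumes b: "numbering \<tau> S Q" and g: "g \<subseteq> S"
  shows "even (card {j\<in>S. (\<tau> j \<in> g) \<noteq> (j \<in> g)})"
proof -
  have fin: "finite S" using numberingD(1)[OF b] .
  have "bij_betw \<tau> {j\<in>S. \<tau> j \<in> g} g"
    unfolding bij_betw_def
  proof
    show "inj_on \<tau> {j\<in>S. \<tau> j \<in> g}" by (rule inj_on_subset[OF numbering_inj(1)[OF b]]) auto
    show "\<tau> ` {j \<in> S. \<tau> j \<in> g} = g" using numbering_inj(2)[OF b] g by (auto 0 4)
  qed
  then have "card {j\<in>S. \<tau> j \<in> g} = card g" by (rule bij_betw_same_card)
  moreover have "{j\<in>S. (\<tau> j \<in> g) \<noteq> (j \<in> g)} = sym_diff {j\<in>S. \<tau> j \<in> g} g" using g by auto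
  moreover have "finite g" "finite {j\<in>S. \<tau> j \<in> g}" using g fin finite_subset by auto
  ultimately show ?thesis using even_card_sym_diff[of "{j\<in>S. \<tau> j \<in> g}" g] by simp
qed

text \<open>Going once around an orbit of even length takes an odd number of sign changes. The
  resulting translation by \<open>V\<close> is an involution on the odd subsets that reverses every
  sign.\<close>

lemma theta_even_orbit:
  assumes t: "numbering \<tau>t S P" and b: "numbering \<tau>b S Q"
    and \<sigma>: "\<sigma> permutes S" "\<And>j. j \<in> S \<Longrightarrow> \<sigma> (\<tau>b j) = \<tau>t j"
    and y: "y \<in> S" and ev: "even (card (orbit \<sigma> y))"
  shows "theta P Q S = 0"
proof -
  define V where "V = {j\<in>S. (\<tau>b j \<in> orbit \<sigma> y) \<noteq> (j \<in> orbit \<sigma> y)}"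
  have finS: "finite S" using numberingD(1)[OF t] .
  have "permutation \<sigma>" using \<sigma>(1) finS permutation_permutes by blast
  then have "card (orbit \<sigma> y) > 0" by (rule orbit_enum(4))
  then have sg: "(- 1 :: int) ^ (card (orbit \<sigma> y) - 1) = - 1" using ev by simp
  have VS: "V \<subseteq> S" by (auto simp: V_def)
  have shift: "inv_sign P Q (sym_diff Y V) = - inv_sign P Q Y" if "Y \<subseteq> S" "odd (card Y)" for Y
    using inv_sign_orbit_shift[OF t b \<sigma> y that] sg unfolding V_def by simp
  have "even (card V)"
    unfolding V_def using permutes_orbit_subset[OF \<sigma>(1) y] by (rule even_card_boundary[OF b])
  then have odd: "odd (card (sym_diff Y V)) \<longleftrightarrow> odd (card Y)" if "Y \<subseteq> S" for Y
    using even_card_sym_diff[of Y V] that VS finS finite_subset by blast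
  have "theta P Q S = (\<Sum>Y | Y \<subseteq> S \<and> odd (card Y). - inv_sign P Q Y)"
    unfolding theta_def
  proof (rule sum.reindex_bij_witness[where i = "\<lambda>Y. sym_diff Y V" and j = "\<lambda>Y. sym_diff Y V"])
    fix Y assume Y: "Y \<in> {Y. Y \<subseteq> S \<and> odd (card Y)}"
    show "sym_diff (sym_diff Y V) V = Y" by auto
    show "sym_diff Y V \<in> {Y. Y \<subseteq> S \<and> odd (card Y)}" using odd Y VS by auto
    show "- inv_sign P Q (sym_diff Y V) = inv_sign P Q Y" using shift Y by simp
  qed (use odd VS in auto)
  then show ?thesis by (simp add: theta_def sum_negf)
qed

section \<open>Inserting an element into a long cycle and deleting it\<close>

lemma bij_betw_lessThan_card:
  assumes "finite S" "inj_on f S" "f ` S \<subseteq> {..<card S}"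
  shows "bij_betw f S {..<card S}"
  unfolding bij_betw_def using assms by (metis card_image card_lessThan card_subset_eq finite_lessThan)

lemma numbering_conjugate:
  assumes n: "numbering \<tau> S P" and h: "bij_betw h S S'"
    and c: "\<And>j. j \<in> S \<Longrightarrow> \<tau>' (h j) = h (\<tau> j)" and P: "\<And>j. j \<in> S \<Longrightarrow> P' (h j) = P j"
  shows "numbering \<tau>' S' P'"
proof -
  note D = numberingD[OF n]
  have S': "S' = h ` S" and inj: "inj_on h S" using h by (auto simp: bij_betw_def)
  have card: "card S' = card S" using h bij_betw_same_card by metis
  have "inj_on P' S'"
  proof (rule inj_onI)
    fix a b assume ab: "a \<in> S'" "b \<in> S'" "P' a = P' b"
    then obtain i j where ij: "i \<in> S" "a = h i" "j \<in> S" "b = h j" unfolding S' by blast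
    then have "P i = P j" using ab(3) P by metis
    then show "a = b" using D(3) ij by (metis inj_onD)
  qed
  moreover have "P' ` S' = P ` S"
    unfolding S' image_image using P by (intro image_cong) auto
  ultimately have "bij_betw P' S' {..<card S'}" using D(4) card by (simp add: bij_betw_def)
  moreover have "\<tau>' i \<in> S' \<and> P' (\<tau>' i) = Suc (P' i) mod card S'" if i: "i \<in> S'" for i
  proof -
    obtain j where j: "j \<in> S" "i = h j" using i unfolding S' by blast
    have "\<tau>' i = h (\<tau> j)" "h (\<tau> j) \<in> S'" using c[OF j(1)] D(5)[OF j(1)] j(2) S' by auto
    then show ?thesis using D(6)[OF j(1)] P[OF j(1)] P[OF D(5)[OF j(1)]] card j(2) by simp
  qed
  moreover have "finite S'" "S' \<noteq> {}" using D(1,2) S' by auto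
  ultimately show ?thesis by (simp add: numbering_def)
qed

text \<open>The transposition redirects the old predecessor of \<open>w\<close> to \<open>x\<close>
  and sends \<open>x\<close> to \<open>w\<close>. Accordingly \<open>x\<close> takes over the number
  of \<open>w\<close>, and everything from \<open>w\<close> on moves up by one.\<close>

lemma numbering_insert:
  assumes n: "numbering \<tau> S P" and x: "x \<notin> S" and w: "w \<in> S" and fx: "\<tau> x = x"
  shows "numbering (transpose x w \<circ> \<tau>) (insert x S)
    (\<lambda>b. if b = x then P w else if P b < P w then P b else Suc (P b))" (is "numbering ?\<tau> ?S ?P")
proof -
  note D = numberingD[OF n]
  have card: "card ?S = Suc (card S)" using x D(1) by simp
  have "inj_on ?P ?S"
  proof (rule inj_onI)
    fix a b assume ab: "a \<in> ?S" "b \<in> ?S" "?P a = ?P b"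
    have "P a = P b \<Longrightarrow> a = b" if "a \<in> S" "b \<in> S" using D(3) that by (auto simp: inj_on_def)
    then show "a = b"
      using ab by (auto split: if_splits)
  qed
  moreover have "?P ` ?S \<subseteq> {..<card ?S}"
    using D(7) w unfolding card by (auto simp: less_Suc_eq)
  ultimately have "bij_betw ?P ?S {..<card ?S}"
    using D(1) by (intro bij_betw_lessThan_card) auto
  moreover have "?\<tau> j \<in> ?S \<and> ?P (?\<tau> j) = Suc (?P j) mod card ?S" if j: "j \<in> ?S" for j
  proof (cases "j = x")
    case True
    then show ?thesis using fx w x D(7)[OF w] card by auto
  next
    case False
    then have jS: "j \<in> S" using j by simp
    note j = D(5,6,7)[OF jS]
    show ?thesis
    proof (cases "\<tau> j = w")
      case True
      then have "?\<tau> j = x" by simp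
      moreover have "P w = Suc (P j) mod card S" using j True by simp
      ultimately show ?thesis
        using j(3) D(7)[OF w] False card by (cases "Suc (P j) = card S") auto
    next
      case neq: False
      have "\<tau> j \<noteq> x" using j x by auto
      then have t: "?\<tau> j = \<tau> j" using neq by simp
      have "P (\<tau> j) \<noteq> P w" using neq D(3) j(1) w by (auto simp: inj_on_def)
      then show ?thesis
        using j \<open>\<tau> j \<noteq> x\<close> False card D(7)[OF w] unfolding t
        by (cases "Suc (P j) = card S") auto
    qed
  qed
  ultimately show ?thesis using D(1) by (simp add: numbering_def)
qed

text \<open>The transposition makes the predecessor of \<open>x\<close> skip to
  \<open>\<tau> x\<close> and leaves \<open>x\<close> fixed. As \<open>x\<close> is not a fixed
  point of \<tau>, the remaining set is nonempty.\<close>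

lemma numbering_delete:
  assumes n: "numbering \<tau> (insert x S) P" and x: "x \<notin> S" and fx: "\<tau> x \<noteq> x"
  shows "numbering (transpose x (\<tau> x) \<circ> \<tau>) S (\<lambda>b. if P b < P x then P b else P b - 1)"
    (is "numbering ?\<tau> S ?P")
proof -
  note D = numberingD[OF n]
  have fin: "finite S" using D(1) by simp
  have card: "card (insert x S) = Suc (card S)" using x fin by simp
  have ne: "S \<noteq> {}" using D(5)[of x] fx by auto
  then have cpos: "0 < card S" using fin by (simp add: card_gt_0_iff)
  have nx: "P b \<noteq> P x" if "b \<in> S" for b using D(3) x that by (auto simp: inj_on_def)
  have "inj_on ?P S"
  proof (rule inj_onI)
    fix a b assume ab: "a \<in> S" "b \<in> S" "?P a = ?P b"
    have "P a = P b" using ab(3) nx[OF ab(1)] nx[OF ab(2)] by (auto split: if_splits)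
    then show "a = b" using D(3) ab by (auto simp: inj_on_def)
  qed
  moreover have "?P ` S \<subseteq> {..<card S}"
  proof
    fix k assume "k \<in> ?P ` S"
    then obtain b where b: "b \<in> S" "k = ?P b" by blast
    then show "k \<in> {..<card S}" using D(7)[of b] D(7)[of x] nx[OF b(1)] card by auto
  qed
  ultimately have "bij_betw ?P S {..<card S}"
    by (rule bij_betw_lessThan_card[OF fin])
  moreover have "?\<tau> j \<in> S \<and> ?P (?\<tau> j) = Suc (?P j) mod card S" if j: "j \<in> S" for j
  proof -
    have jx: "j \<noteq> x" using j x by auto
    have Pj: "\<tau> j \<in> insert x S" "P (\<tau> j) = Suc (P j) mod Suc (card S)" "P j < Suc (card S)"
      using D(5,6,7)[of j] j card by auto
    have Px: "\<tau> x \<in> S" "P (\<tau> x) = Suc (P x) mod Suc (card S)" "P x < Suc (card S)"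
      using D(5,6,7)[of x] fx card by auto
    note nx' = nx[OF j]
    show ?thesis
    proof (cases "\<tau> j = x")
      case True
      then have t: "?\<tau> j = \<tau> x" by simp
      show ?thesis
        unfolding t using Pj Px nx' True nx[OF Px(1)] cpos
        by (cases "Suc (P j) = Suc (card S)"; cases "Suc (P x) = Suc (card S)") auto
    next
      case False
      have "\<tau> j \<noteq> \<tau> x" using numbering_inj(1)[OF n] j jx by (auto simp: inj_on_def)
      then have t: "?\<tau> j = \<tau> j" using False by simp
      have tS: "\<tau> j \<in> S" using False Pj by auto
      show ?thesis
        unfolding t using Pj Px nx' nx[OF tS] tS cpos
        by (cases "Suc (P j) = Suc (card S)") auto
    qed
  qed
  ultimately show ?thesis using fin ne by (simp add: numbering_def)
qed

text \<open>An odd subset either avoids \<open>x\<close> or consists of \<open>x\<close> and an even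
  subset of \<open>S\<close>. Making room for \<open>x\<close> preserves the orders on
  \<open>S\<close>, and \<open>x\<close> is inverted with \<open>b\<close> exactly if
  \<open>b\<close> precedes one of the insertion points \<open>y\<close>, \<open>w\<close> in its
  order but not the other.\<close>

lemma theta_insert:
  assumes t: "inj_on P S" and b: "inj_on Q S" and fin: "finite S" and x: "x \<notin> S"
    and P': "\<And>b. P' b = (if b = x then P y else if P b < P y then P b else Suc (P b))"
    and Q': "\<And>b. Q' b = (if b = x then Q w else if Q b < Q w then Q b else Suc (Q b))"
  shows "theta P' Q' (insert x S) = theta P Q S + phi P Q S y w"
proof -
  have cr: "crossing_pair P' Q' a b = crossing_pair P Q a b" if "a \<noteq> x" "b \<noteq> x" for a b
    using that unfolding crossing_pair_def P' Q' by auto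
  have crx: "crossing_pair P' Q' x b \<longleftrightarrow> (P b < P y) \<noteq> (Q b < Q w)" if "b \<noteq> x" for b
    using that unfolding crossing_pair_def P' Q' by auto
  have eq: "inv_sign P' Q' Y = inv_sign P Q Y" if "Y \<subseteq> S" for Y
    using that fin x by (intro inv_sign_cong cr) (auto intro: finite_subset)
  have ins: "inv_sign P' Q' (insert x Z) = ins_sign P Q y w Z" if Z: "Z \<subseteq> S" for Z
  proof -
    have "finite Z" "x \<notin> Z" using Z fin x finite_subset by auto
    moreover from this have "(\<Prod>b\<in>Z. sb (crossing_pair P' Q' x b)) = (\<Prod>b\<in>Z. sb (P b < P y) * sb (Q b < Q w))"
    proof (intro prod.cong refl)
      fix b assume "x \<notin> Z" "b \<in> Z"
      then have "b \<noteq> x" by blast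
      show "sb (crossing_pair P' Q' x b) = sb (P b < P y) * sb (Q b < Q w)"
        unfolding crx[OF \<open>b \<noteq> x\<close>] by (rule sb_neq)
    qed
    ultimately show ?thesis by (simp add: inv_sign_insert ins_sign_def eq[OF Z])
  qed
  have "{Y. Y \<subseteq> insert x S \<and> odd (card Y)} =
      {Y. Y \<subseteq> S \<and> odd (card Y)} \<union> insert x ` {Z. Z \<subseteq> S \<and> even (card Z)}" (is "?L = ?A \<union> ?B")
  proof
    show "?L \<subseteq> ?A \<union> ?B"
    proof
      fix Y assume Y: "Y \<in> ?L"
      show "Y \<in> ?A \<union> ?B"
      proof (cases "x \<in> Y")
        case True
        have "finite Y" using Y fin finite_subset by auto
        then have "card Y = Suc (card (Y - {x}))" using True by (metis card_Suc_Diff1)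
        then have "Y - {x} \<in> {Z. Z \<subseteq> S \<and> even (card Z)}" using Y by auto
        moreover have "Y = insert x (Y - {x})" using True by auto
        ultimately show ?thesis by blast
      qed (use Y in auto)
    qed
    have "odd (card (insert x Z))" if "Z \<subseteq> S" "even (card Z)" for Z
    proof -
      have "finite Z" "x \<notin> Z" using that x fin finite_subset by auto
      then show ?thesis using that by simp
    qed
    then show "?A \<union> ?B \<subseteq> ?L" by auto
  qed
  moreover have "?A \<inter> ?B = {}" using x by auto
  moreover have "inj_on (insert x) {Z. Z \<subseteq> S \<and> even (card Z)}"
    using x by (intro inj_onI) (metis insert_ident mem_Collect_eq subsetD)
  moreover have "finite ?A" "finite ?B" using fin by auto
  ultimately have "theta P' Q' (insert x S) = (\<Sum>Y\<in>?A. inv_sign P' Q' Y) + (\<Sum>Z | Z \<subseteq> S \<and> even (card Z). inv_sign P' Q' (insert x Z))"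
    unfolding theta_def by (simp add: sum.union_disjoint sum.reindex)
  also have "\<dots> = theta P Q S + phi P Q S y w"
    unfolding theta_def phi_def using eq ins by (intro arg_cong2[where f = "(+)"] sum.cong) auto
  finally show ?thesis .
qed

lemma numbering_imp_cyclic_on:
  assumes "numbering \<tau> S P"
  shows "cyclic_on \<tau> S"
proof -
  note D = numberingD[OF assms]
  obtain s where s: "s \<in> S" "P s = 0" using D(4,8) by (metis imageE lessThan_iff)
  have *: "\<forall>j\<in>S. P j = k \<longrightarrow> j = (\<tau> ^^ k) s" for k
  proof (induction k)
    case 0
    then show ?case using s D(3) by (auto simp: inj_on_def)
  next
    case (Suc k)
    show ?case
    proof (intro ballI impI)
      fix j assume j: "j \<in> S" "P j = Suc k"
      then have "k < card S" using D(7)[OF j(1)] by simp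
      then obtain i where i: "i \<in> S" "P i = k" using D(4) by (metis imageE lessThan_iff)
      have "P (\<tau> i) = P j" using D(6)[OF i(1)] i(2) D(7)[OF j(1)] j(2) by simp
      then have "j = \<tau> i" using D(3) D(5)[OF i(1)] j(1) by (auto simp: inj_on_def)
      then show "j = (\<tau> ^^ Suc k) s" using Suc i by auto
    qed
  qed
  have sub: "(\<tau> ^^ k) s \<in> S" for k using s D(5) by (induction k) auto
  have "s \<in> orbit \<tau> s"
  proof -
    obtain j where j: "j \<in> S" "P j = card S - 1" using D(4,8)
      by (metis diff_less imageE lessThan_iff zero_less_one)
    then have "P (\<tau> j) = P s" using D(6)[OF j(1)] s D(8) by simp
    then have "\<tau> j = s" using D(3) D(5)[OF j(1)] s by (auto simp: inj_on_def)
    moreover have "j = (\<tau> ^^ (card S - 1)) s" using * j by blast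
    ultimately have "(\<tau> ^^ Suc (card S - 1)) s = s" by simp
    then show ?thesis unfolding orbit_altdef by (metis (mono_tags, lifting) mem_Collect_eq zero_less_Suc)
  qed
  then have "orbit \<tau> s = S"
    unfolding orbit_altdef_self_in[OF \<open>s \<in> orbit \<tau> s\<close>] using * sub by blast
  then show ?thesis unfolding cyclic_on_def using s by metis
qed

lemma cyclic_on_imp_numbering:
  assumes "\<tau> permutes S" "finite S" "cyclic_on \<tau> S" "s \<in> S"
  obtains P where "numbering \<tau> S P" "\<And>k. k < card S \<Longrightarrow> P ((\<tau> ^^ k) s) = k"
proof -
  have p: "permutation \<tau>" using assms permutation_permutes by blast
  have S: "orbit \<tau> s = S" using assms(3,4) by (simp add: orbit_cyclic_eq3)
  note O = orbit_enum[OF p, of s, unfolded S]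
  define P where "P = the_inv_into {..<card S} (\<lambda>k. (\<tau> ^^ k) s)"
  have P: "P ((\<tau> ^^ k) s) = k" if "k < card S" for k
    unfolding P_def using that by (intro the_inv_into_f_f[OF O(2)]) simp
  have "bij_betw P S {..<card S}"
    unfolding P_def by (rule bij_betw_the_inv_into) (use O in \<open>simp add: bij_betw_def\<close>)
  moreover have "\<tau> j \<in> S \<and> P (\<tau> j) = Suc (P j) mod card S" if j: "j \<in> S" for j
  proof
    show "\<tau> j \<in> S" using j assms(1) by (simp add: permutes_in_image)
    obtain k where k: "k < card S" "j = (\<tau> ^^ k) s" using j O(1) by blast
    show "P (\<tau> j) = Suc (P j) mod card S"
    proof (cases "Suc k = card S")
      case True
      then have "\<tau> j = s" using k O(3) by (metis comp_apply funpow.simps(2))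
      then show ?thesis using P[of 0] O(4) P[OF k(1)] k True by simp
    next
      case False
      then have "Suc k < card S" using k by simp
      then show ?thesis using P[of "Suc k"] P[OF k(1)] k by simp
    qed
  qed
  ultimately show ?thesis using that[of P] P assms(2,4) by (auto simp: numbering_def)
qed

section \<open>Factorizations into two long cycles\<close>

text \<open>An element \<open>\<tau>\<close> stands for the pair \<open>(\<tau>\<^sub>t, \<tau>\<^sub>b) = (\<sigma> \<circ> \<tau>, \<tau>)\<close>.\<close>

definition factor_set :: "'a set \<Rightarrow> ('a \<Rightarrow> 'a) \<Rightarrow> ('a \<Rightarrow> 'a) set" where
  "factor_set S \<sigma> = {\<tau>. \<tau> permutes S \<and> cyclic_on \<tau> S \<and> cyclic_on (\<sigma> \<circ> \<tau>) S}"

text \<open>The choice is harmless: \<open>theta\<close> does not depend on the numberings of the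
  two cycles, nor does \<open>phi\<close> for insertion points in \<open>S\<close>.\<close>

definition num :: "('a \<Rightarrow> 'a) \<Rightarrow> 'a set \<Rightarrow> 'a \<Rightarrow> nat" where
  "num \<tau> S = (SOME P. numbering \<tau> S P)"

definition theta_of :: "'a set \<Rightarrow> ('a \<Rightarrow> 'a) \<Rightarrow> ('a \<Rightarrow> 'a) \<Rightarrow> int" where
  "theta_of S \<sigma> \<tau> = theta (num (\<sigma> \<circ> \<tau>) S) (num \<tau> S) S"

definition phi_of :: "'a set \<Rightarrow> ('a \<Rightarrow> 'a) \<Rightarrow> 'a \<Rightarrow> 'a \<Rightarrow> ('a \<Rightarrow> 'a) \<Rightarrow> int" where
  "phi_of S \<sigma> y w \<tau> = phi (num (\<sigma> \<circ> \<tau>) S) (num \<tau> S) S y w"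

text \<open>Unlike the spin parity, this sum also has a meaning when \<sigma> has cycles of even
  length. That allows the recursion to pass through all splits before those with even parts drop
  out.\<close>

definition spin_sum :: "'a set \<Rightarrow> ('a \<Rightarrow> 'a) \<Rightarrow> int" where
  "spin_sum S \<sigma> = (\<Sum>\<tau>\<in>factor_set S \<sigma>. theta_of S \<sigma> \<tau>)"

lemma num:
  assumes "numbering \<tau> S P"
  shows "numbering \<tau> S (num \<tau> S)"
  unfolding num_def by (rule someI[where P = "numbering \<tau> S", OF assms])

lemma num_cyclic:
  assumes "\<tau> permutes S" "finite S" "cyclic_on \<tau> S"
  shows "numbering \<tau> S (num \<tau> S)"
proof -
  obtain s where "s \<in> S" using assms(3) unfolding cyclic_on_def by blast
  then show ?thesis using cyclic_on_imp_numbering[OF assms] num by metis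
qed

lemma factor_setD:
  assumes "finite S" "\<sigma> permutes S" "\<tau> \<in> factor_set S \<sigma>"
  shows "\<tau> permutes S" "numbering \<tau> S (num \<tau> S)" "numbering (\<sigma> \<circ> \<tau>) S (num (\<sigma> \<circ> \<tau>) S)"
  using assms num_cyclic permutes_compose[of \<tau> S \<sigma>] unfolding factor_set_def by blast+

lemma factor_setI:
  assumes "\<tau> permutes S" "numbering \<tau> S P" "numbering (\<sigma> \<circ> \<tau>) S Q"
  shows "\<tau> \<in> factor_set S \<sigma>"
  using assms numbering_imp_cyclic_on unfolding factor_set_def by blast

lemma theta_of_eq:
  assumes "numbering (\<sigma> \<circ> \<tau>) S P" "numbering \<tau> S Q"
  shows "theta_of S \<sigma> \<tau> = theta P Q S"
  unfolding theta_of_def using assms num by (intro theta_numbering) blast+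

lemma phi_of_eq:
  assumes "numbering (\<sigma> \<circ> \<tau>) S P" "numbering \<tau> S Q" "y \<in> S" "w \<in> S"
  shows "phi_of S \<sigma> y w \<tau> = phi P Q S y w"
  unfolding phi_of_def by (rule phi_numbering[OF num[OF assms(1)] assms(1) num[OF assms(2)] assms(2-4)])

lemma finite_factor_set: "finite S \<Longrightarrow> finite (factor_set S \<sigma>)"
  unfolding factor_set_def by (rule finite_subset[OF _ finite_permutations[of S]]) auto

lemma permutes_delete:
  assumes "\<tau> permutes insert x S" "x \<notin> S"
  shows "transpose x (\<tau> x) \<circ> \<tau> permutes S"
proof (rule permutes_superset)
  have "\<tau> x \<in> insert x S" using permutes_in_image[OF assms(1)] by blast
  then show "transpose x (\<tau> x) \<circ> \<tau> permutes insert x S"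
    by (intro permutes_compose[OF assms(1)] permutes_swap_id) auto
qed (use assms in auto)

lemma permutes_insert_transpose:
  assumes "\<tau> permutes S" "w \<in> S"
  shows "transpose x w \<circ> \<tau> permutes insert x S"
  using assms by (intro permutes_compose[OF permutes_subset] permutes_swap_id) auto

text \<open>The product that remains after deleting \<open>x\<close> from the cycles \<open>\<sigma> \<circ> \<tau>\<close> and \<open>\<tau>\<close>, where \<open>w = \<tau> x\<close>; it does
  not depend on the rest of \<open>\<tau>\<close>.\<close>

definition reduced_perm :: "('a \<Rightarrow> 'a) \<Rightarrow> 'a \<Rightarrow> 'a \<Rightarrow> 'a \<Rightarrow> 'a" where
  "reduced_perm \<sigma> x w = transpose x (\<sigma> w) \<circ> \<sigma> \<circ> transpose x w"

lemma reduced_perm_permutes: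
  assumes "\<sigma> permutes insert x S" "x \<notin> S" "w \<in> S"
  shows "reduced_perm \<sigma> x w permutes S"
proof -
  have "\<sigma> \<circ> transpose x w permutes insert x S"
    using assms by (intro permutes_compose permutes_swap_id) auto
  from permutes_delete[OF this assms(2)] show ?thesis
    by (simp add: reduced_perm_def comp_assoc)
qed

text \<open>A factorization on \<open>insert x S\<close> amounts to the image
  \<open>w = \<tau> x\<close> and a factorization of the reduced permutation on \<open>S\<close>.
  Since \<open>S\<close> is nonempty, neither long cycle fixes \<open>x\<close>; this is the
  restriction to \<open>w \<in> S\<close> with \<open>\<sigma> w \<noteq> x\<close>. Conversely
  \<open>x\<close> is put back just before \<open>\<sigma> w\<close> in the top cycle and just
  before \<open>w\<close> in the bottom one.\<close>

lemma spin_sum_recursion: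
  assumes fin: "finite S" and x: "x \<notin> S" and ne: "S \<noteq> {}" and \<sigma>: "\<sigma> permutes insert x S"
  shows "spin_sum (insert x S) \<sigma> = (\<Sum>w | w \<in> S \<and> \<sigma> w \<noteq> x. spin_sum S (reduced_perm \<sigma> x w)
     + (\<Sum>\<tau>\<in>factor_set S (reduced_perm \<sigma> x w). phi_of S (reduced_perm \<sigma> x w) (\<sigma> w) w \<tau>))"
proof -
  let ?S = "insert x S" and ?W = "{w. w \<in> S \<and> \<sigma> w \<noteq> x}" and ?r = "reduced_perm \<sigma> x"
  have r: "?r w \<circ> \<tau> = transpose x (\<sigma> w) \<circ> (\<sigma> \<circ> (transpose x w \<circ> \<tau>))" for w and \<tau> :: "'a \<Rightarrow> 'a"
    by (simp add: reduced_perm_def comp_assoc)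
  have tt: "transpose x w \<circ> (transpose x w \<circ> \<tau>) = \<tau>" for w and \<tau> :: "'a \<Rightarrow> 'a"
    by (simp flip: comp_assoc)
  have "spin_sum ?S \<sigma> = (\<Sum>(w, \<tau>)\<in>Sigma ?W (\<lambda>w. factor_set S (?r w)).
       theta_of S (?r w) \<tau> + phi_of S (?r w) (\<sigma> w) w \<tau>)"
    unfolding spin_sum_def
  proof (rule sum.reindex_bij_witness[where
        i = "\<lambda>(w, \<tau>). transpose x w \<circ> \<tau>" and j = "\<lambda>\<tau>. (\<tau> x, transpose x (\<tau> x) \<circ> \<tau>)"])
    fix \<tau> assume \<tau>: "\<tau> \<in> factor_set ?S \<sigma>"
    note D = factor_setD[OF _ \<sigma> \<tau>, simplified, OF fin]
    obtain z where z: "z \<in> S" using ne by blast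
    have zx: "z \<in> ?S" "z \<noteq> x" "x \<in> ?S" using z x by auto
    have n1: "\<tau> x \<noteq> x" using numbering_no_fixpoint[OF D(2) zx(3,1,2)] .
    have n2: "(\<sigma> \<circ> \<tau>) x \<noteq> x" using numbering_no_fixpoint[OF _ zx(3,1,2)] D(3) by (simp add: comp_def)
    have w: "\<tau> x \<in> S" using D(1) n1 by (metis insertE insertI1 permutes_in_image)
    let ?\<tau> = "transpose x (\<tau> x) \<circ> \<tau>"
    show "(case (\<tau> x, ?\<tau>) of (w, \<tau>) \<Rightarrow> transpose x w \<circ> \<tau>) = \<tau>" by (simp add: tt)
    have e: "?r (\<tau> x) \<circ> ?\<tau> = transpose x ((\<sigma> \<circ> \<tau>) x) \<circ> (\<sigma> \<circ> \<tau>)" by (simp add: r tt)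
    have nd: "numbering (\<sigma> \<circ> \<tau>) ?S (num (\<sigma> \<circ> \<tau>) ?S)" using D(3) by (simp add: comp_def)
    have m: "?\<tau> \<in> factor_set S (?r (\<tau> x))"
      using numbering_delete[OF D(2) x n1] numbering_delete[OF nd x n2] permutes_delete[OF D(1) x]
      by (intro factor_setI) (simp_all only: e)
    then show "(\<tau> x, ?\<tau>) \<in> Sigma ?W (\<lambda>w. factor_set S (?r w))"
      using w n2 by simp
    show "(case (\<tau> x, ?\<tau>) of (w, \<tau>) \<Rightarrow> theta_of S (?r w) \<tau> + phi_of S (?r w) (\<sigma> w) w \<tau>) = theta_of ?S \<sigma> \<tau>"
    proof -
      have rp: "?r (\<tau> x) permutes S" using reduced_perm_permutes[OF \<sigma> x w] .
      note D' = factor_setD[OF fin rp m]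
      have y: "\<sigma> (\<tau> x) \<in> S" using n2 w \<sigma> by (metis comp_apply insertE insertI2 permutes_in_image)
      have f1: "?\<tau> x = x" by simp
      have f2: "(?r (\<tau> x) \<circ> ?\<tau>) x = x" unfolding e by simp
      have b1: "transpose x (\<tau> x) \<circ> ?\<tau> = \<tau>" by (simp add: tt)
      have b2: "transpose x (\<sigma> (\<tau> x)) \<circ> (?r (\<tau> x) \<circ> ?\<tau>) = \<sigma> \<circ> \<tau>" unfolding e by (simp add: tt)
      note N1 = numbering_insert[OF D'(2) x w f1, unfolded b1]
      note N2 = numbering_insert[OF D'(3) x y f2, unfolded b2]
      have "theta_of ?S \<sigma> \<tau> = theta (num (?r (\<tau> x) \<circ> ?\<tau>) S) (num ?\<tau> S) S
          + phi (num (?r (\<tau> x) \<circ> ?\<tau>) S) (num ?\<tau> S) S (\<sigma> (\<tau> x)) (\<tau> x)"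
        unfolding theta_of_eq[OF N2 N1]
        by (rule theta_insert[OF numberingD(3)[OF D'(3)] numberingD(3)[OF D'(2)] fin x]) (rule refl)+
      then show ?thesis by (simp add: theta_of_def phi_of_def)
    qed
  next
    fix p assume p: "p \<in> Sigma ?W (\<lambda>w. factor_set S (?r w))"
    obtain w \<tau> where wt: "p = (w, \<tau>)" by fastforce
    then have w: "w \<in> S" "\<sigma> w \<noteq> x" and \<tau>: "\<tau> \<in> factor_set S (?r w)" using p by auto
    have rp: "?r w permutes S" using reduced_perm_permutes[OF \<sigma> x w(1)] .
    note D = factor_setD[OF fin rp \<tau>]
    have y: "\<sigma> w \<in> S" using w \<sigma> by (metis insertE insertI2 permutes_in_image)
    have f1: "\<tau> x = x" using D(1) x by (simp add: permutes_not_in)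
    have f2: "(?r w \<circ> \<tau>) x = x" using f1 rp x by (simp add: permutes_not_in)
    have b2: "transpose x (\<sigma> w) \<circ> (?r w \<circ> \<tau>) = \<sigma> \<circ> (transpose x w \<circ> \<tau>)" unfolding r by (simp add: tt)
    show "(case p of (w, \<tau>) \<Rightarrow> transpose x w \<circ> \<tau>) \<in> factor_set ?S \<sigma>"
      unfolding wt prod.case
      by (rule factor_setI[OF permutes_insert_transpose[OF D(1) w(1)] numbering_insert[OF D(2) x w(1) f1]
            numbering_insert[OF D(3) x y f2, unfolded b2]])
    have "(transpose x w \<circ> \<tau>) x = w" by (simp add: f1)
    then show "((case p of (w, \<tau>) \<Rightarrow> transpose x w \<circ> \<tau>) x,
        transpose x ((case p of (w, \<tau>) \<Rightarrow> transpose x w \<circ> \<tau>) x) \<circ> (case p of (w, \<tau>) \<Rightarrow> transpose x w \<circ> \<tau>)) = p"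
      unfolding wt by (simp add: tt)
  qed
  also have "\<dots> = (\<Sum>w\<in>?W. \<Sum>\<tau>\<in>factor_set S (?r w). theta_of S (?r w) \<tau> + phi_of S (?r w) (\<sigma> w) w \<tau>)"
    using fin finite_factor_set by (intro sum.Sigma[symmetric]) auto
  finally show ?thesis by (simp add: sum.distrib spin_sum_def)
qed

lemma phi_chain:
  assumes t: "numbering \<tau>t S P" and b: "numbering \<tau>b S Q"
    and \<sigma>: "\<And>j. j \<in> S \<Longrightarrow> \<sigma> (\<tau>b j) = \<tau>t j"
    and y: "y \<in> S" and w: "w \<in> S"
    and ne: "\<And>i. 0 < i \<Longrightarrow> i \<le> k \<Longrightarrow> (\<sigma> ^^ i) w \<noteq> y"
  shows "(\<sigma> ^^ k) w \<in> S \<and> phi P Q S y ((\<sigma> ^^ k) w) = (- 1) ^ k * phi P Q S y w"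
  using ne
proof (induction k)
  case (Suc k)
  then have IH: "(\<sigma> ^^ k) w \<in> S" "phi P Q S y ((\<sigma> ^^ k) w) = (- 1) ^ k * phi P Q S y w" by auto
  obtain m where m: "m \<in> S" "(\<sigma> ^^ k) w = \<tau>b m" using numbering_inj(2)[OF b] IH(1) by (metis imageE)
  have e: "(\<sigma> ^^ Suc k) w = \<tau>t m" using \<sigma>[OF m(1)] m(2) by simp
  have "\<tau>t m \<noteq> y" using Suc.prems[of "Suc k"] unfolding e by simp
  from phi_step[OF t b y m(1) this] IH(2) show ?case
    unfolding e m(2) using numberingD(5)[OF t m(1)] by simp
qed (use w in simp)

text \<open>The first \<open>n - 1\<close> steps, an even number, bring the insertion point to the
  element that \<sigma> sends to \<open>y\<close>. The signs cancel, and there \<open>phi\<close>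
  equals \<open>theta\<close>.\<close>

lemma phi_odd_distance:
  assumes t: "numbering \<tau>t S P" and b: "numbering \<tau>b S Q"
    and \<sigma>: "\<And>j. j \<in> S \<Longrightarrow> \<sigma> (\<tau>b j) = \<tau>t j"
    and y: "y \<in> S" and w: "w \<in> S" and n: "odd n" "(\<sigma> ^^ n) w = y"
    and ne: "\<And>i. 0 < i \<Longrightarrow> i < n \<Longrightarrow> (\<sigma> ^^ i) w \<noteq> y"
  shows "phi P Q S y w = theta P Q S"
proof -
  obtain k where k: "n = Suc k" "even k" using n(1) by (cases n) auto
  have ne': "(\<sigma> ^^ i) w \<noteq> y" if "0 < i" "i \<le> k" for i using ne[of i] that k by simp
  have *: "(\<sigma> ^^ k) w \<in> S" "phi P Q S y ((\<sigma> ^^ k) w) = phi P Q S y w"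
    using phi_chain[where k = k, OF t b \<sigma> y w ne'] k(2) by simp_all
  obtain m where m: "m \<in> S" "(\<sigma> ^^ k) w = \<tau>b m" using numbering_inj(2)[OF b] *(1) by (metis imageE)
  have "\<tau>t m = y" using \<sigma>[OF m(1)] m(2) n(2) k(1) by simp
  then show ?thesis using phi_succ[OF t b m(1)] * m(2) by simp
qed

section \<open>Conjugation of factorizations\<close>

definition conj_perm :: "('a \<Rightarrow> 'a) \<Rightarrow> ('a \<Rightarrow> 'a) \<Rightarrow> 'a \<Rightarrow> 'a" where
  "conj_perm h \<tau> = h \<circ> \<tau> \<circ> inv h"

lemma conj_perm_apply: "bij h \<Longrightarrow> conj_perm h \<tau> (h j) = h (\<tau> j)"
  by (simp add: conj_perm_def bij_is_inj)

lemma conj_perm_comp: "bij h \<Longrightarrow> conj_perm h \<sigma> \<circ> conj_perm h \<tau> = conj_perm h (\<sigma> \<circ> \<tau>)"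
  by (auto simp: conj_perm_def fun_eq_iff bij_is_inj)

lemma conj_perm_inv: "bij h \<Longrightarrow> conj_perm (inv h) (conj_perm h \<tau>) = \<tau>" "bij h \<Longrightarrow> conj_perm h (conj_perm (inv h) \<tau>) = \<tau>"
  by (auto simp: conj_perm_def fun_eq_iff inv_inv_eq bij_is_inj bij_is_surj surj_f_inv_f)

lemma conj_perm_permutes:
  assumes h: "bij h" and "\<tau> permutes S"
  shows "conj_perm h \<tau> permutes h ` S"
proof -
  have "bij (conj_perm h \<tau>)"
    unfolding conj_perm_def using h permutes_bij[OF assms(2)] by (intro bij_comp bij_imp_bij_inv)
  moreover have "conj_perm h \<tau> i = i" if "i \<notin> h ` S" for i
  proof -
    have "i = h (inv h i)" using h by (simp add: bij_is_surj surj_f_inv_f)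
    then have "inv h i \<notin> S" using that by auto
    then show ?thesis using assms(2) \<open>i = h (inv h i)\<close> by (simp add: conj_perm_def permutes_not_in)
  qed
  ultimately show ?thesis by (simp add: permutes_def bij_iff)
qed

lemma conj_perm_factor_set:
  assumes "bij h" "\<tau> \<in> factor_set S \<sigma>"
  shows "conj_perm h \<tau> \<in> factor_set (h ` S) (conj_perm h \<sigma>)"
proof -
  have "cyclic_on (conj_perm h f) (h ` S)" if "cyclic_on f S" for f
    using that by (rule cyclic_on_image) (simp add: conj_perm_apply[OF assms(1)])
  then show ?thesis
    using assms unfolding factor_set_def by (simp add: conj_perm_permutes conj_perm_comp)
qed

lemma numbering_conj_perm:
  assumes "bij h" "numbering \<tau> S P"
  shows "numbering (conj_perm h \<tau>) (h ` S) (P \<circ> inv h)"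
  using assms by (intro numbering_conjugate[OF assms(2)])
    (auto simp: conj_perm_apply bij_betw_def bij_is_inj intro: inj_on_subset)

lemma conj_perm_theta_of:
  assumes "finite S" "\<sigma> permutes S" and h: "bij h" and \<tau>: "\<tau> \<in> factor_set S \<sigma>"
  shows "theta_of (h ` S) (conj_perm h \<sigma>) (conj_perm h \<tau>) = theta_of S \<sigma> \<tau>"
proof -
  note D = factor_setD[OF assms(1,2) \<tau>]
  have i: "inj_on h S" using bij_is_inj[OF h] by (rule inj_on_subset) simp
  have "P \<circ> inv h \<circ> h = P" for P :: "'a \<Rightarrow> nat" using h by (simp add: comp_assoc bij_is_inj)
  then show ?thesis
    using theta_of_eq[of "conj_perm h \<sigma>" "conj_perm h \<tau>", OF numbering_conj_perm[OF h D(3), folded conj_perm_comp[OF h]] numbering_conj_perm[OF h D(2)]]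
    by (simp add: theta_image[OF i] theta_of_def)
qed

lemma conj_perm_phi_of:
  assumes "finite S" "\<sigma> permutes S" and h: "bij h" and \<tau>: "\<tau> \<in> factor_set S \<sigma>" and "y \<in> S" "w \<in> S"
  shows "phi_of (h ` S) (conj_perm h \<sigma>) (h y) (h w) (conj_perm h \<tau>) = phi_of S \<sigma> y w \<tau>"
proof -
  note D = factor_setD[OF assms(1,2) \<tau>]
  have i: "inj_on h S" using bij_is_inj[OF h] by (rule inj_on_subset) simp
  have "P \<circ> inv h \<circ> h = P" for P :: "'a \<Rightarrow> nat" using h by (simp add: comp_assoc bij_is_inj)
  then show ?thesis
    using phi_of_eq[of "conj_perm h \<sigma>" "conj_perm h \<tau>", OF numbering_conj_perm[OF h D(3), folded conj_perm_comp[OF h]] numbering_conj_perm[OF h D(2)], of "h y" "h w"] assms(5,6)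
    by (simp add: phi_image[OF i] phi_of_def)
qed

lemma spin_sum_conj_perm:
  assumes "finite S" "\<sigma> permutes S" and h: "bij h"
  shows "spin_sum (h ` S) (conj_perm h \<sigma>) = spin_sum S \<sigma>"
  unfolding spin_sum_def
proof (rule sum.reindex_bij_witness[where i = "conj_perm h" and j = "conj_perm (inv h)"])
  fix \<tau> assume \<tau>: "\<tau> \<in> factor_set S \<sigma>"
  show "conj_perm (inv h) (conj_perm h \<tau>) = \<tau>" using h by (rule conj_perm_inv)
  show "conj_perm h \<tau> \<in> factor_set (h ` S) (conj_perm h \<sigma>)" using conj_perm_factor_set[OF h \<tau>] .
next
  fix \<tau> assume \<tau>: "\<tau> \<in> factor_set (h ` S) (conj_perm h \<sigma>)"
  show i: "conj_perm h (conj_perm (inv h) \<tau>) = \<tau>" using h by (rule conj_perm_inv)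
  have "inv h ` h ` S = S" using h by (simp add: bij_is_inj image_inv_f_f)
  then show m: "conj_perm (inv h) \<tau> \<in> factor_set S \<sigma>"
    using conj_perm_factor_set[OF bij_imp_bij_inv[OF h] \<tau>] conj_perm_inv(1)[OF h] by metis
  show "theta_of S \<sigma> (conj_perm (inv h) \<tau>) = theta_of (h ` S) (conj_perm h \<sigma>) \<tau>"
    using conj_perm_theta_of[OF assms m] i by simp
qed

text \<open>Rotating the cycle of \<open>w\<close> alone is a symmetry of \<open>\<sigma>\<close>; it replaces \<open>w\<close> by \<open>\<sigma> w\<close>,
  which changes the sign of every term.\<close>

lemma sum_phi_of_separated:
  assumes fin: "finite S" and \<sigma>: "\<sigma> permutes S" and y: "y \<in> S" "y \<notin> orbit \<sigma> w" and w: "w \<in> S"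
  shows "(\<Sum>\<tau>\<in>factor_set S \<sigma>. phi_of S \<sigma> y w \<tau>) = 0"
proof -
  define A where "A = orbit \<sigma> w"
  define h where "h = perm_restrict \<sigma> A"
  have p: "permutation \<sigma>" using \<sigma> fin permutation_permutes by blast
  have wA: "w \<in> A" using permutation_self_in_orbit[OF p] by (simp add: A_def)
  have AS: "A \<subseteq> S" using permutes_orbit_subset[OF \<sigma> w] by (simp add: A_def)
  have cyc: "cyclic_on \<sigma> A" unfolding A_def using cyclic_on_orbit[OF \<sigma> fin] .
  have iff: "\<sigma> j \<in> A \<longleftrightarrow> j \<in> A" for j
    using cyclic_on_inI[OF cyc] cyclic_on_f_in[OF \<sigma> cyc] by blast
  have hj: "h j = (if j \<in> A then \<sigma> j else j)" for j by (simp add: h_def perm_restrict_def)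
  have inj\<sigma>: "\<sigma> i = \<sigma> j \<longleftrightarrow> i = j" for i j using permutes_inj[OF \<sigma>] by (simp add: inj_eq)
  have "inj_on h S"
    by (rule inj_onI) (metis hj iff inj\<sigma>)
  moreover have hS: "h ` S \<subseteq> S" using \<sigma> by (auto simp: hj permutes_in_image)
  ultimately have "h ` S = S" "bij_betw h S S"
    using fin endo_inj_surj by (blast, simp add: bij_betw_def endo_inj_surj)
  then have hp: "h permutes S"
    using AS by (intro bij_imp_permutes) (auto simp: hj)
  then have h: "bij h" by (rule permutes_bij)
  have "h (\<sigma> j) = \<sigma> (h j)" for j by (simp add: hj iff)
  then have "h \<circ> \<sigma> = \<sigma> \<circ> h" by auto
  then have c: "conj_perm h \<sigma> = \<sigma>"
    unfolding conj_perm_def using surj_iff[of h] bij_is_surj[OF h] by (simp add: comp_assoc)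
  have hy: "h y = y" "h w = \<sigma> w" using y wA by (simp_all add: hj A_def)
  have sw: "\<sigma> w \<in> S" using w \<sigma> by (simp add: permutes_in_image)
  \<comment> \<open>Because \<open>y\<close> lies on another cycle, \<open>\<sigma> w\<close> cannot
    be \<open>y\<close>, and the sign rule applies to every factorization.\<close>
  have step: "phi_of S \<sigma> y (\<sigma> w) \<tau> = - phi_of S \<sigma> y w \<tau>" if \<tau>: "\<tau> \<in> factor_set S \<sigma>" for \<tau>
  proof -
    note D = factor_setD[OF fin \<sigma> \<tau>]
    obtain m where m: "m \<in> S" "w = \<tau> m" using numbering_inj(2)[OF D(2)] w by (metis imageE)
    have "\<sigma> w \<noteq> y" using y iff[of w] wA A_def by auto
    then show ?thesis
      using phi_step[OF D(3,2) y(1) m(1)] m(2) by (simp add: phi_of_def)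
  qed
  have "(\<Sum>\<tau>\<in>factor_set S \<sigma>. phi_of S \<sigma> y w \<tau>) = (\<Sum>\<tau>\<in>factor_set S \<sigma>. phi_of S \<sigma> y (\<sigma> w) \<tau>)"
  proof (rule sum.reindex_bij_witness[where i = "conj_perm (inv h)" and j = "conj_perm h"])
    fix \<tau> assume \<tau>: "\<tau> \<in> factor_set S \<sigma>"
    show "conj_perm (inv h) (conj_perm h \<tau>) = \<tau>" using h by (rule conj_perm_inv)
    show "conj_perm h \<tau> \<in> factor_set S \<sigma>"
      using conj_perm_factor_set[OF h \<tau>] c \<open>h ` S = S\<close> by simp
    show "phi_of S \<sigma> y (\<sigma> w) (conj_perm h \<tau>) = phi_of S \<sigma> y w \<tau>"
      using conj_perm_phi_of[OF fin \<sigma> h \<tau> y(1) w] c \<open>h ` S = S\<close> hy by simp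
  next
    fix \<tau> assume \<tau>: "\<tau> \<in> factor_set S \<sigma>"
    show "conj_perm h (conj_perm (inv h) \<tau>) = \<tau>" using h by (rule conj_perm_inv)
    have "inv h ` S = S" using hp by (simp add: permutes_inv permutes_image)
    moreover have "conj_perm (inv h) \<sigma> = \<sigma>" using c conj_perm_inv(1)[OF h] by metis
    ultimately show "conj_perm (inv h) \<tau> \<in> factor_set S \<sigma>"
      using conj_perm_factor_set[OF bij_imp_bij_inv[OF h] \<tau>] by simp
  qed
  also have "\<dots> = - (\<Sum>\<tau>\<in>factor_set S \<sigma>. phi_of S \<sigma> y w \<tau>)"
    using step by (simp add: sum_negf)
  finally show ?thesis by simp
qed

section \<open>Cycle types of the reduced permutations\<close>

lemma cyclic_on_enum:
  assumes n: "0 < n" and f: "\<And>i. i < n \<Longrightarrow> f (g i) = g (Suc i mod n)"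
  shows "cyclic_on f (g ` {..<n})"
proof -
  have *: "(f ^^ k) (g 0) = g (k mod n)" for k
  proof (induction k)
    case (Suc k)
    then show ?case using f[of "k mod n"] n by (simp add: mod_Suc_eq)
  qed simp
  have "orbit f (g 0) = g ` {..<n}"
  proof
    show "orbit f (g 0) \<subseteq> g ` {..<n}" unfolding orbit_altdef using * n by auto
    show "g ` {..<n} \<subseteq> orbit f (g 0)"
    proof
      fix z assume "z \<in> g ` {..<n}"
      then obtain i where "i < n" "z = g i" by blast
      then have "z = (f ^^ (i + n)) (g 0)" using * by simp
      then show "z \<in> orbit f (g 0)" unfolding orbit_altdef using n by auto
    qed
  qed
  then show ?thesis unfolding cyclic_on_def using n by (metis imageI lessThan_iff)
qed

lemma orbit_subset_closed:
  assumes "\<And>b. b \<in> A \<Longrightarrow> f b \<in> A" "a \<in> A"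
  shows "orbit f a \<subseteq> A"
proof
  fix z assume "z \<in> orbit f a"
  then show "z \<in> A" by induction (use assms in auto)
qed

text \<open>Orbits are nonempty and stay inside a closed set, so the orbits in \<open>A\<close>
  differ from those in \<open>B\<close> and the set of orbits splits without overlap.\<close>

lemma cycle_type_Un:
  assumes "finite A" "finite B" "A \<inter> B = {}" "\<And>a. a \<in> A \<Longrightarrow> f a \<in> A" "\<And>b. b \<in> B \<Longrightarrow> f b \<in> B"
  shows "cycle_type f (A \<union> B) = cycle_type f A + cycle_type f B"
proof -
  have "orbit f ` A \<inter> orbit f ` B = {}"
  proof (rule ccontr)
    assume "orbit f ` A \<inter> orbit f ` B \<noteq> {}"
    then obtain a b where "a \<in> A" "b \<in> B" "orbit f a = orbit f b" by blast
    moreover from this have "orbit f a \<subseteq> A" "orbit f b \<subseteq> B" using orbit_subset_closed assms(4,5) by metis+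
    ultimately show False using orbit_nonempty[of f a] assms(3) by blast
  qed
  then show ?thesis
    using assms by (simp add: cycle_type_def image_Un mset_set_Union)
qed

lemma cycle_type_cyclic:
  assumes "cyclic_on f A"
  shows "cycle_type f A = {#card A#}"
proof -
  have "A \<noteq> {}" using assms orbit_nonempty unfolding cyclic_on_def by metis
  moreover have "orbit f a = A" if "a \<in> A" for a using assms that by (simp add: orbit_cyclic_eq3)
  ultimately have "orbit f ` A = {A}" by auto
  then show ?thesis by (simp add: cycle_type_def)
qed

lemma cycle_type_cong:
  assumes "\<And>a. a \<in> A \<Longrightarrow> f a = g a" "\<And>a. a \<in> A \<Longrightarrow> f a \<in> A"
  shows "cycle_type f A = cycle_type g A"
proof -
  have "orbit f a = orbit g a" if "a \<in> A" for a
    using assms that by (intro orbit_cong0[of a A]) auto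
  then show ?thesis by (simp add: cycle_type_def cong: image_cong)
qed

text \<open>In terms of cycles, \<open>w\<close> now goes to \<open>\<sigma> x\<close>, a
  predecessor of \<open>x\<close> other than \<open>w\<close> goes to \<open>\<sigma> w\<close>, and
  the rest is unchanged. A fixed point \<open>x\<close> merely disappears.\<close>

lemma reduced_perm_eq:
  assumes \<sigma>: "\<sigma> permutes T" and ne: "w \<noteq> x"
  shows "reduced_perm \<sigma> x w w = (if \<sigma> x = x then \<sigma> w else \<sigma> x)"
    "b \<noteq> w \<Longrightarrow> b \<noteq> x \<Longrightarrow> reduced_perm \<sigma> x w b = (if \<sigma> b = x then \<sigma> w else \<sigma> b)"
proof -
  have inj: "\<sigma> i = \<sigma> j \<longleftrightarrow> i = j" for i j using permutes_inj[OF \<sigma>] by (simp add: inj_eq)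
  show "reduced_perm \<sigma> x w w = (if \<sigma> x = x then \<sigma> w else \<sigma> x)"
    using inj[of x w] ne by (simp add: reduced_perm_def transpose_def)
  show "reduced_perm \<sigma> x w b = (if \<sigma> b = x then \<sigma> w else \<sigma> b)" if "b \<noteq> w" "b \<noteq> x"
    using inj[of b w] that by (simp add: reduced_perm_def transpose_def)
qed

lemma orbit_closed:
  assumes "\<sigma> permutes T" "finite T"
  shows "\<sigma> b \<in> orbit \<sigma> z \<longleftrightarrow> b \<in> orbit \<sigma> z"
  using cyclic_on_inI[OF cyclic_on_orbit[OF assms]] cyclic_on_f_in[OF assms(1) cyclic_on_orbit[OF assms]]
  by blast

lemma cycle_type_split_off:
  assumes \<sigma>: "\<sigma> permutes T" and T: "finite T" and B: "B \<subseteq> T" "\<And>b. b \<in> B \<Longrightarrow> \<sigma> b \<in> B" and z: "orbit \<sigma> z \<subseteq> B"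
  shows "cycle_type \<sigma> B = add_mset (card (orbit \<sigma> z)) (cycle_type \<sigma> (B - orbit \<sigma> z))"
proof -
  have "finite B" using B T finite_subset by blast
  moreover have "orbit \<sigma> z \<union> (B - orbit \<sigma> z) = B" using z by blast
  ultimately have "cycle_type \<sigma> B = cycle_type \<sigma> (orbit \<sigma> z) + cycle_type \<sigma> (B - orbit \<sigma> z)"
    using cycle_type_Un[of "orbit \<sigma> z" "B - orbit \<sigma> z" \<sigma>] z B(2) orbit_closed[OF \<sigma> T]
    by (metis (no_types, lifting) Diff_disjoint Diff_iff finite_Diff finite_subset)
  then show ?thesis using cycle_type_cyclic[OF cyclic_on_orbit[OF \<sigma> T]] by simp
qed

text \<open>The cycle of \<open>x\<close> is cut in two: \<open>w\<close> now returns to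
  \<open>\<sigma> x\<close>, and the last element returns to \<open>\<sigma> w\<close>. The
  exponents \<open>1..a\<close> form the cycle \<open>A\<close> that contains \<open>w\<close>, the
  exponents from \<open>a + 1\<close> to \<open>n - 1\<close> the cycle \<open>B\<close> that
  contains \<open>\<sigma> w\<close>. The second claim is what makes the insertion sum of a split
  vanish.\<close>

lemma cycle_type_reduced_split:
  assumes fin: "finite S" and x: "x \<notin> S" and \<sigma>: "\<sigma> permutes insert x S"
    and n: "n = card (orbit \<sigma> x)" and a: "1 \<le> a" "a + 2 \<le> n" and w: "w = (\<sigma> ^^ a) x"
  shows "cycle_type (reduced_perm \<sigma> x w) S = part_split (cycle_type \<sigma> (insert x S)) n a"
    "\<sigma> w \<notin> orbit (reduced_perm \<sigma> x w) w"
proof -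
  let ?T = "insert x S" and ?r = "reduced_perm \<sigma> x w" and ?f = "\<lambda>i. (\<sigma> ^^ i) x"
  have T: "finite ?T" using fin by simp
  have p: "permutation \<sigma>" using \<sigma> T permutation_permutes by blast
  note O = orbit_enum[OF p, of x, folded n]
  have inj: "?f i = ?f j \<longleftrightarrow> i = j" if "i < n" "j < n" for i j
    using O(2) that by (metis inj_onD lessThan_iff)
  have fx: "?f i \<noteq> x" if "0 < i" "i < n" for i using inj[of i 0] that by simp
  have fw: "?f i \<noteq> w" if "i \<noteq> a" "i < n" for i using inj[of i a] that a w by simp
  have wx: "w \<noteq> x" using fx[of a] a w by simp
  have r_w: "?r (?f a) = ?f 1" using reduced_perm_eq(1)[OF \<sigma> wx] fx[of 1] a w by simp
  have r_f: "?r (?f i) = ?f (Suc i)" if "0 < i" "Suc i < n" "i \<noteq> a" for i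
    using reduced_perm_eq(2)[OF \<sigma> wx, of "?f i"] fx[of i] fw[of i] fx[of "Suc i"] that by simp
  have r_l: "?r (?f (n - 1)) = ?f (Suc a)"
  proof -
    have "\<sigma> (?f (n - 1)) = ?f (Suc (n - 1))" by simp
    also have "\<dots> = x" using O(3,4) by simp
    finally show ?thesis
      using reduced_perm_eq(2)[OF \<sigma> wx, of "?f (n - 1)"] fx[of "n - 1"] fw[of "n - 1"] a w by simp
  qed
  define A where "A = (\<lambda>i. ?f (Suc i)) ` {..<a}"
  define B where "B = (\<lambda>i. ?f (Suc a + i)) ` {..<n - 1 - a}"
  have cA: "cyclic_on ?r A"
    unfolding A_def
  proof (rule cyclic_on_enum)
    fix i assume i: "i < a"
    show "?r (?f (Suc i)) = ?f (Suc (Suc i mod a))"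
    proof (cases "Suc i = a")
      case True
      then show ?thesis using r_w by simp
    qed (use r_f[of "Suc i"] i a in simp)
  qed (use a in simp)
  have cB: "cyclic_on ?r B"
    unfolding B_def
  proof (rule cyclic_on_enum)
    fix i assume i: "i < n - 1 - a"
    show "?r (?f (Suc a + i)) = ?f (Suc a + Suc i mod (n - 1 - a))"
    proof (cases "Suc i = n - 1 - a")
      case True
      then have "Suc a + i = n - 1" by simp
      then show ?thesis using r_l True by simp
    next
      case False
      then have "?r (?f (Suc a + i)) = ?f (Suc (Suc a + i))" using i a by (intro r_f) auto
      then show ?thesis using False i by simp
    qed
  qed (use a in simp)
  have "inj_on (\<lambda>i. ?f (Suc i)) {..<a}" "inj_on (\<lambda>i. ?f (Suc a + i)) {..<n - 1 - a}"
    using inj a by (auto intro!: inj_onI simp del: funpow.simps)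
  then have card: "card A = a" "card B = n - 1 - a" by (simp_all add: A_def B_def card_image)
  have AB: "A \<inter> B = {}"
  proof (rule ccontr)
    assume "A \<inter> B \<noteq> {}"
    then obtain i j where ij: "i < a" "j < n - 1 - a" "?f (Suc i) = ?f (Suc a + j)" unfolding A_def B_def by blast
    then have "Suc i < n" "Suc a + j < n" "Suc i \<noteq> Suc a + j" by simp_all
    then show False using inj ij(3) by metis
  qed
  have AB_O: "insert x (A \<union> B) = orbit \<sigma> x"
  proof -
    have A': "A = ?f ` {1..<Suc a}"
    proof -
      have "Suc ` {..<a} = {1..<Suc a}" by (simp add: lessThan_atLeast0)
      moreover have "A = ?f ` Suc ` {..<a}" unfolding A_def image_image ..
      ultimately show ?thesis by simp
    qed
    have B': "B = ?f ` {Suc a..<n}"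
    proof -
      have "(\<lambda>i. Suc a + i) ` {..<n - 1 - a} = {Suc a..<n}"
        using a image_add_atLeastLessThan[of "Suc a" 0 "n - 1 - a"] by (simp add: lessThan_atLeast0)
      moreover have "B = ?f ` (\<lambda>i. Suc a + i) ` {..<n - 1 - a}" unfolding B_def image_image ..
      ultimately show ?thesis by simp
    qed
    have "{..<n} = insert 0 ({1..<Suc a} \<union> {Suc a..<n})" using a by auto
    then have "orbit \<sigma> x = insert (?f 0) (?f ` {1..<Suc a} \<union> ?f ` {Suc a..<n})" using O(1) by (metis image_Un image_insert)
    then show ?thesis unfolding A' B' by simp
  qed
  define R where "R = ?T - orbit \<sigma> x"
  have OT: "orbit \<sigma> x \<subseteq> ?T" using permutes_orbit_subset[OF \<sigma>, of x] by simp
  have xAB: "x \<notin> A \<union> B"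
  proof
    assume "x \<in> A \<union> B"
    then obtain i where "0 < i" "i < n" "x = ?f i" unfolding A_def B_def using a by force
    then show False using fx by metis
  qed
  have "orbit \<sigma> x - {x} = A \<union> B" unfolding AB_O[symmetric] using xAB by simp
  moreover have "x \<in> orbit \<sigma> x" unfolding AB_O[symmetric] by simp
  ultimately have S: "S = (A \<union> B) \<union> R" using x OT unfolding R_def by auto
  have \<sigma>R: "\<sigma> b \<in> R" if "b \<in> R" for b
    using that orbit_closed[OF \<sigma> T] \<sigma> unfolding R_def by (simp add: permutes_in_image del: insert_iff)
  have rR: "?r b = \<sigma> b" if "b \<in> R" for b
  proof -
    have "b \<noteq> x" "b \<noteq> w" "\<sigma> b \<noteq> x"
      using that \<sigma>R[OF that] AB_O w a O(1) unfolding R_def by auto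
    then show ?thesis using reduced_perm_eq(2)[OF \<sigma> wx] by simp
  qed
  have finAB: "finite A" "finite B" "finite R" using S fin by (metis finite_Un)+
  have "cycle_type ?r S = cycle_type ?r (A \<union> B) + cycle_type ?r R"
    unfolding S using finAB AB_O \<sigma>R rR cyclic_on_inI[OF cA] cyclic_on_inI[OF cB]
    by (intro cycle_type_Un) (auto simp: R_def)
  also have "cycle_type ?r (A \<union> B) = {#a, n - a - 1#}"
    using cycle_type_Un[OF finAB(1,2) AB cyclic_on_inI[OF cA] cyclic_on_inI[OF cB]]
      cycle_type_cyclic[OF cA] cycle_type_cyclic[OF cB] card by (simp add: diff_commute)
  also have "cycle_type ?r R = cycle_type \<sigma> R" using rR \<sigma>R by (intro cycle_type_cong) auto
  finally have 1: "cycle_type ?r S = {#a, n - a - 1#} + cycle_type \<sigma> R" .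
  have 2: "cycle_type \<sigma> ?T = add_mset n (cycle_type \<sigma> R)"
    using cycle_type_split_off[OF \<sigma> T order.refl _ OT] \<sigma> n unfolding R_def
    by (simp add: permutes_in_image del: insert_iff)
  show "cycle_type ?r S = part_split (cycle_type \<sigma> ?T) n a" unfolding 1 2 by (simp add: part_split_def)
  have "w \<in> A" unfolding A_def w using a by (intro image_eqI[of _ _ "a - 1"]) (auto simp del: funpow.simps)
  then have "orbit ?r w = A" using cA by (simp add: orbit_cyclic_eq3)
  moreover have "\<sigma> w \<in> B" unfolding B_def w using a by (intro image_eqI[of _ _ 0]) auto
  ultimately show "\<sigma> w \<notin> orbit ?r w" using AB by blast
qed

text \<open>The cycle of \<open>x\<close>, deprived of \<open>x\<close>, is spliced in between
  \<open>w\<close> and \<open>\<sigma> w\<close>. Hence the length, one less than the sum of the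
  two, and the distance \<open>n\<close> from \<open>w\<close> to \<open>\<sigma> w\<close>, whose
  parity decides the insertion sum of a merge.\<close>

lemma cycle_type_reduced_merge:
  assumes fin: "finite S" and x: "x \<notin> S" and \<sigma>: "\<sigma> permutes insert x S"
    and n: "n = card (orbit \<sigma> x)" and w: "w \<in> S" "w \<notin> orbit \<sigma> x"
  shows "cycle_type (reduced_perm \<sigma> x w) S = part_merge (cycle_type \<sigma> (insert x S)) n (card (orbit \<sigma> w))"
    "(reduced_perm \<sigma> x w ^^ n) w = \<sigma> w"
    "\<And>i. 0 < i \<Longrightarrow> i < n \<Longrightarrow> (reduced_perm \<sigma> x w ^^ i) w \<noteq> \<sigma> w"
proof -
  let ?T = "insert x S" and ?r = "reduced_perm \<sigma> x w" and ?f = "\<lambda>i. (\<sigma> ^^ i) x" and ?g = "\<lambda>i. (\<sigma> ^^ i) w"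
  define m where "m = card (orbit \<sigma> w)"
  have T: "finite ?T" using fin by simp
  have p: "permutation \<sigma>" using \<sigma> T permutation_permutes by blast
  note O = orbit_enum[OF p, of x, folded n] and W = orbit_enum[OF p, of w, folded m_def]
  note cl = orbit_closed[OF \<sigma> T]
  have xO: "x \<in> orbit \<sigma> x" "w \<in> orbit \<sigma> w" using permutation_self_in_orbit[OF p] by blast+
  have inj: "?f i = ?f j \<longleftrightarrow> i = j" if "i < n" "j < n" for i j
    using O(2) that by (metis inj_onD lessThan_iff)
  have injg: "?g i = ?g j \<longleftrightarrow> i = j" if "i < m" "j < m" for i j
    using W(2) that by (metis inj_onD lessThan_iff)
  have fx: "?f i \<noteq> x" if "0 < i" "i < n" for i using inj[of i 0] that by simp
  have gw: "?g i \<noteq> w" if "0 < i" "i < m" for i using injg[of i 0] that by simp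
  have fO: "?f i \<in> orbit \<sigma> x" for i using xO(1) by (induction i) (auto simp: cl)
  have gO: "?g i \<notin> orbit \<sigma> x" for i using w(2) by (induction i) (auto simp: cl)
  have wx: "w \<noteq> x" using w x by auto
  have r_f: "?r (?f i) = ?f (Suc i)" if "0 < i" "Suc i < n" for i
    using reduced_perm_eq(2)[OF \<sigma> wx, of "?f i"] fx[of i] fO[of i] w(2) fx[of "Suc i"] that by auto
  have last: "\<sigma> (?f (n - 1)) = x"
  proof -
    have "\<sigma> (?f (n - 1)) = ?f (Suc (n - 1))" by simp
    also have "\<dots> = x" using O(3,4) by simp
    finally show ?thesis .
  qed
  have r_l: "?r (?f (n - 1)) = \<sigma> w" if "n > 1"
    using reduced_perm_eq(2)[OF \<sigma> wx, of "?f (n - 1)"] fx[of "n - 1"] fO[of "n - 1"] w(2) that last by auto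
  have r_w: "?r w = (if n = 1 then \<sigma> w else \<sigma> x)"
  proof -
    have "\<sigma> x = x \<longleftrightarrow> n = 1" using fx[of 1] last O(4) by (cases "n = 1") auto
    then show ?thesis using reduced_perm_eq(1)[OF \<sigma> wx] by simp
  qed
  have r_g: "?r (?g i) = ?g (Suc i)" if "0 < i" "i < m" for i
  proof -
    have "?g i \<noteq> x" "?g (Suc i) \<noteq> x" using gO[of i] gO[of "Suc i"] xO(1) by metis+
    then show ?thesis using reduced_perm_eq(2)[OF \<sigma> wx, of "?g i"] gw[OF that] by simp
  qed
  have rw: "(?r ^^ i) w = ?f i" if "0 < i" "i < n" for i
    using that
  proof (induction i)
    case (Suc i)
    show ?case
    proof (cases "i = 0")
      case True
      then show ?thesis using r_w Suc.prems by simp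
    next
      case False
      then show ?thesis using Suc r_f[of i] by simp
    qed
  qed simp
  show "(?r ^^ n) w = \<sigma> w"
  proof (cases "n = 1")
    case False
    then have "(?r ^^ n) w = ?r ((?r ^^ (n - 1)) w)" using O(4) by (cases n) auto
    also have "\<dots> = \<sigma> w" using rw[of "n - 1"] r_l False O(4) by simp
    finally show ?thesis .
  qed (use r_w in simp)
  show "(?r ^^ i) w \<noteq> \<sigma> w" if "0 < i" "i < n" for i
    using rw[OF that] fO[of i] gO[of 1] by auto
  \<comment> \<open>The merged cycle is listed from the place after \<open>w\<close>: the
    \<open>n - 1\<close> elements from the cycle of \<open>x\<close>, then the cycle of
    \<open>w\<close> from \<open>\<sigma> w\<close> on, with \<open>w\<close> at the very
    end.\<close>
  define g where "g i = (if i < n - 1 then ?f (Suc i) else ?g (Suc (i - (n - 1))))" for i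
  define C where "C = g ` {..<n - 1 + m}"
  have cC: "cyclic_on ?r C"
    unfolding C_def
  proof (rule cyclic_on_enum)
    fix i assume i: "i < n - 1 + m"
    consider "Suc i < n - 1" | "Suc i = n - 1" | "n - 1 \<le> i" "Suc i < n - 1 + m" | "Suc i = n - 1 + m" "n - 1 \<le> i"
      using i by linarith
    then show "?r (g i) = g (Suc i mod (n - 1 + m))"
    proof cases
      case 1
      then show ?thesis using r_f[of "Suc i"] by (simp add: g_def)
    next
      case 2
      then have "?f (Suc i) = ?f (n - 1)" by simp
      then show ?thesis using r_l W(4) 2 by (simp add: g_def)
    next
      case 3
      have "?r (?g (Suc (i - (n - 1)))) = ?g (Suc (Suc (i - (n - 1))))" using 3 by (intro r_g) auto
      moreover have "Suc i - (n - 1) = Suc (i - (n - 1))" using 3 by simp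
      ultimately show ?thesis using 3 by (simp add: g_def)
    next
      case 4
      then have e: "Suc (i - (n - 1)) = m" using W(4) by linarith
      have "g i = w" using 4 W(3) unfolding g_def e by simp
      moreover have "g 0 = (if n = 1 then \<sigma> w else \<sigma> x)" using O(4) by (auto simp: g_def)
      ultimately show ?thesis using r_w 4 by simp
    qed
  qed (use W(4) in simp)
  have C: "C = (orbit \<sigma> x - {x}) \<union> orbit \<sigma> w"
  proof -
    have "{..<n - 1 + m} = {..<n - 1} \<union> (\<lambda>i. i + (n - 1)) ` {..<m}"
      using image_add_atLeastLessThan'[of "n - 1" 0 m] by (auto simp: lessThan_atLeast0 add.commute)
    then have "C = g ` {..<n - 1} \<union> (\<lambda>i. g (i + (n - 1))) ` {..<m}"
      unfolding C_def by (simp add: image_Un image_image)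
    moreover have "g ` {..<n - 1} = orbit \<sigma> x - {x}"
    proof
      show "g ` {..<n - 1} \<subseteq> orbit \<sigma> x - {x}"
        using fO fx by (auto simp: g_def simp del: funpow.simps)
      show "orbit \<sigma> x - {x} \<subseteq> g ` {..<n - 1}"
      proof
        fix z assume z: "z \<in> orbit \<sigma> x - {x}"
        then obtain i where i: "i < n" "z = ?f i" using O(1) by blast
        then obtain j where "i = Suc j" using z by (cases i) auto
        then show "z \<in> g ` {..<n - 1}" using i by (intro image_eqI[of _ _ j]) (auto simp: g_def)
      qed
    qed
    moreover have "(\<lambda>i. g (i + (n - 1))) ` {..<m} = orbit \<sigma> w"
    proof -
      have "(\<lambda>i. g (i + (n - 1))) ` {..<m} = \<sigma> ` ?g ` {..<m}" by (simp add: g_def image_image)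
      also have "\<dots> = \<sigma> ` orbit \<sigma> w" using W(1) by simp
      also have "\<dots> = orbit \<sigma> w"
        using endo_inj_surj[of "orbit \<sigma> w" \<sigma>] cl xO T permutes_inj[OF \<sigma>] permutes_orbit_subset[OF \<sigma>, of w] w(1)
        by (metis finite_subset image_subsetI inj_on_subset insertI2 subset_UNIV)
      finally show ?thesis .
    qed
    ultimately show ?thesis by simp
  qed
  have OT: "orbit \<sigma> x \<subseteq> ?T" "orbit \<sigma> w \<subseteq> ?T"
    using permutes_orbit_subset[OF \<sigma>, of x] permutes_orbit_subset[OF \<sigma>, of w] w by auto
  have disj: "orbit \<sigma> x \<inter> orbit \<sigma> w = {}"
    using W(1) gO by auto
  have finO: "finite (orbit \<sigma> x)" "finite (orbit \<sigma> w)" using OT T finite_subset by blast+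
  have cardC: "card C = n + m - 1"
  proof -
    have "card C = card (orbit \<sigma> x - {x}) + card (orbit \<sigma> w)"
      unfolding C using disj finO by (intro card_Un_disjoint) auto
    then show ?thesis using xO(1) finO O(4) n m_def by simp
  qed
  define R where "R = ?T - orbit \<sigma> x - orbit \<sigma> w"
  have S: "S = C \<union> R" using C x OT xO disj unfolding R_def by blast
  have CR: "C \<inter> R = {}" unfolding C R_def by blast
  have \<sigma>R: "\<sigma> b \<in> R" if "b \<in> R" for b
    using that cl \<sigma> unfolding R_def by (simp add: permutes_in_image del: insert_iff)
  have rR: "?r b = \<sigma> b" if "b \<in> R" for b
  proof -
    have "b \<noteq> x" "b \<noteq> w" "\<sigma> b \<noteq> x"
      using that \<sigma>R[OF that] xO unfolding R_def by auto
    then show ?thesis using reduced_perm_eq(2)[OF \<sigma> wx] by simp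
  qed
  have "cycle_type ?r S = cycle_type ?r C + cycle_type ?r R"
    unfolding S using fin CR \<sigma>R rR cyclic_on_inI[OF cC] by (intro cycle_type_Un) (auto simp: S)
  also have "cycle_type ?r C = {#n + m - 1#}" using cycle_type_cyclic[OF cC] cardC by simp
  also have "cycle_type ?r R = cycle_type \<sigma> R" using rR \<sigma>R by (intro cycle_type_cong) auto
  finally have 1: "cycle_type ?r S = {#n + m - 1#} + cycle_type \<sigma> R" .
  have 2: "cycle_type \<sigma> ?T = add_mset n (cycle_type \<sigma> (?T - orbit \<sigma> x))"
    using cycle_type_split_off[OF \<sigma> T order.refl _ OT(1)] \<sigma> n
    by (simp add: permutes_in_image del: insert_iff)
  have 3: "cycle_type \<sigma> (?T - orbit \<sigma> x) = add_mset m (cycle_type \<sigma> R)"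
    unfolding R_def m_def using cl \<sigma> OT disj
    by (intro cycle_type_split_off[OF \<sigma> T]) (auto simp: permutes_in_image simp del: insert_iff)
  show "cycle_type ?r S = part_merge (cycle_type \<sigma> ?T) n (card (orbit \<sigma> w))"
    unfolding 1 2 3 by (simp add: part_merge_def m_def)
qed

section \<open>Conjugacy of permutations\<close>

text \<open>Conjugation uses a bijection of the whole type. The sets \<open>S' - S\<close> and
  \<open>S - S'\<close> have the same size, so the former can be sent to the latter and everything
  outside both sets left in place.\<close>

lemma bij_betw_extend_bij:
  fixes S S' :: "'a set"
  assumes h: "bij_betw h S S'" and fin: "finite S"
  obtains k where "bij k" "\<And>j. j \<in> S \<Longrightarrow> k j = h j" "k ` S = S'"
proof -
  have fin': "finite S'" using h fin bij_betw_finite by blast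
  have "card S = card S'" using h by (rule bij_betw_same_card)
  then have "card (S' - S) = card (S - S')"
    using card_Int_Diff[OF fin, of S'] card_Int_Diff[OF fin', of S] by (simp add: Int_commute)
  then obtain b where b: "bij_betw b (S' - S) (S - S')"
    using finite_same_card_bij fin fin' by blast
  define k where "k j = (if j \<in> S then h j else if j \<in> S' then b j else j)" for j
  have 1: "bij_betw k S S'" using h by (rule bij_betw_cong[THEN iffD1, rotated]) (simp add: k_def)
  have 2: "bij_betw k (S' - S) (S - S')" using b by (rule bij_betw_cong[THEN iffD1, rotated]) (simp add: k_def)
  have 3: "bij_betw k (- (S \<union> S')) (- (S \<union> S'))"
    by (rule bij_betw_cong[THEN iffD1, of _ id]) (auto simp: k_def)
  have "bij_betw k (S \<union> (S' - S)) (S' \<union> (S - S'))"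
    by (rule bij_betw_combine[OF 1 2]) auto
  moreover have "S \<union> (S' - S) = S \<union> S'" "S' \<union> (S - S') = S \<union> S'" by auto
  ultimately have "bij_betw k (S \<union> S') (S \<union> S')" by simp
  from bij_betw_combine[OF this 3 Compl_disjoint] have "bij k" by (simp only: Compl_partition)
  moreover have "k ` S = S'" using 1 by (simp add: bij_betw_def)
  ultimately show ?thesis using that by (simp add: k_def)
qed

lemma orbit_bij:
  assumes "permutation f" "permutation g" and c: "card (orbit f x) = card (orbit g x')"
  obtains h where "bij_betw h (orbit f x) (orbit g x')" "\<And>j. j \<in> orbit f x \<Longrightarrow> h (f j) = g (h j)"
proof -
  define n where "n = card (orbit f x)"
  note F = orbit_enum[OF assms(1), of x, folded n_def]
  note G = orbit_enum[OF assms(2), of x', folded c, folded n_def]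
  define e where "e = the_inv_into {..<n} (\<lambda>i. (f ^^ i) x)"
  have e: "e ((f ^^ i) x) = i" if "i < n" for i
    unfolding e_def using the_inv_into_f_f[OF F(2)] that by simp
  define h where "h = (\<lambda>i. (g ^^ i) x') \<circ> e"
  have "bij_betw e (orbit f x) {..<n}"
    unfolding e_def by (rule bij_betw_the_inv_into) (use F in \<open>simp add: bij_betw_def\<close>)
  moreover have "bij_betw (\<lambda>i. (g ^^ i) x') {..<n} (orbit g x')" using G by (simp add: bij_betw_def)
  ultimately have "bij_betw h (orbit f x) (orbit g x')" unfolding h_def by (rule bij_betw_trans)
  moreover have "h (f j) = g (h j)" if "j \<in> orbit f x" for j
  proof -
    obtain i where i: "i < n" "j = (f ^^ i) x" using F(1) \<open>j \<in> orbit f x\<close> by blast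
    have hj: "h j = (g ^^ i) x'" using i e by (simp add: h_def)
    show ?thesis
    proof (cases "Suc i = n")
      case True
      then have "f j = (f ^^ 0) x" using F(3) i by (metis comp_apply funpow.simps(2) funpow_0)
      then have "h (f j) = x'" using e[of 0] F(4) by (simp add: h_def)
      moreover have "g (h j) = x'" using G(3) True hj by (metis comp_apply funpow.simps(2))
      ultimately show ?thesis by simp
    next
      case False
      then have "Suc i < n" using i by simp
      then have "h (f j) = (g ^^ Suc i) x'" using e[of "Suc i"] i by (simp add: h_def)
      then show ?thesis using hj by simp
    qed
  qed
  ultimately show ?thesis using that by blast
qed

text \<open>Orbits of equal length are matched one at a time. The closed subsets \<open>B\<close>
  and \<open>B'\<close> are there for the induction: what is left after removing an orbit is again
  of this kind.\<close>

lemma same_cycle_type_bij: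
  assumes f: "f permutes T" "finite T" and g: "g permutes T'" "finite T'"
    and "B \<subseteq> T" "\<And>b. b \<in> B \<Longrightarrow> f b \<in> B" "B' \<subseteq> T'" "\<And>b. b \<in> B' \<Longrightarrow> g b \<in> B'"
    and "cycle_type f B = cycle_type g B'"
  shows "\<exists>h. bij_betw h B B' \<and> (\<forall>j\<in>B. h (f j) = g (h j))"
  using assms(5-)
proof (induction "card B" arbitrary: B B' rule: less_induct)
  case less
  have pf: "permutation f" and pg: "permutation g" using f g permutation_permutes by blast+
  have fin: "finite B" "finite B'" using less.prems(1,3) f g finite_subset by blast+
  show ?case
  proof (cases "B = {}")
    case True
    then have "cycle_type g B' = {#}" using less.prems(5) by (simp add: cycle_type_def)
    then have "B' = {}" using fin by (auto simp: cycle_type_def mset_set_empty_iff)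
    then show ?thesis using True by (auto simp: bij_betw_def)
  next
    case False
    then obtain x where x: "x \<in> B" by blast
    define Ob where "Ob = orbit f x"
    have Ob: "Ob \<subseteq> B" unfolding Ob_def using orbit_subset_closed[of B f x] less.prems(2) x by blast
    have xOb: "x \<in> Ob" unfolding Ob_def using permutation_self_in_orbit[OF pf] .
    note s = cycle_type_split_off[OF f less.prems(1,2), of x, folded Ob_def, OF _ Ob]
    have "card Ob \<in># cycle_type g B'" using s less.prems(5) by (metis union_single_eq_member)
    then obtain x' where x': "x' \<in> B'" "card (orbit g x') = card Ob"
      using fin by (auto simp: cycle_type_def)
    define O' where "O' = orbit g x'"
    have O': "O' \<subseteq> B'" unfolding O'_def using orbit_subset_closed[of B' g x'] less.prems(4) x' by blast
    note s' = cycle_type_split_off[OF g less.prems(3,4), of x', folded O'_def, OF _ O']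
    have "cycle_type f (B - Ob) = cycle_type g (B' - O')"
      using s s' less.prems(5) x'(2) O'_def by simp
    moreover have "card (B - Ob) < card B" using fin x xOb by (intro psubset_card_mono) auto
    moreover have "f b \<in> B - Ob" if "b \<in> B - Ob" for b
      using that less.prems(2) orbit_closed[OF f] by (auto simp: Ob_def)
    moreover have "g b \<in> B' - O'" if "b \<in> B' - O'" for b
      using that less.prems(4) orbit_closed[OF g] by (auto simp: O'_def)
    ultimately obtain h1 where h1: "bij_betw h1 (B - Ob) (B' - O')" "\<forall>j\<in>B - Ob. h1 (f j) = g (h1 j)"
      using less.hyps[of "B - Ob" "B' - O'"] less.prems(1,3) by blast
    obtain h0 where h0: "bij_betw h0 Ob O'" "\<And>j. j \<in> Ob \<Longrightarrow> h0 (f j) = g (h0 j)"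
      using orbit_bij[OF pf pg] x'(2) unfolding Ob_def O'_def by metis
    define h where "h j = (if j \<in> Ob then h0 j else h1 j)" for j
    have "bij_betw h Ob O'" using h0(1) by (rule bij_betw_cong[THEN iffD1, rotated]) (simp add: h_def)
    moreover have "bij_betw h (B - Ob) (B' - O')"
      using h1(1) by (rule bij_betw_cong[THEN iffD1, rotated]) (simp add: h_def)
    ultimately have "bij_betw h (Ob \<union> (B - Ob)) (O' \<union> (B' - O'))" by (rule bij_betw_combine) auto
    then have "bij_betw h B B'" using Ob O' by (simp add: Un_absorb1)
    moreover have "h (f j) = g (h j)" if "j \<in> B" for j
      using that h0(2)[of j] h1(2) orbit_closed[OF f, of j x] by (simp add: h_def flip: Ob_def)
    ultimately show ?thesis by blast
  qed
qed

text \<open>Deleting \<open>x\<close> leaves a permutation of \<open>S\<close>, whereas the spin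
  counts refer to one chosen permutation of an initial segment of the numbers; invariance under
  conjugation connects the two.\<close>

lemma spin_sum_cycle_type:
  assumes f: "f permutes S" "finite S" and g: "g permutes S'" "finite S'"
    and c: "cycle_type f S = cycle_type g S'"
  shows "spin_sum S f = spin_sum S' g"
proof -
  have "\<exists>h. bij_betw h S S' \<and> (\<forall>j\<in>S. h (f j) = g (h j))"
    using f g c by (intro same_cycle_type_bij[OF f g]) (auto simp: permutes_in_image)
  then obtain h where h: "bij_betw h S S'" "\<And>j. j \<in> S \<Longrightarrow> h (f j) = g (h j)" by blast
  obtain k where k: "bij k" "\<And>j. j \<in> S \<Longrightarrow> k j = h j" "k ` S = S'"
    by (rule bij_betw_extend_bij[OF h(1) f(2)]) blast
  have "conj_perm k f = g"
  proof
    fix i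
    obtain j where j: "i = k j" using k(1) by (metis bij_pointE)
    show "conj_perm k f i = g i"
    proof (cases "j \<in> S")
      case True
      then have "f j \<in> S" using f by (simp add: permutes_in_image)
      then have "conj_perm k f i = h (f j)" unfolding j conj_perm_apply[OF k(1)] using k(2) by blast
      also have "\<dots> = g i" unfolding j k(2)[OF True] by (rule h(2)[OF True])
      finally show ?thesis .
    next
      case False
      then have "i \<notin> S'" using k j by (metis bij_is_inj image_iff inj_image_mem_iff)
      then show ?thesis using False f g by (simp add: j conj_perm_apply[OF k(1)] permutes_not_in)
    qed
  qed
  then show ?thesis using spin_sum_conj_perm[OF f(2,1) k(1)] k(3) by simp
qed

lemma sum_mset_cycle_type:
  assumes "f permutes S" "finite S"
  shows "sum_mset (cycle_type f S) = card S"
proof -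
  have p: "permutation f" using assms permutation_permutes by blast
  have "\<Union> (orbit f ` S) = S"
    using permutes_orbit_subset[OF assms(1)] permutation_self_in_orbit[OF p] by blast
  moreover have "card (\<Union> (orbit f ` S)) = sum card (orbit f ` S)"
  proof (rule card_Union_disjoint)
    show "disjoint (orbit f ` S)"
      unfolding disjoint_def
    proof (intro ballI impI)
      fix A B assume "A \<in> orbit f ` S" "B \<in> orbit f ` S" "A \<noteq> B"
      then obtain a b where ab: "A = orbit f a" "B = orbit f b" by blast
      show "A \<inter> B = {}"
      proof (rule ccontr)
        assume "A \<inter> B \<noteq> {}"
        then obtain c where "c \<in> orbit f a" "c \<in> orbit f b" using ab by blast
        then have "orbit f a = orbit f c" "orbit f b = orbit f c"
          using orbit_cyclic_eq3[OF cyclic_on_orbit[OF assms]] by metis+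
        then show False using ab \<open>A \<noteq> B\<close> by simp
      qed
    qed
    show "finite A" if "A \<in> orbit f ` S" for A
      using that permutes_orbit_subset[OF assms(1)] assms(2) finite_subset by blast
  qed
  ultimately show ?thesis by (simp add: cycle_type_def sum_unfold_sum_mset)
qed

section \<open>Existence of a permutation with given cycle type\<close>

lemma cyclic_on_cycle_of_list:
  assumes "distinct cs" "cs \<noteq> []"
  shows "cyclic_on (cycle_of_list cs) (set cs)"
proof -
  have r: "map (cycle_of_list cs) cs = rotate1 cs"
    using cyclic_rotation[OF assms(1), of 1] by simp
  have "cyclic_on (cycle_of_list cs) ((!) cs ` {..<length cs})"
  proof (rule cyclic_on_enum)
    fix i assume "i < length cs"
    then show "cycle_of_list cs (cs ! i) = cs ! (Suc i mod length cs)"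
      using arg_cong[OF r, of "\<lambda>l. l ! i"] by (simp add: nth_rotate1)
  qed (use assms in simp)
  moreover have "(!) cs ` {..<length cs} = set cs" by (auto simp: in_set_conv_nth)
  ultimately show ?thesis by simp
qed

text \<open>A cycle on the next \<open>n\<close> numbers is composed with the permutation built so
  far. This existence gives the choice in \<open>base_choice\<close> its intended meaning.\<close>

lemma cycle_type_exists:
  assumes "\<forall>n\<in>#p. 0 < n"
  shows "\<exists>\<sigma>. \<sigma> permutes {1..sum_mset p} \<and> cycle_type \<sigma> {1..sum_mset p} = p"
  using assms
proof (induction p)
  case empty
  then show ?case by (intro exI[of _ id]) (simp add: permutes_id cycle_type_def id_def)
next
  case (add n p)
  define M where "M = sum_mset p"
  obtain \<sigma> where \<sigma>: "\<sigma> permutes {1..M}" "cycle_type \<sigma> {1..M} = p" using add unfolding M_def by auto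
  define cs where "cs = [Suc M..<Suc (M + n)]"
  define c where "c = cycle_of_list cs"
  have set: "set cs = {Suc M..M + n}" by (auto simp: cs_def)
  have n: "0 < n" using add.prems by simp
  then have "cs \<noteq> []" by (simp add: cs_def)
  then have cyc: "cyclic_on c {Suc M..M + n}"
    using cyclic_on_cycle_of_list[of cs] set unfolding c_def by (simp add: cs_def)
  have cp: "c permutes {Suc M..M + n}" unfolding c_def using cycle_permutes[of cs] set by simp
  have U: "{1..M + n} = {1..M} \<union> {Suc M..M + n}" by auto
  have c\<sigma>: "(c \<circ> \<sigma>) j = \<sigma> j" if "j \<in> {1..M}" for j
    using that \<sigma>(1) cp by (simp add: permutes_def) (metis Suc_le_eq leD atLeastAtMost_iff permutes_in_image[OF \<sigma>(1)])
  have cc: "(c \<circ> \<sigma>) j = c j" if "j \<in> {Suc M..M + n}" for j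
    using that \<sigma>(1) by (simp add: permutes_not_in)
  have in1: "\<sigma> j \<in> {1..M}" if "j \<in> {1..M}" for j using that permutes_in_image[OF \<sigma>(1)] by blast
  have in2: "c j \<in> {Suc M..M + n}" if "j \<in> {Suc M..M + n}" for j using that permutes_in_image[OF cp] by blast
  have "cycle_type (c \<circ> \<sigma>) {1..M + n} = cycle_type (c \<circ> \<sigma>) {1..M} + cycle_type (c \<circ> \<sigma>) {Suc M..M + n}"
    unfolding U using c\<sigma> cc in1 in2 by (intro cycle_type_Un) auto
  also have "cycle_type (c \<circ> \<sigma>) {1..M} = p"
    using cycle_type_cong[of "{1..M}" "c \<circ> \<sigma>" \<sigma>] c\<sigma> in1 \<sigma>(2) by simp
  also have "cycle_type (c \<circ> \<sigma>) {Suc M..M + n} = {#n#}"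
    using cycle_type_cong[of "{Suc M..M + n}" "c \<circ> \<sigma>" c] cc in2 cycle_type_cyclic[OF cyc] by simp
  finally have "cycle_type (c \<circ> \<sigma>) {1..M + n} = add_mset n p" by (simp only: add_mset_add_single[symmetric])
  moreover have "c \<circ> \<sigma> permutes {1..M + n}"
    by (rule permutes_compose; rule permutes_subset[OF \<sigma>(1)] permutes_subset[OF cp]) (auto simp: U)
  moreover have "sum_mset (add_mset n p) = M + n" by (simp add: M_def)
  ultimately show ?case by metis
qed

lemma base_choice:
  assumes "\<forall>n\<in>#p. 0 < n" "p \<noteq> {#}" "base_choice p = (\<sigma>, star)"
  shows "\<sigma> permutes {1..sum_mset p}" "cycle_type \<sigma> {1..sum_mset p} = p" "star \<in> {1..sum_mset p}"
proof -
  let ?R = "\<lambda>(\<sigma>, star). \<sigma> permutes {1..sum_mset p} \<and> cycle_type \<sigma> {1..sum_mset p} = p \<and> star \<in> {1..sum_mset p}"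
  obtain \<sigma>0 where "\<sigma>0 permutes {1..sum_mset p}" "cycle_type \<sigma>0 {1..sum_mset p} = p"
    using cycle_type_exists[OF assms(1)] by blast
  moreover obtain n where "n \<in># p" using assms(2) by blast
  then have "1 \<le> sum_mset p" using assms(1) by (metis One_nat_def Suc_leI neq0_conv sum_mset_0_iff)
  ultimately have "?R (\<sigma>0, 1)" by simp
  then have "?R (base_choice p)" unfolding base_choice_def by (rule someI[where P = ?R])
  then show "\<sigma> permutes {1..sum_mset p}" "cycle_type \<sigma> {1..sum_mset p} = p" "star \<in> {1..sum_mset p}"
    unfolding assms(3) by simp_all
qed

section \<open>Quadratic forms over the field with two elements\<close>

text \<open>Sums and products of bits are to remain field operations for the simplifier instead of
  becoming bitwise ones.\<close>

declare add_bit_eq_xor [simp del] mult_bit_eq_and [simp del]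

definition sg :: "bit \<Rightarrow> int" where
  "sg s = (if s = 0 then 1 else - 1)"

lemma sg_simps [simp]: "sg 0 = 1" "sg 1 = - 1" "sg s * sg s = 1"
  by (simp_all add: sg_def)

lemma sg_add: "sg (s + t) = sg s * sg t"
  by (cases s; cases t) simp_all

lemma sg_of_bool: "sg (of_bool c) = sb c"
  by (simp add: sb_def)

lemma sg_sum: "sg (\<Sum>i\<in>I. f i) = (\<Prod>i\<in>I. sg (f i))"
  by (induction I rule: infinite_finite_induct) (simp_all add: sg_add)

lemma sg_inject: "sg s = sg t \<longleftrightarrow> s = t"
  by (cases s; cases t) simp_all

lemma bit_add_self [simp]: "(s :: bit) + s = 0" "s + (s + t) = t"
  by (cases s; cases t; simp)+

lemma bit_add_eq_0_iff: "(s :: bit) + t = 0 \<longleftrightarrow> s = t"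
  by (cases s; cases t) simp_all

locale bit_form =
  fixes A :: "'a set" and b :: "('a \<Rightarrow> bit) \<Rightarrow> ('a \<Rightarrow> bit) \<Rightarrow> bit"
  assumes fin: "finite A"
    and add_left: "\<And>x y z. b (\<lambda>\<alpha>. x \<alpha> + y \<alpha>) z = b x z + b y z"
    and sym: "\<And>x y. b x y = b y x"
    and alt: "\<And>x. b x x = 0"
begin

definition V :: "('a \<Rightarrow> bit) set" where
  "V = {x. \<forall>\<alpha>. \<alpha> \<notin> A \<longrightarrow> x \<alpha> = 0}"

definition rad :: "('a \<Rightarrow> bit) set" where
  "rad = {x \<in> V. \<forall>y\<in>V. b x y = 0}"

definition sympl :: "nat \<Rightarrow> (nat \<Rightarrow> 'a \<Rightarrow> bit) \<Rightarrow> (nat \<Rightarrow> 'a \<Rightarrow> bit) \<Rightarrow> bool" where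
  "sympl g u v \<longleftrightarrow> (\<forall>i<g. u i \<in> V \<and> v i \<in> V)
     \<and> (\<forall>i<g. \<forall>j<g. b (u i) (u j) = 0 \<and> b (v i) (v j) = 0 \<and> b (u i) (v j) = of_bool (i = j))"

text \<open>Spanning is meant modulo the radical, just as a symplectic basis of homology generates
  the cycles modulo boundaries.\<close>

definition spans :: "nat \<Rightarrow> (nat \<Rightarrow> 'a \<Rightarrow> bit) \<Rightarrow> (nat \<Rightarrow> 'a \<Rightarrow> bit) \<Rightarrow> bool" where
  "spans g u v \<longleftrightarrow> (\<forall>x\<in>V. \<exists>I J. I \<subseteq> {..<g} \<and> J \<subseteq> {..<g}
     \<and> (\<lambda>\<alpha>. x \<alpha> + ((\<Sum>i\<in>I. u i \<alpha>) + (\<Sum>j\<in>J. v j \<alpha>))) \<in> rad)"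

lemma zero_left: "b (\<lambda>\<alpha>. 0) z = 0"
  using add_left[of "\<lambda>\<alpha>. 0" "\<lambda>\<alpha>. 0" z] by simp

lemma sum_left: "b (\<lambda>\<alpha>. \<Sum>i\<in>I. u i \<alpha>) z = (\<Sum>i\<in>I. b (u i) z)"
  by (induction I rule: infinite_finite_induct) (simp_all add: zero_left add_left)

lemma add_right: "b z (\<lambda>\<alpha>. x \<alpha> + y \<alpha>) = b z x + b z y"
  using add_left sym by metis

lemma sum_right: "b z (\<lambda>\<alpha>. \<Sum>i\<in>I. u i \<alpha>) = (\<Sum>i\<in>I. b z (u i))"
  by (simp add: sum_left sym[of z])

lemma V_zero: "(\<lambda>\<alpha>. 0) \<in> V"
  by (simp add: V_def)

lemma V_add: "x \<in> V \<Longrightarrow> y \<in> V \<Longrightarrow> (\<lambda>\<alpha>. x \<alpha> + y \<alpha>) \<in> V"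
  by (simp add: V_def)

lemma V_sum: "(\<And>i. i \<in> I \<Longrightarrow> u i \<in> V) \<Longrightarrow> (\<lambda>\<alpha>. \<Sum>i\<in>I. u i \<alpha>) \<in> V"
  by (simp add: V_def)

lemma bij_betw_V: "bij_betw (\<lambda>Y \<alpha>. of_bool (\<alpha> \<in> Y)) (Pow A) V"
proof (rule bij_betw_byWitness[where f' = "\<lambda>x. {\<alpha>. x \<alpha> = 1}"])
  show "\<forall>x\<in>V. (\<lambda>\<alpha>. of_bool (\<alpha> \<in> {\<alpha>. x \<alpha> = 1})) = x"
    by (auto simp: fun_eq_iff of_bool_def)
  show "(\<lambda>x. {\<alpha>. x \<alpha> = 1}) ` V \<subseteq> Pow A"
    by (auto simp: V_def)
qed (auto simp: V_def)

lemma finite_V: "finite V"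
  using bij_betw_V fin by (metis bij_betw_finite finite_Pow_iff)

lemma card_V: "card V = 2 ^ card A"
  using bij_betw_V fin by (metis bij_betw_same_card card_Pow)

lemma finite_rad: "finite rad"
  using finite_V by (simp add: rad_def)

lemma sum_of_bool_mem:
  fixes I :: "nat set"
  assumes "I \<subseteq> {..<g}"
  shows "(\<Sum>i\<in>I. of_bool (i = j)) = (of_bool (j \<in> I) :: bit)"
  using finite_subset[OF assms finite_lessThan] by (simp add: of_bool_def sum.delta)

text \<open>Pairing with the partner of a basis vector reads off its coefficient; this yields both
  the projection onto the family and the uniqueness of coordinates.\<close>

lemma comb_pairing:
  assumes s: "sympl g u v" and IJ: "I \<subseteq> {..<g}" "J \<subseteq> {..<g}" and k: "k < g"
  shows "b (\<lambda>\<alpha>. (\<Sum>i\<in>I. u i \<alpha>) + (\<Sum>j\<in>J. v j \<alpha>)) (v k) = of_bool (k \<in> I)"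
    "b (\<lambda>\<alpha>. (\<Sum>i\<in>I. u i \<alpha>) + (\<Sum>j\<in>J. v j \<alpha>)) (u k) = of_bool (k \<in> J)"
proof -
  have "(\<Sum>i\<in>I. b (u i) (v k)) = (\<Sum>i\<in>I. of_bool (i = k))" "(\<Sum>i\<in>J. b (v i) (v k)) = (\<Sum>i\<in>J. 0)"
    "(\<Sum>i\<in>I. b (u i) (u k)) = (\<Sum>i\<in>I. 0)"
    using s IJ k unfolding sympl_def by (intro sum.cong refl; blast)+
  moreover have "(\<Sum>j\<in>J. b (v j) (u k)) = (\<Sum>j\<in>J. of_bool (j = k))"
    using s IJ k unfolding sympl_def by (intro sum.cong) (auto simp: sym[of "v _" "u _"])
  ultimately show "b (\<lambda>\<alpha>. (\<Sum>i\<in>I. u i \<alpha>) + (\<Sum>j\<in>J. v j \<alpha>)) (v k) = of_bool (k \<in> I)"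
    "b (\<lambda>\<alpha>. (\<Sum>i\<in>I. u i \<alpha>) + (\<Sum>j\<in>J. v j \<alpha>)) (u k) = of_bool (k \<in> J)"
    using sum_of_bool_mem[OF IJ(1)] sum_of_bool_mem[OF IJ(2)] by (simp_all add: add_left sum_left)
qed

lemma comb_V:
  assumes "sympl g u v" "I \<subseteq> {..<g}" "J \<subseteq> {..<g}"
  shows "(\<lambda>\<alpha>. (\<Sum>i\<in>I. u i \<alpha>) + (\<Sum>j\<in>J. v j \<alpha>)) \<in> V"
  using assms unfolding sympl_def by (intro V_add V_sum) auto

text \<open>A symplectic family of maximal length spans: otherwise some vector and a partner, both made
  orthogonal to the family, would extend it.\<close>

lemma symplectic_basis_exists:
  obtains g u v where "sympl g u v" "spans g u v"
proof -
  let ?P = "\<lambda>g. \<exists>u v. sympl g u v"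
  have "?P 0" by (simp add: sympl_def)
  \<comment> \<open>The vectors \<open>u i\<close> are told apart by their partners, so the length
    of a symplectic family is bounded and a longest one exists.\<close>
  moreover have "g \<le> card V" if "?P g" for g
  proof -
    obtain u v where uv: "sympl g u v" using \<open>?P g\<close> by blast
    have "inj_on u {..<g}"
    proof (rule inj_onI)
      fix i j assume ij: "i \<in> {..<g}" "j \<in> {..<g}" "u i = u j"
      then have "b (u i) (v j) = of_bool (i = j)" "b (u j) (v j) = of_bool (j = j)"
        using uv unfolding sympl_def by blast+
      then show "i = j" using ij(3) by (cases "i = j") auto
    qed
    moreover have "u ` {..<g} \<subseteq> V" using uv by (auto simp: sympl_def)
    ultimately show ?thesis using card_inj_on_le[OF _ _ finite_V] by fastforce
  qed
  ultimately obtain g where g: "?P g" "\<And>g'. ?P g' \<Longrightarrow> g' \<le> g"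
    using Nat.ex_has_greatest_nat[of ?P 0 "card V"] by blast
  obtain u v where uv: "sympl g u v" using g(1) by blast
  define I where "I x = {i. i < g \<and> b x (v i) = 1}" for x
  define J where "J x = {i. i < g \<and> b x (u i) = 1}" for x
  \<comment> \<open>\<open>pr x\<close> removes the component of \<open>x\<close> in the family: the
    coefficient of \<open>u i\<close> is the pairing with \<open>v i\<close>, and
    conversely.\<close>
  define pr where "pr x = (\<lambda>\<alpha>. x \<alpha> + ((\<Sum>i\<in>I x. u i \<alpha>) + (\<Sum>j\<in>J x. v j \<alpha>)))" for x
  have IJ: "I x \<subseteq> {..<g}" "J x \<subseteq> {..<g}" for x by (auto simp: I_def J_def)
  have prV: "pr x \<in> V" if "x \<in> V" for x
    unfolding pr_def using that comb_V[OF uv IJ] by (rule V_add)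
  have pr_orth: "b (pr x) (u k) = 0" "b (pr x) (v k) = 0" if k: "k < g" for x k
    using comb_pairing[OF uv IJ k, of x x] k unfolding pr_def add_left[of x]
    by (auto simp: I_def J_def)
  have "pr x \<in> rad" if x: "x \<in> V" for x
  proof (rule ccontr)
    assume "pr x \<notin> rad"
    then obtain y where y: "y \<in> V" "b (pr x) y = 1" using prV[OF x] by (auto simp: rad_def)
    have "b (pr x) (\<lambda>\<alpha>. (\<Sum>i\<in>I y. u i \<alpha>) + (\<Sum>j\<in>J y. v j \<alpha>)) = 0"
      using pr_orth IJ[of y] unfolding add_right sum_right by (simp add: subset_eq)
    then have xy: "b (pr x) (pr y) = 1" using y(2) unfolding pr_def[of y] add_right by simp
    have orth': "b (u k) (pr z) = 0" "b (v k) (pr z) = 0" if "k < g" for k z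
      using pr_orth[OF that] sym by metis+
    have "sympl (Suc g) (u(g := pr x)) (v(g := pr y))"
      unfolding sympl_def
    proof (intro conjI allI impI)
      fix i assume i: "i < Suc g"
      show "(u(g := pr x)) i \<in> V" "(v(g := pr y)) i \<in> V"
        using i uv prV[OF x] prV[OF y(1)] unfolding sympl_def by (cases "i = g"; simp)+
      fix j assume j: "j < Suc g"
      consider "i < g" "j < g" | "i < g" "j = g" | "i = g" "j < g" | "i = g" "j = g"
        using i j by linarith
      note c = this
      show "b ((u(g := pr x)) i) ((u(g := pr x)) j) = 0"
        using c by cases (use uv pr_orth orth' alt in \<open>simp_all add: sympl_def\<close>)
      show "b ((v(g := pr y)) i) ((v(g := pr y)) j) = 0"
        using c by cases (use uv pr_orth orth' alt in \<open>simp_all add: sympl_def\<close>)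
      show "b ((u(g := pr x)) i) ((v(g := pr y)) j) = of_bool (i = j)"
        using c by cases (use uv pr_orth orth' xy in \<open>simp_all add: sympl_def\<close>)
    qed
    then have "Suc g \<le> g" using g(2) by blast
    then show False by simp
  qed
  note pr_rad = this
  have "spans g u v"
    unfolding spans_def
  proof
    fix x assume "x \<in> V"
    have "(\<lambda>\<alpha>. x \<alpha> + ((\<Sum>i\<in>I x. u i \<alpha>) + (\<Sum>j\<in>J x. v j \<alpha>))) \<in> rad"
      using pr_rad[OF \<open>x \<in> V\<close>] unfolding pr_def .
    then show "\<exists>I J. I \<subseteq> {..<g} \<and> J \<subseteq> {..<g}
       \<and> (\<lambda>\<alpha>. x \<alpha> + ((\<Sum>i\<in>I. u i \<alpha>) + (\<Sum>j\<in>J. v j \<alpha>))) \<in> rad"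
      by (intro exI[of _ "I x"] exI[of _ "J x"] conjI IJ)
  qed
  then show ?thesis using uv that by blast
qed

end

locale bit_quadratic = bit_form +
  fixes q :: "('a \<Rightarrow> bit) \<Rightarrow> bit"
  assumes q_add: "\<And>x y. x \<in> V \<Longrightarrow> y \<in> V \<Longrightarrow> q (\<lambda>\<alpha>. x \<alpha> + y \<alpha>) = q x + q y + b x y"
begin

lemma q_zero: "q (\<lambda>\<alpha>. 0) = 0"
  using q_add[OF V_zero V_zero] by (simp add: zero_left)

lemma q_sum:
  assumes "finite I" "\<And>i. i \<in> I \<Longrightarrow> u i \<in> V" "\<And>i j. i \<in> I \<Longrightarrow> j \<in> I \<Longrightarrow> b (u i) (u j) = 0"
  shows "q (\<lambda>\<alpha>. \<Sum>i\<in>I. u i \<alpha>) = (\<Sum>i\<in>I. q (u i))"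
  using assms
proof (induction I)
  case (insert k I)
  have "b (u k) (\<lambda>\<alpha>. \<Sum>i\<in>I. u i \<alpha>) = 0" using insert.prems by (simp add: sum_right)
  moreover have "(\<lambda>\<alpha>. \<Sum>i\<in>I. u i \<alpha>) \<in> V" using insert.prems by (intro V_sum) auto
  ultimately show ?case using insert by (simp add: q_add)
qed (simp add: q_zero)

lemma comb_q:
  assumes s: "sympl g u v" and IJ: "I \<subseteq> {..<g}" "J \<subseteq> {..<g}"
  shows "q (\<lambda>\<alpha>. (\<Sum>i\<in>I. u i \<alpha>) + (\<Sum>j\<in>J. v j \<alpha>)) =
    (\<Sum>i\<in>I. q (u i)) + (\<Sum>j\<in>J. q (v j) + of_bool (j \<in> I))"
proof -
  have fin: "finite I" "finite J" using IJ finite_subset by blast+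
  have uI: "(\<lambda>\<alpha>. \<Sum>i\<in>I. u i \<alpha>) \<in> V" "(\<lambda>\<alpha>. \<Sum>j\<in>J. v j \<alpha>) \<in> V"
    using s IJ by (auto simp: sympl_def intro!: V_sum)
  have "q (\<lambda>\<alpha>. \<Sum>i\<in>I. u i \<alpha>) = (\<Sum>i\<in>I. q (u i))" "q (\<lambda>\<alpha>. \<Sum>j\<in>J. v j \<alpha>) = (\<Sum>j\<in>J. q (v j))"
    using s IJ fin by (auto simp: sympl_def subset_eq intro!: q_sum)
  moreover have "b (\<lambda>\<alpha>. \<Sum>i\<in>I. u i \<alpha>) (\<lambda>\<alpha>. \<Sum>j\<in>J. v j \<alpha>) = (\<Sum>j\<in>J. of_bool (j \<in> I))"
    unfolding sum_right
  proof (intro sum.cong refl)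
    fix j assume "j \<in> J"
    then have "j < g" using IJ by auto
    then show "b (\<lambda>\<alpha>. \<Sum>i\<in>I. u i \<alpha>) (v j) = of_bool (j \<in> I)"
      using comb_pairing(1)[OF s IJ(1), of "{}" j] by simp
  qed
  ultimately show ?thesis using q_add[OF uI] by (simp add: sum.distrib)
qed

text \<open>The sum factors over hyperbolic planes. A plane with values \<open>c\<close> and
  \<open>d\<close> on its basis contributes \<open>1 + sg c + sg d - sg c * sg d\<close>, which is
  \<open>2 * sg (c * d)\<close>; the minus sign comes from the pairing of the two basis
  vectors.\<close>

lemma gauss_sum_hyperbolic:
  assumes G: "finite G"
  shows "(\<Sum>I\<in>Pow G. \<Sum>J\<in>Pow G. sg ((\<Sum>i\<in>I. c i) + (\<Sum>j\<in>J. d j + of_bool (j \<in> I))))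
    = 2 ^ card G * sg (\<Sum>i\<in>G. c i * d i)"
proof -
  have inner: "(\<Sum>J\<in>Pow G. sg ((\<Sum>i\<in>I. c i) + (\<Sum>j\<in>J. d j + of_bool (j \<in> I))))
    = (\<Prod>i\<in>I. sg (c i) * (1 - sg (d i))) * (\<Prod>i\<in>G - I. 1 + sg (d i))" if I: "I \<subseteq> G" for I
  proof -
    have "(\<Sum>J\<in>Pow G. sg ((\<Sum>i\<in>I. c i) + (\<Sum>j\<in>J. d j + of_bool (j \<in> I))))
      = (\<Prod>i\<in>I. sg (c i)) * (\<Sum>J\<in>Pow G. (\<Prod>j\<in>J. sg (d j) * sb (j \<in> I)) * (\<Prod>j\<in>G - J. 1))"
      by (simp add: sg_add sg_sum sg_of_bool sum_distrib_left)
    also have "\<dots> = (\<Prod>i\<in>I. sg (c i)) * (\<Prod>j\<in>G. sg (d j) * sb (j \<in> I) + 1)"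
      by (subst prod_add[OF G]) simp
    also have "(\<Prod>j\<in>G. sg (d j) * sb (j \<in> I) + 1) =
        (\<Prod>j\<in>I. sg (d j) * sb (j \<in> I) + 1) * (\<Prod>j\<in>G - I. sg (d j) * sb (j \<in> I) + 1)"
      by (subst prod.subset_diff[OF I G]) (rule mult.commute)
    also have "(\<Prod>j\<in>I. sg (d j) * sb (j \<in> I) + 1) = (\<Prod>j\<in>I. 1 - sg (d j))"
      by (intro prod.cong) auto
    also have "(\<Prod>j\<in>G - I. sg (d j) * sb (j \<in> I) + 1) = (\<Prod>j\<in>G - I. 1 + sg (d j))"
      by (intro prod.cong) auto
    finally show ?thesis by (simp add: prod.distrib mult.assoc)
  qed
  have "(\<Sum>I\<in>Pow G. \<Sum>J\<in>Pow G. sg ((\<Sum>i\<in>I. c i) + (\<Sum>j\<in>J. d j + of_bool (j \<in> I))))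
    = (\<Sum>I\<in>Pow G. (\<Prod>i\<in>I. sg (c i) * (1 - sg (d i))) * (\<Prod>i\<in>G - I. 1 + sg (d i)))"
    using inner by (intro sum.cong) auto
  also have "\<dots> = (\<Prod>i\<in>G. sg (c i) * (1 - sg (d i)) + (1 + sg (d i)))"
    by (rule prod_add[OF G, symmetric])
  also have "\<dots> = (\<Prod>i\<in>G. 2 * sg (c i * d i))"
  proof (intro prod.cong refl)
    fix i show "sg (c i) * (1 - sg (d i)) + (1 + sg (d i)) = 2 * sg (c i * d i)"
      by (cases "c i"; cases "d i") simp_all
  qed
  finally show ?thesis by (simp add: prod.distrib sg_sum)
qed

text \<open>Each vector is uniquely the sum of a radical vector and a combination of the symplectic
  family: existence is the spanning property, and uniqueness follows by pairing. As \<open>q\<close>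
  ignores the radical part, the hyperbolic sum is repeated \<open>card rad\<close> times.\<close>

lemma gauss_sum:
  assumes s: "sympl g u v" and sp: "spans g u v" and q0: "\<And>x. x \<in> rad \<Longrightarrow> q x = 0"
  shows "(\<Sum>x\<in>V. sg (q x)) = int (card rad) * 2 ^ g * sg (\<Sum>i<g. q (u i) * q (v i))"
    "card V = card rad * 4 ^ g"
proof -
  define F where "F = (\<lambda>(r, I, J). (\<lambda>\<alpha>. r \<alpha> + ((\<Sum>i\<in>I. u i \<alpha>) + (\<Sum>j\<in>J. v j \<alpha>))))"
  define D where "D = rad \<times> Pow {..<g} \<times> Pow {..<g}"
  have radV: "r \<in> V" and rad0: "x \<in> V \<Longrightarrow> b r x = 0" if "r \<in> rad" for r x using that by (auto simp: rad_def)
  have pair: "b (F (r, I, J)) (v k) = of_bool (k \<in> I)" "b (F (r, I, J)) (u k) = of_bool (k \<in> J)"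
    if "(r, I, J) \<in> D" "k < g" for r I J k
    using that comb_pairing[OF s, of I J k] s rad0[of r "u k"] rad0[of r "v k"]
    unfolding F_def D_def prod.case add_left[of r] by (auto simp: sympl_def)
  have "inj_on F D"
  proof (rule inj_onI)
    fix p p' assume p: "p \<in> D" "p' \<in> D" "F p = F p'"
    obtain r I J r' I' J' where e: "p = (r, I, J)" "p' = (r', I', J')" by (metis prod_cases3)
    have "k \<in> I \<longleftrightarrow> k \<in> I'" "k \<in> J \<longleftrightarrow> k \<in> J'" if "k < g" for k
      using pair[of r I J k] pair[of r' I' J' k] p that unfolding e by (auto simp: of_bool_def split: if_splits)
    moreover have "I \<subseteq> {..<g}" "J \<subseteq> {..<g}" "I' \<subseteq> {..<g}" "J' \<subseteq> {..<g}" using p e by (auto simp: D_def)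
    ultimately have IJ: "I = I'" "J = J'" by blast+
    have "r \<alpha> = r' \<alpha>" for \<alpha>
      using fun_cong[OF p(3), of \<alpha>] unfolding e F_def IJ by simp
    then show "p = p'" using e IJ by auto
  qed
  moreover have "F ` D = V"
  proof
    show "F ` D \<subseteq> V"
    proof
      fix x assume "x \<in> F ` D"
      then obtain r I J where rIJ: "r \<in> rad" "I \<subseteq> {..<g}" "J \<subseteq> {..<g}" and x: "x = F (r, I, J)"
        unfolding D_def by blast
      show "x \<in> V"
        unfolding x F_def prod.case using radV[OF rIJ(1)] comb_V[OF s rIJ(2,3)] by (rule V_add)
    qed
    show "V \<subseteq> F ` D"
    proof
      fix x assume "x \<in> V"
      then obtain I J where IJ: "I \<subseteq> {..<g}" "J \<subseteq> {..<g}"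
        "(\<lambda>\<alpha>. x \<alpha> + ((\<Sum>i\<in>I. u i \<alpha>) + (\<Sum>j\<in>J. v j \<alpha>))) \<in> rad"
        using sp unfolding spans_def by blast
      have "x = F (\<lambda>\<alpha>. x \<alpha> + ((\<Sum>i\<in>I. u i \<alpha>) + (\<Sum>j\<in>J. v j \<alpha>)), I, J)"
        by (auto simp: F_def fun_eq_iff add.assoc)
      then show "x \<in> F ` D" using IJ by (auto simp: D_def)
    qed
  qed
  ultimately have bij: "bij_betw F D V" by (simp add: bij_betw_def)
  have fin: "finite rad" by (rule finite_rad)
  have qF: "q (F (r, I, J)) = (\<Sum>i\<in>I. q (u i)) + (\<Sum>j\<in>J. q (v j) + of_bool (j \<in> I))"
    if r: "r \<in> rad" and IJ: "I \<subseteq> {..<g}" "J \<subseteq> {..<g}" for r I J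
    using q_add[OF radV[OF r] comb_V[OF s IJ]] rad0[OF r comb_V[OF s IJ]] q0[OF r] comb_q[OF s IJ]
    by (simp add: F_def)
  have "(\<Sum>x\<in>V. sg (q x)) = (\<Sum>p\<in>D. sg (q (F p)))"
    using sum.reindex_bij_betw[OF bij, of "\<lambda>x. sg (q x)"] by simp
  also have "\<dots> = (\<Sum>r\<in>rad. \<Sum>I\<in>Pow {..<g}. \<Sum>J\<in>Pow {..<g}. sg (q (F (r, I, J))))"
    unfolding D_def by (simp add: sum.cartesian_product)
  also have "\<dots> = (\<Sum>r\<in>rad. \<Sum>I\<in>Pow {..<g}. \<Sum>J\<in>Pow {..<g}.
      sg ((\<Sum>i\<in>I. q (u i)) + (\<Sum>j\<in>J. q (v j) + of_bool (j \<in> I))))"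
    using qF by (intro sum.cong) auto
  also have "\<dots> = int (card rad) * 2 ^ g * sg (\<Sum>i<g. q (u i) * q (v i))"
    by (subst gauss_sum_hyperbolic) simp_all
  finally show "(\<Sum>x\<in>V. sg (q x)) = int (card rad) * 2 ^ g * sg (\<Sum>i<g. q (u i) * q (v i))" .
  have "card V = card D" using bij_betw_same_card[OF bij] by simp
  then show "card V = card rad * 4 ^ g"
    using fin by (simp add: D_def card_cartesian_product card_Pow flip: power_mult_distrib)
qed

end

section \<open>The quadratic form of a labeled permutation\<close>

definition proper :: "'a lperm \<Rightarrow> bool" where
  "proper \<pi> \<longleftrightarrow> distinct (fst \<pi>) \<and> distinct (snd \<pi>) \<and> set (snd \<pi>) = set (fst \<pi>)"

lemma length_takeWhile_nth:
  "distinct xs \<Longrightarrow> k < length xs \<Longrightarrow> length (takeWhile (\<lambda>\<beta>. \<beta> \<noteq> xs ! k) xs) = k"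
proof (induction xs arbitrary: k)
  case (Cons x xs)
  then show ?case by (cases k) auto
qed simp

lemma proper_length: "proper \<pi> \<Longrightarrow> length (labels_of \<pi> r) = length (fst \<pi>)"
  by (cases r) (auto simp: proper_def dest!: distinct_card)

lemma pos_nth: "proper \<pi> \<Longrightarrow> k < length (fst \<pi>) \<Longrightarrow> pos \<pi> r (labels_of \<pi> r ! k) = k"
  using proper_length[of \<pi> r] unfolding pos_def
  by (intro length_takeWhile_nth) (cases r; simp add: proper_def)+

lemma alphabet_nth:
  assumes "proper \<pi>" "\<alpha> \<in> alphabet \<pi>"
  obtains k where "k < length (fst \<pi>)" "labels_of \<pi> r ! k = \<alpha>" "pos \<pi> r \<alpha> = k"
proof -
  have "\<alpha> \<in> set (labels_of \<pi> r)" using assms by (cases r) (auto simp: alphabet_def proper_def)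
  then obtain k where "k < length (labels_of \<pi> r)" "labels_of \<pi> r ! k = \<alpha>" by (auto simp: in_set_conv_nth)
  then show ?thesis using that[of k] pos_nth[OF assms(1), of k r] proper_length[OF assms(1)] by metis
qed

lemma labels_of_pos: "proper \<pi> \<Longrightarrow> \<alpha> \<in> alphabet \<pi> \<Longrightarrow> labels_of \<pi> r ! pos \<pi> r \<alpha> = \<alpha>"
  using alphabet_nth by metis

lemma pos_less: "proper \<pi> \<Longrightarrow> \<alpha> \<in> alphabet \<pi> \<Longrightarrow> pos \<pi> r \<alpha> < length (fst \<pi>)"
  using alphabet_nth by metis

lemma pos_inject:
  "proper \<pi> \<Longrightarrow> \<alpha> \<in> alphabet \<pi> \<Longrightarrow> \<beta> \<in> alphabet \<pi> \<Longrightarrow> pos \<pi> r \<alpha> = pos \<pi> r \<beta> \<longleftrightarrow> \<alpha> = \<beta>"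
  using labels_of_pos by metis

text \<open>Each inverted pair of labels is taken once, in the orientation that increases on top; a
  sum of the symmetric relation \<open>loops_cross\<close> over ordered pairs would vanish mod
  2.\<close>

definition quad :: "'a lperm \<Rightarrow> ('a \<Rightarrow> bit) \<Rightarrow> bit" where
  "quad \<pi> x = (\<Sum>\<alpha>\<in>alphabet \<pi>. x \<alpha>) + (\<Sum>\<alpha>\<in>alphabet \<pi>. \<Sum>\<beta>\<in>alphabet \<pi>.
     x \<alpha> * x \<beta> * of_bool (pos \<pi> Top \<alpha> < pos \<pi> Top \<beta> \<and> pos \<pi> Bottom \<beta> < pos \<pi> Bottom \<alpha>))"

lemma finite_alphabet: "finite (alphabet \<pi>)"
  by (simp add: alphabet_def)

lemma loops_cross_eq:
  assumes "proper \<pi>" "\<alpha> \<in> alphabet \<pi>" "\<beta> \<in> alphabet \<pi>"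
  shows "(of_bool (loops_cross \<pi> \<alpha> \<beta>) :: bit) =
     of_bool (pos \<pi> Top \<alpha> < pos \<pi> Top \<beta> \<and> pos \<pi> Bottom \<beta> < pos \<pi> Bottom \<alpha>)
     + of_bool (pos \<pi> Top \<beta> < pos \<pi> Top \<alpha> \<and> pos \<pi> Bottom \<alpha> < pos \<pi> Bottom \<beta>)"
proof (cases "\<alpha> = \<beta>")
  case False
  then have "pos \<pi> Top \<alpha> \<noteq> pos \<pi> Top \<beta>" "pos \<pi> Bottom \<alpha> \<noteq> pos \<pi> Bottom \<beta>"
    using pos_inject assms by metis+
  then show ?thesis by (cases "pos \<pi> Top \<alpha> < pos \<pi> Top \<beta>"; cases "pos \<pi> Bottom \<alpha> < pos \<pi> Bottom \<beta>") (auto simp: loops_cross_def)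
qed (simp add: loops_cross_def)

lemma intersection_form_sym:
  assumes "proper \<pi>"
  shows "intersection_form \<pi> x y = intersection_form \<pi> y x"
proof -
  have "loops_cross \<pi> \<alpha> \<beta> = loops_cross \<pi> \<beta> \<alpha>" if "\<alpha> \<in> alphabet \<pi>" "\<beta> \<in> alphabet \<pi>" for \<alpha> \<beta>
    using loops_cross_eq[OF assms that] loops_cross_eq[OF assms that(2,1)]
    by (metis add.commute of_bool_eq_iff)
  then show ?thesis
    unfolding intersection_form_def by (subst sum.swap) (intro sum.cong refl, simp add: mult_ac)
qed

lemma quad_add:
  assumes "proper \<pi>"
  shows "quad \<pi> (\<lambda>\<alpha>. x \<alpha> + y \<alpha>) = quad \<pi> x + quad \<pi> y + intersection_form \<pi> x y"
proof -
  let ?A = "alphabet \<pi>"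
  let ?c = "\<lambda>\<alpha> \<beta>. of_bool (pos \<pi> Top \<alpha> < pos \<pi> Top \<beta> \<and> pos \<pi> Bottom \<beta> < pos \<pi> Bottom \<alpha>) :: bit"
  have "intersection_form \<pi> x y = (\<Sum>\<alpha>\<in>?A. \<Sum>\<beta>\<in>?A. x \<alpha> * y \<beta> * ?c \<alpha> \<beta>) + (\<Sum>\<alpha>\<in>?A. \<Sum>\<beta>\<in>?A. x \<alpha> * y \<beta> * ?c \<beta> \<alpha>)"
    unfolding intersection_form_def using loops_cross_eq[OF assms]
    by (simp add: distrib_left sum.distrib)
  also have "(\<Sum>\<alpha>\<in>?A. \<Sum>\<beta>\<in>?A. x \<alpha> * y \<beta> * ?c \<beta> \<alpha>) = (\<Sum>\<alpha>\<in>?A. \<Sum>\<beta>\<in>?A. y \<alpha> * x \<beta> * ?c \<alpha> \<beta>)"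
    by (subst sum.swap) (simp add: mult_ac)
  finally show ?thesis
    by (simp add: quad_def distrib_left distrib_right sum.distrib add_ac)
qed

lemma quadratic_lperm:
  assumes "proper \<pi>"
  shows "bit_quadratic (alphabet \<pi>) (intersection_form \<pi>) (quad \<pi>)"
proof -
  interpret bit_form "alphabet \<pi>" "intersection_form \<pi>"
  proof
    show "finite (alphabet \<pi>)" by (rule finite_alphabet)
    show "intersection_form \<pi> (\<lambda>\<alpha>. x \<alpha> + y \<alpha>) z = intersection_form \<pi> x z + intersection_form \<pi> y z" for x y z
      by (simp add: intersection_form_def distrib_right sum.distrib)
    show "intersection_form \<pi> x y = intersection_form \<pi> y x" for x y
      using assms by (rule intersection_form_sym)
    show "intersection_form \<pi> x x = 0" for x
      using quad_add[OF assms, of x x] by (simp add: quad_def)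
  qed
  show ?thesis by unfold_locales (rule quad_add[OF assms])
qed

lemma V_eq_cycles: "proper \<pi> \<Longrightarrow> bit_form.V (alphabet \<pi>) = cycles \<pi>"
  using bit_form.V_def[OF bit_quadratic.axioms(1)[OF quadratic_lperm]] by (simp add: cycles_def)

definition delta :: "'a \<Rightarrow> 'a \<Rightarrow> bit" where
  "delta \<alpha> \<beta> = of_bool (\<beta> = \<alpha>)"

lemma quad_delta: "\<alpha> \<in> alphabet \<pi> \<Longrightarrow> quad \<pi> (delta \<alpha>) = 1"
proof -
  assume \<alpha>: "\<alpha> \<in> alphabet \<pi>"
  have "(\<Sum>\<beta>\<in>alphabet \<pi>. delta \<alpha> \<beta>) = 1"
    using \<alpha> by (simp add: finite_alphabet delta_def of_bool_def sum.delta)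
  moreover have "delta \<alpha> \<beta> * delta \<alpha> \<gamma> * of_bool (pos \<pi> Top \<beta> < pos \<pi> Top \<gamma> \<and> pos \<pi> Bottom \<gamma> < pos \<pi> Bottom \<beta>) = 0" for \<beta> \<gamma>
    by (cases "\<beta> = \<alpha>"; cases "\<gamma> = \<alpha>") (simp_all add: delta_def)
  then have "(\<Sum>\<beta>\<in>alphabet \<pi>. \<Sum>\<gamma>\<in>alphabet \<pi>. delta \<alpha> \<beta> * delta \<alpha> \<gamma>
      * of_bool (pos \<pi> Top \<beta> < pos \<pi> Top \<gamma> \<and> pos \<pi> Bottom \<gamma> < pos \<pi> Bottom \<beta>)) = 0"
    by (intro sum.neutral ballI)
  ultimately show ?thesis unfolding quad_def by (simp only: add_0_right)
qed

lemma intersection_form_delta: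
  assumes "\<alpha> \<in> alphabet \<pi>"
  shows "intersection_form \<pi> (delta \<alpha>) y = (\<Sum>\<beta>\<in>alphabet \<pi>. y \<beta> * of_bool (loops_cross \<pi> \<alpha> \<beta>))"
proof -
  have "intersection_form \<pi> (delta \<alpha>) y =
      (\<Sum>\<gamma>\<in>alphabet \<pi>. if \<gamma> = \<alpha> then (\<Sum>\<beta>\<in>alphabet \<pi>. y \<beta> * of_bool (loops_cross \<pi> \<alpha> \<beta>)) else 0)"
    unfolding intersection_form_def by (intro sum.cong refl) (simp add: delta_def)
  then show ?thesis using assms by (simp add: finite_alphabet sum.delta)
qed

section \<open>Crossing numbers along a closed curve\<close>

fun pair_sum :: "('b \<Rightarrow> 'b \<Rightarrow> bit) \<Rightarrow> 'b list \<Rightarrow> bit" where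
  "pair_sum f [] = 0"
| "pair_sum f (c # cs) = (\<Sum>d\<leftarrow>cs. f c d) + pair_sum f cs"

lemma pair_sum_cong:
  "sorted_wrt (\<lambda>c d. f c d = g c d) cs \<Longrightarrow> pair_sum f cs = pair_sum g cs"
  by (induction cs) (simp_all cong: map_cong)

lemma pair_sum_zero: "sorted_wrt (\<lambda>c d. f c d = 0) cs \<Longrightarrow> pair_sum f cs = 0"
  by (induction cs) (simp_all cong: map_cong)

lemma pair_sum_map: "pair_sum f (map h cs) = pair_sum (\<lambda>c d. f (h c) (h d)) cs"
  by (induction cs) (simp_all add: comp_def)

definition label_of :: "'a crossing \<Rightarrow> 'a" where
  "label_of c = fst (snd c)"

lemma cycle_of_curve_Cons:
  "cycle_of_curve (c # \<gamma>) = (\<lambda>\<alpha>. delta (label_of c) \<alpha> + cycle_of_curve \<gamma> \<alpha>)"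
  by (cases c) (auto simp: fun_eq_iff cycle_of_curve_def delta_def label_of_def)

text \<open>The class is a sum of one \<open>delta\<close> per crossing, each of value 1, and every
  pair of crossings adds an intersection number. Repeated crossings of a side fit in because a label
  does not cross itself.\<close>

lemma quad_cycle_of_curve:
  assumes "proper \<pi>" "\<forall>c\<in>set \<gamma>. label_of c \<in> alphabet \<pi>"
  shows "quad \<pi> (cycle_of_curve \<gamma>) = of_nat (length \<gamma>)
    + pair_sum (\<lambda>c d. of_bool (loops_cross \<pi> (label_of c) (label_of d))) \<gamma>"
  using assms(2)
proof (induction \<gamma>)
  case Nil
  then show ?case by (simp add: quad_def cycle_of_curve_def)
next
  case (Cons c \<gamma>)
  have "(\<Sum>\<beta>\<in>alphabet \<pi>. cycle_of_curve \<gamma> \<beta> * of_bool (loops_cross \<pi> (label_of c) \<beta>))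
     = (\<Sum>d\<leftarrow>\<gamma>. of_bool (loops_cross \<pi> (label_of c) (label_of d)))"
    using Cons.prems
  proof (induction \<gamma>)
    case Nil
    then show ?case by (simp add: cycle_of_curve_def)
  next
    case (Cons d \<gamma>)
    have "delta (label_of d) \<beta> * of_bool (loops_cross \<pi> (label_of c) \<beta>)
       = (if \<beta> = label_of d then of_bool (loops_cross \<pi> (label_of c) (label_of d)) else 0)" for \<beta>
      by (simp add: delta_def)
    then have "(\<Sum>\<beta>\<in>alphabet \<pi>. delta (label_of d) \<beta> * of_bool (loops_cross \<pi> (label_of c) \<beta>))
       = of_bool (loops_cross \<pi> (label_of c) (label_of d))"
      using Cons.prems by (simp add: finite_alphabet sum.delta)
    then show ?case using Cons by (simp add: cycle_of_curve_Cons distrib_right sum.distrib)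
  qed
  then show ?case
    using Cons unfolding cycle_of_curve_Cons quad_add[OF assms(1)]
    by (simp add: quad_delta intersection_form_delta add_ac)
qed

fun ord_sum :: "real list \<Rightarrow> bit" where
  "ord_sum [] = 0"
| "ord_sum (a # l) = (\<Sum>c\<leftarrow>l. of_bool (a < c)) + ord_sum l"

definition flat :: "('b \<times> 'b) list \<Rightarrow> 'b list" where
  "flat ps = concat (map (\<lambda>(a, b). [a, b]) ps)"

lemma flat_simps [simp]: "flat [] = []" "flat ((a, b) # ps) = a # b # flat ps"
  by (simp_all add: flat_def)

text \<open>For four distinct numbers this is 1 exactly if the two pairs interlace, that is, if the
  chords cross. Written as a sum of comparisons it can be matched with the count of increasing pairs
  in a list.\<close>

definition sep :: "real \<times> real \<Rightarrow> real \<times> real \<Rightarrow> bit" where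
  "sep p q = of_bool (fst p < fst q) + of_bool (fst p < snd q) + of_bool (snd p < fst q) + of_bool (snd p < snd q)"

lemma sum_list_flat: "(\<Sum>c\<leftarrow>flat ps. f c) = (\<Sum>p\<leftarrow>ps. f (fst p) + f (snd p) :: bit)"
  by (induction ps) (auto simp: add_ac)

lemma ord_sum_flat: "ord_sum (flat ps) = pair_sum sep ps + (\<Sum>p\<leftarrow>ps. of_bool (fst p < snd p))"
proof (induction ps)
  case (Cons p ps)
  have "(\<Sum>c\<leftarrow>flat ps. of_bool (fst p < c)) + (\<Sum>c\<leftarrow>flat ps. of_bool (snd p < c)) = (\<Sum>q\<leftarrow>ps. sep p q)"
    unfolding sum_list_flat sum_list_addf[symmetric] by (simp add: sep_def add_ac)
  then show ?case using Cons by (cases p) (simp add: add_ac)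
qed simp

lemma ord_sum_snoc: "ord_sum (l @ [a]) = ord_sum l + (\<Sum>c\<leftarrow>l. of_bool (c < a))"
  by (induction l) (simp_all add: add_ac)

lemma ord_sum_rotate1:
  assumes "distinct (a # l)"
  shows "ord_sum (l @ [a]) + ord_sum (a # l) = of_nat (length l)"
proof -
  have *: "(\<Sum>c\<leftarrow>l. of_bool (c < a)) + (\<Sum>c\<leftarrow>l. of_bool (a < c)) = (of_nat (length l) :: bit)"
    using assms
  proof (induction l)
    case (Cons c l)
    then have "of_bool (c < a) + of_bool (a < c) = (1 :: bit)" by (cases "c < a") auto
    then show ?case using Cons by (simp add: add_ac)
  qed simp
  have "ord_sum (l @ [a]) + ord_sum (a # l) = (ord_sum l + ord_sum l) + ((\<Sum>c\<leftarrow>l. of_bool (c < a)) + (\<Sum>c\<leftarrow>l. of_bool (a < c)))"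
    unfolding ord_sum_snoc ord_sum.simps by (simp only: add_ac)
  then show ?thesis unfolding * by simp
qed

lemma flat_shift:
  "\<gamma> \<noteq> [] \<Longrightarrow> flat (zip (map e \<gamma>) (tl (map x \<gamma>) @ [z])) = tl (flat (map (\<lambda>c. (x c, e c)) \<gamma>)) @ [z]"
proof (induction \<gamma>)
  case (Cons c \<gamma>)
  then show ?case by (cases \<gamma>) auto
qed simp

lemma length_flat: "length (flat ps) = 2 * length ps"
  by (induction ps) auto

text \<open>The list \<open>x0, e0, x1, e1, ...\<close> read in consecutive pairs gives the gluings;
  rotated by one place it gives the arcs \<open>(e0, x1)\<close>, \<open>(e1, x2)\<close>, and so
  on. The rotation reverses the comparisons of \<open>x0\<close> with all other points. Their number
  is odd, so the two counts of increasing pairs add up to 1.\<close>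

lemma pair_sums_closed_curve:
  assumes "\<gamma> \<noteq> []" "distinct (flat (map (\<lambda>c. (x c, e c)) \<gamma>))"
  shows "pair_sum sep (map (\<lambda>c. (x c, e c)) \<gamma>) + (\<Sum>c\<leftarrow>\<gamma>. of_bool (x c < e c))
    + (pair_sum sep (zip (map e \<gamma>) (rotate1 (map x \<gamma>))) + (\<Sum>p\<leftarrow>zip (map e \<gamma>) (rotate1 (map x \<gamma>)). of_bool (fst p < snd p))) = 1"
proof -
  let ?W = "map (\<lambda>c. (x c, e c)) \<gamma>" and ?M = "zip (map e \<gamma>) (rotate1 (map x \<gamma>))"
  obtain c \<gamma>' where \<gamma>: "\<gamma> = c # \<gamma>'" using assms(1) by (cases \<gamma>) auto
  define l where "l = tl (flat ?W)"
  have W: "flat ?W = x c # l" by (simp add: \<gamma> l_def)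
  have "rotate1 (map x \<gamma>) = tl (map x \<gamma>) @ [x c]" by (simp add: \<gamma>)
  then have M: "flat ?M = l @ [x c]" using flat_shift[OF assms(1), of e x "x c"] by (simp add: l_def)
  have "length (flat ?W) = 2 * length \<gamma>" using length_flat[of ?W] by (simp only: length_map)
  then have "Suc (length l) = 2 * length \<gamma>" unfolding W by simp
  then have "odd (length l)" by presburger
  then have "(of_nat (length l) :: bit) = 1" by (metis bit_not_zero_iff even_of_nat even_zero)
  then have "ord_sum (flat ?M) + ord_sum (flat ?W) = 1"
    using ord_sum_rotate1[of "x c" l] assms(2) unfolding W M by simp
  then show ?thesis unfolding ord_sum_flat by (simp add: comp_def add_ac)
qed

definition side_point :: "'a lperm \<Rightarrow> row \<Rightarrow> 'a crossing \<Rightarrow> real" where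
  "side_point \<pi> r c = real (pos \<pi> r (label_of c)) + snd (snd c)"

definition valid_crossing :: "'a lperm \<Rightarrow> 'a crossing \<Rightarrow> bool" where
  "valid_crossing \<pi> c \<longleftrightarrow> label_of c \<in> alphabet \<pi> \<and> 0 < snd (snd c) \<and> snd (snd c) < 1"

definition exit_pos :: "'a lperm \<Rightarrow> 'a crossing \<Rightarrow> real" where
  "exit_pos \<pi> c = circ \<pi> (exit_point \<pi> c)"

definition entry_pos :: "'a lperm \<Rightarrow> 'a crossing \<Rightarrow> real" where
  "entry_pos \<pi> c = circ \<pi> (entry_point \<pi> c)"

lemma crossing_points:
  "fst c = Top \<Longrightarrow> exit_point \<pi> c = (Top, side_point \<pi> Top c)"
  "fst c = Top \<Longrightarrow> entry_point \<pi> c = (Bottom, side_point \<pi> Bottom c)"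
  "fst c = Bottom \<Longrightarrow> exit_point \<pi> c = (Bottom, side_point \<pi> Bottom c)"
  "fst c = Bottom \<Longrightarrow> entry_point \<pi> c = (Top, side_point \<pi> Top c)"
  by (cases c; simp add: side_point_def label_of_def)+

lemma crossing_pos:
  "fst c = Top \<Longrightarrow> exit_pos \<pi> c = side_point \<pi> Top c"
  "fst c = Top \<Longrightarrow> entry_pos \<pi> c = 2 * real (length (fst \<pi>)) - side_point \<pi> Bottom c"
  "fst c = Bottom \<Longrightarrow> exit_pos \<pi> c = 2 * real (length (fst \<pi>)) - side_point \<pi> Bottom c"
  "fst c = Bottom \<Longrightarrow> entry_pos \<pi> c = side_point \<pi> Top c"
  unfolding exit_pos_def entry_pos_def by (simp_all add: crossing_points)

lemma side_point_bounds:
  assumes "proper \<pi>" "valid_crossing \<pi> c"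
  shows "0 < side_point \<pi> r c" "side_point \<pi> r c < real (length (fst \<pi>))"
proof -
  have "pos \<pi> r (label_of c) + 1 \<le> length (fst \<pi>)"
    using pos_less[OF assms(1)] assms(2) by (simp add: valid_crossing_def Suc_le_eq)
  then have "real (pos \<pi> r (label_of c)) + 1 \<le> real (length (fst \<pi>))" by linarith
  then show "0 < side_point \<pi> r c" "side_point \<pi> r c < real (length (fst \<pi>))"
    using assms(2) by (auto simp: side_point_def valid_crossing_def)
qed

lemma nat_frac_less:
  assumes "0 < (t :: real)" "t < 1" "0 < s" "s < 1"
  shows "real i + t < real j + s \<longleftrightarrow> i < j \<or> i = j \<and> t < s"
proof (cases i j rule: linorder_cases)
  case less
  then have "real i + 1 \<le> real j" by linarith
  then show ?thesis using assms less by auto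
next
  case greater
  then have "real j + 1 \<le> real i" by linarith
  then show ?thesis using assms greater by auto
qed auto

lemma side_point_less:
  assumes "valid_crossing \<pi> c" "valid_crossing \<pi> d"
  shows "side_point \<pi> r c < side_point \<pi> r d \<longleftrightarrow> pos \<pi> r (label_of c) < pos \<pi> r (label_of d)
     \<or> pos \<pi> r (label_of c) = pos \<pi> r (label_of d) \<and> snd (snd c) < snd (snd d)"
  using assms unfolding side_point_def valid_crossing_def by (intro nat_frac_less) auto

lemma side_point_eq:
  assumes "proper \<pi>" "valid_crossing \<pi> c" "valid_crossing \<pi> d" "side_point \<pi> r c = side_point \<pi> r d"
  shows "snd c = snd d"
proof -
  have "pos \<pi> r (label_of c) = pos \<pi> r (label_of d)" "snd (snd c) = snd (snd d)"
    using side_point_less[OF assms(2,3), of r] side_point_less[OF assms(3,2), of r] assms(4) by auto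
  moreover from this have "label_of c = label_of d"
    using pos_inject[OF assms(1)] assms(2,3) by (metis valid_crossing_def)
  ultimately show ?thesis by (simp add: label_of_def prod_eq_iff)
qed

lemma loops_cross_side_points:
  assumes "proper \<pi>" "valid_crossing \<pi> c" "valid_crossing \<pi> d"
  shows "loops_cross \<pi> (label_of c) (label_of d) \<longleftrightarrow>
    (side_point \<pi> Top c < side_point \<pi> Top d) \<noteq> (side_point \<pi> Bottom c < side_point \<pi> Bottom d)"
proof (cases "label_of c = label_of d")
  case True
  then show ?thesis by (simp add: loops_cross_def side_point_less[OF assms(2,3)])
next
  case False
  then have "pos \<pi> r (label_of c) \<noteq> pos \<pi> r (label_of d)" for r
    using pos_inject[OF assms(1)] assms(2,3) by (metis valid_crossing_def)
  then show ?thesis by (simp add: loops_cross_def side_point_less[OF assms(2,3)])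
qed

lemma row_cases: "fst c = Top \<or> fst c = Bottom"
  by (cases "fst c") auto

lemma exit_entry_less:
  assumes "proper \<pi>" "valid_crossing \<pi> c"
  shows "exit_pos \<pi> c < entry_pos \<pi> c \<longleftrightarrow> fst c = Top" "exit_pos \<pi> c \<noteq> entry_pos \<pi> c"
  using side_point_bounds[OF assms, of Top] side_point_bounds[OF assms, of Bottom] row_cases[of c]
  by (auto simp: crossing_pos)

lemma crossing_pos_distinct:
  assumes "proper \<pi>" "valid_crossing \<pi> c" "valid_crossing \<pi> d" "snd c \<noteq> snd d"
  shows "exit_pos \<pi> c \<noteq> exit_pos \<pi> d" "exit_pos \<pi> c \<noteq> entry_pos \<pi> d"
    "entry_pos \<pi> c \<noteq> exit_pos \<pi> d" "entry_pos \<pi> c \<noteq> entry_pos \<pi> d"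
proof -
  have ne: "side_point \<pi> Top c \<noteq> side_point \<pi> Top d" "side_point \<pi> Bottom c \<noteq> side_point \<pi> Bottom d"
    using side_point_eq assms by metis+
  note b = side_point_bounds[OF assms(1,2), of Top] side_point_bounds[OF assms(1,2), of Bottom]
    side_point_bounds[OF assms(1,3), of Top] side_point_bounds[OF assms(1,3), of Bottom]
  show "exit_pos \<pi> c \<noteq> exit_pos \<pi> d" "exit_pos \<pi> c \<noteq> entry_pos \<pi> d"
    "entry_pos \<pi> c \<noteq> exit_pos \<pi> d" "entry_pos \<pi> c \<noteq> entry_pos \<pi> d"
    using row_cases[of c] row_cases[of d] ne b by (auto simp: crossing_pos)
qed

lemma sep_commute_pair: "sep (b, a) q = sep (a, b) q" "sep p (d, c) = sep p (c, d)"
  by (simp_all add: sep_def add_ac)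

text \<open>A gluing joins the abscissa on top to \<open>2 * n\<close> minus the abscissa at the
  bottom, \<open>n\<close> being the number of labels. All top coordinates lie below all bottom
  ones, and the bottom row is traversed backwards; so two such chords interlace exactly if the
  orders in the two rows disagree.\<close>

lemma sep_loops_cross:
  assumes "proper \<pi>" "valid_crossing \<pi> c" "valid_crossing \<pi> d" "snd c \<noteq> snd d"
  shows "sep (exit_pos \<pi> c, entry_pos \<pi> c) (exit_pos \<pi> d, entry_pos \<pi> d) =
    of_bool (loops_cross \<pi> (label_of c) (label_of d))"
proof -
  let ?n = "2 * real (length (fst \<pi>))"
  let ?p = "\<lambda>c. (side_point \<pi> Top c, ?n - side_point \<pi> Bottom c)"
  have "sep (exit_pos \<pi> c, entry_pos \<pi> c) q = sep (?p c) q" for q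
  proof (cases "fst c = Top")
    case False
    then have "fst c = Bottom" using row_cases by blast
    then show ?thesis by (simp add: crossing_pos) (rule sep_commute_pair(1))
  qed (simp add: crossing_pos)
  moreover have "sep p (exit_pos \<pi> d, entry_pos \<pi> d) = sep p (?p d)" for p
  proof (cases "fst d = Top")
    case False
    then have "fst d = Bottom" using row_cases by blast
    then show ?thesis by (simp add: crossing_pos) (rule sep_commute_pair(2))
  qed (simp add: crossing_pos)
  moreover have "sep (?p c) (?p d) = of_bool (loops_cross \<pi> (label_of c) (label_of d))"
  proof -
    have ne: "side_point \<pi> Bottom c \<noteq> side_point \<pi> Bottom d"
      using side_point_eq assms by metis
    note b = side_point_bounds[OF assms(1,2), of Top] side_point_bounds[OF assms(1,2), of Bottom]
      side_point_bounds[OF assms(1,3), of Top] side_point_bounds[OF assms(1,3), of Bottom]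
    have "side_point \<pi> Top c < ?n - side_point \<pi> Bottom d" "\<not> ?n - side_point \<pi> Bottom c < side_point \<pi> Top d"
      using b by linarith+
    moreover have "?n - side_point \<pi> Bottom c < ?n - side_point \<pi> Bottom d \<longleftrightarrow> \<not> side_point \<pi> Bottom c < side_point \<pi> Bottom d"
      using ne by linarith
    ultimately show ?thesis
      unfolding loops_cross_side_points[OF assms(1-3)] sep_def fst_conv snd_conv
      by (cases "side_point \<pi> Top c < side_point \<pi> Top d"; cases "side_point \<pi> Bottom c < side_point \<pi> Bottom d") simp_all
  qed
  ultimately show ?thesis by simp
qed

lemma sep_strictly_between:
  assumes "fst q \<noteq> fst p" "fst q \<noteq> snd p" "snd q \<noteq> fst p" "snd q \<noteq> snd p"
  shows "sep p q = of_bool (strictly_between (fst p) (snd p) (fst q) \<noteq> strictly_between (fst p) (snd p) (snd q))"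
proof -
  have "strictly_between (fst p) (snd p) w \<longleftrightarrow> (fst p < w) \<noteq> (snd p < w)" if "w \<noteq> fst p" "w \<noteq> snd p" for w
    using that unfolding strictly_between_def min_def max_def by auto
  then show ?thesis
    using assms unfolding sep_def
    by (cases "fst p < fst q"; cases "fst p < snd q"; cases "snd p < fst q"; cases "snd p < snd q") simp_all
qed

text \<open>On an arc that returns to its row, the half turn is positive exactly if the clockwise
  coordinate increases. An arc between the rows does not turn, and its coordinate increases only
  from top to bottom, which is the case of two crossings through the bottom row.\<close>

lemma arc_order_half_turns:
  assumes "proper \<pi>" "valid_crossing \<pi> c" "valid_crossing \<pi> d"
  shows "(of_bool (entry_pos \<pi> c < exit_pos \<pi> d) :: bit) =
     of_bool (half_turns (entry_point \<pi> c, exit_point \<pi> d) = 1) + of_bool (fst c = Bottom \<and> fst d = Bottom)"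
    "half_turns (entry_point \<pi> c, exit_point \<pi> d) =
      2 * of_bool (half_turns (entry_point \<pi> c, exit_point \<pi> d) = 1)
      - of_bool (fst c = Bottom \<and> fst d = Top) - of_bool (fst c = Top \<and> fst d = Bottom)"
proof -
  note b = side_point_bounds[OF assms(1,2), of Top] side_point_bounds[OF assms(1,2), of Bottom]
    side_point_bounds[OF assms(1,3), of Top] side_point_bounds[OF assms(1,3), of Bottom]
  show "(of_bool (entry_pos \<pi> c < exit_pos \<pi> d) :: bit) =
     of_bool (half_turns (entry_point \<pi> c, exit_point \<pi> d) = 1) + of_bool (fst c = Bottom \<and> fst d = Bottom)"
    using row_cases[of c] row_cases[of d] b by (auto simp: crossing_pos crossing_points)
  show "half_turns (entry_point \<pi> c, exit_point \<pi> d) =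
      2 * of_bool (half_turns (entry_point \<pi> c, exit_point \<pi> d) = 1)
      - of_bool (fst c = Bottom \<and> fst d = Top) - of_bool (fst c = Top \<and> fst d = Bottom)"
    using row_cases[of c] row_cases[of d] by (auto simp: crossing_points)
qed

lemma cyclic_changes:
  fixes R :: "nat \<Rightarrow> bool"
  assumes "0 < m"
  shows "(\<Sum>i<m. of_bool (R i \<and> \<not> R (Suc i mod m))) = (\<Sum>i<m. of_bool (\<not> R i \<and> R (Suc i mod m)) :: int)"
proof -
  have "inj_on (\<lambda>i. Suc i mod m) {..<m}"
  proof (rule inj_onI)
    fix i j assume "i \<in> {..<m}" "j \<in> {..<m}" "Suc i mod m = Suc j mod m"
    then show "i = j" using mod_shift_inj[of i m j 1] by simp
  qed
  moreover have "(\<lambda>i. Suc i mod m) ` {..<m} \<subseteq> {..<m}" using assms by auto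
  ultimately have "bij_betw (\<lambda>i. Suc i mod m) {..<m} {..<m}"
    using bij_betw_lessThan_card[of "{..<m}" "\<lambda>i. Suc i mod m"] by simp
  then have "(\<Sum>i<m. of_bool (R (Suc i mod m))) = (\<Sum>i<m. of_bool (R i) :: int)"
    by (rule sum.reindex_bij_betw)
  moreover have "of_bool (R i \<and> \<not> R (Suc i mod m)) - of_bool (\<not> R i \<and> R (Suc i mod m))
     = of_bool (R i) - (of_bool (R (Suc i mod m)) :: int)" for i
    by (cases "R i"; cases "R (Suc i mod m)") simp_all
  then have "(\<Sum>i<m. of_bool (R i \<and> \<not> R (Suc i mod m))) - (\<Sum>i<m. of_bool (\<not> R i \<and> R (Suc i mod m)))
     = (\<Sum>i<m. of_bool (R i)) - (\<Sum>i<m. of_bool (R (Suc i mod m)) :: int)"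
    unfolding sum_subtractf[symmetric] by (intro sum.cong refl)
  ultimately show ?thesis by simp
qed

lemma set_flat_map: "set (flat (map (\<lambda>c. (f c, g c)) cs)) = f ` set cs \<union> g ` set cs"
  by (induction cs) auto

lemma bit_rearrange: "(s :: bit) + a + (p + b) = 1 \<Longrightarrow> a + b + v + s = v + p + 1"
  by (cases s; cases a; cases p; cases b; cases v) simp_all

text \<open>The points where the curve meets the boundary circle are matched in two ways: by the arcs inside \<open>P\<close>
  and by the gluing of the sides. Listed along the curve, both matchings join neighbours, which determines
  the sum of their crossing numbers; the arcs do not cross, and the gluings cross as the loops do.\<close>

lemma quad_simple_closed_curve:
  assumes \<pi>: "proper \<pi>" and s: "simple_closed_curve \<pi> \<gamma>"
  shows "quad \<pi> (cycle_of_curve \<gamma>) = of_int (ind \<pi> \<gamma> + 1)"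
proof -
  let ?x = "exit_pos \<pi>" and ?e = "entry_pos \<pi>"
  define m where "m = length \<gamma>"
  define R where "R i \<longleftrightarrow> fst (\<gamma> ! i) = Bottom" for i
  define h where "h i = half_turns (curve_arc \<pi> \<gamma> i)" for i
  have m: "0 < m" and ne: "\<gamma> \<noteq> []" using s by (auto simp: simple_closed_curve_def m_def)
  have valid: "valid_crossing \<pi> c" if "c \<in> set \<gamma>" for c
    using s that unfolding simple_closed_curve_def valid_crossing_def label_of_def by (cases c) fastforce
  have dist: "distinct (map snd \<gamma>)" using s by (simp add: simple_closed_curve_def)
  have nv: "valid_crossing \<pi> (\<gamma> ! i)" if "i < m" for i using valid that by (simp add: m_def)
  have nd: "snd (\<gamma> ! i) \<noteq> snd (\<gamma> ! j)" if "i < m" "j < m" "i \<noteq> j" for i j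
    using dist that by (simp add: distinct_conv_nth m_def)
  have sm: "Suc i mod m < m" for i using m by simp
  let ?M = "zip (map ?e \<gamma>) (rotate1 (map ?x \<gamma>))"
  have M: "?M ! i = (?e (\<gamma> ! i), ?x (\<gamma> ! (Suc i mod m)))" if "i < m" for i
    using that sm[of i] by (simp add: m_def nth_rotate1)
  have lM: "length ?M = m" by (simp add: m_def)
  have "distinct (flat (map (\<lambda>c. (?x c, ?e c)) \<gamma>))"
    using dist valid
  proof (induction \<gamma>)
    case (Cons c \<gamma>)
    have vc: "valid_crossing \<pi> c" using Cons.prems(2) by simp
    have c: "?x c \<noteq> ?x d" "?x c \<noteq> ?e d" "?e c \<noteq> ?x d" "?e c \<noteq> ?e d" if d: "d \<in> set \<gamma>" for d
    proof -
      have "valid_crossing \<pi> d" "snd c \<noteq> snd d" using Cons.prems d by auto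
      then show "?x c \<noteq> ?x d" "?x c \<noteq> ?e d" "?e c \<noteq> ?x d" "?e c \<noteq> ?e d"
        using crossing_pos_distinct[OF \<pi> vc] by blast+
    qed
    have "?x c \<notin> set (flat (map (\<lambda>c. (?x c, ?e c)) \<gamma>))" "?e c \<notin> set (flat (map (\<lambda>c. (?x c, ?e c)) \<gamma>))"
      unfolding set_flat_map using c by blast+
    moreover have "distinct (flat (map (\<lambda>c. (?x c, ?e c)) \<gamma>))" using Cons by simp
    ultimately show ?case
      using exit_entry_less(2)[OF \<pi> vc] by simp
  qed simp
  note main = pair_sums_closed_curve[OF ne this]
  have "pair_sum sep ?M = 0"
  proof (rule pair_sum_zero, unfold sorted_wrt_iff_nth_less, intro allI impI)
    fix i j assume ij: "i < j" "j < length ?M"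
    then have im: "i < m" "j < m" "i \<noteq> j" using lM by simp_all
    let ?a = "\<gamma> ! i" and ?b = "\<gamma> ! (Suc i mod m)" and ?c = "\<gamma> ! j" and ?d = "\<gamma> ! (Suc j mod m)"
    have sij: "Suc i mod m \<noteq> Suc j mod m" using mod_shift_inj[of i m j 1] im by auto
    have xe: "?x (\<gamma> ! k) \<noteq> ?e (\<gamma> ! l)" if "k < m" "l < m" for k l
      using exit_entry_less(2)[OF \<pi> nv[OF that(1)]] crossing_pos_distinct(2)[OF \<pi> nv[OF that(1)] nv[OF that(2)] nd[OF that]]
      by (cases "k = l") auto
    have "?e ?c \<noteq> ?e ?a" "?x ?d \<noteq> ?x ?b"
      using crossing_pos_distinct(4)[OF \<pi> nv[OF im(2)] nv[OF im(1)] nd[OF im(2,1)]]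
        crossing_pos_distinct(1)[OF \<pi> nv[OF sm] nv[OF sm] nd[OF sm sm]] im(3) sij by metis+
    then have "sep (?M ! i) (?M ! j) = of_bool (strictly_between (?e ?a) (?x ?b) (?e ?c) \<noteq> strictly_between (?e ?a) (?x ?b) (?x ?d))"
      unfolding M[OF im(1)] M[OF im(2)]
      using xe[OF sm im(1)] xe[OF sm im(2)] by (subst sep_strictly_between) (simp_all add: eq_commute)
    also have "\<dots> = of_bool (arcs_cross \<pi> (curve_arc \<pi> \<gamma> i) (curve_arc \<pi> \<gamma> j))"
      by (simp add: arcs_cross_def curve_arc_def entry_pos_def exit_pos_def m_def)
    also have "\<dots> = 0" using s im unfolding simple_closed_curve_def m_def by simp
    finally show "sep (?M ! i) (?M ! j) = 0" .
  qed
  moreover have "pair_sum sep (map (\<lambda>c. (?x c, ?e c)) \<gamma>)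
      = pair_sum (\<lambda>c d. of_bool (loops_cross \<pi> (label_of c) (label_of d))) \<gamma>"
    unfolding pair_sum_map
  proof (rule pair_sum_cong, unfold sorted_wrt_iff_nth_less, intro allI impI)
    fix i j assume "i < j" "j < length \<gamma>"
    then show "sep (?x (\<gamma> ! i), ?e (\<gamma> ! i)) (?x (\<gamma> ! j), ?e (\<gamma> ! j)) =
        of_bool (loops_cross \<pi> (label_of (\<gamma> ! i)) (label_of (\<gamma> ! j)))"
      using nv nd by (intro sep_loops_cross[OF \<pi>]) (simp_all add: m_def)
  qed
  moreover have "(\<Sum>c\<leftarrow>\<gamma>. of_bool (?x c < ?e c)) = (\<Sum>i<m. of_bool (\<not> R i) :: bit)"
  proof -
    have "(\<Sum>c\<leftarrow>\<gamma>. of_bool (?x c < ?e c)) = (\<Sum>i<m. of_bool (?x (\<gamma> ! i) < ?e (\<gamma> ! i)) :: bit)"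
      by (simp add: sum_list_sum_nth m_def atLeast0LessThan)
    also have "\<dots> = (\<Sum>i<m. of_bool (\<not> R i))"
      using exit_entry_less(1)[OF \<pi> nv] row.exhaust by (intro sum.cong refl) (auto simp: R_def)
    finally show ?thesis .
  qed
  moreover have "(\<Sum>p\<leftarrow>?M. of_bool (fst p < snd p)) = (\<Sum>i<m. of_bool (h i = 1) + of_bool (R i \<and> R (Suc i mod m)) :: bit)"
  proof -
    have "(\<Sum>p\<leftarrow>?M. of_bool (fst p < snd p)) = (\<Sum>i<m. of_bool (fst (?M ! i) < snd (?M ! i)) :: bit)"
      by (simp add: sum_list_sum_nth lM atLeast0LessThan m_def)
    also have "\<dots> = (\<Sum>i<m. of_bool (h i = 1) + of_bool (R i \<and> R (Suc i mod m)))"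
    proof (intro sum.cong refl)
      fix i assume "i \<in> {..<m}"
      then have i: "i < m" by simp
      show "of_bool (fst (?M ! i) < snd (?M ! i)) = (of_bool (h i = 1) + of_bool (R i \<and> R (Suc i mod m)) :: bit)"
        unfolding M[OF i] fst_conv snd_conv arc_order_half_turns(1)[OF \<pi> nv[OF i] nv[OF sm]]
        by (simp add: h_def curve_arc_def m_def R_def)
    qed
    finally show ?thesis .
  qed
  ultimately have ps: "pair_sum (\<lambda>c d. of_bool (loops_cross \<pi> (label_of c) (label_of d))) \<gamma>
      + (\<Sum>i<m. of_bool (\<not> R i)) + (\<Sum>i<m. of_bool (h i = 1) + of_bool (R i \<and> R (Suc i mod m))) = 1"
    using main by simp
  \<comment> \<open>\<open>p\<close> counts the positive half turns and \<open>v\<close> the U-turns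
    at the top row. Around a closed curve the changes of row balance, so there are as many U-turns
    at the bottom, and the total turning is \<open>2 * (p - v)\<close>.\<close>
  define p where "p = (\<Sum>i<m. of_bool (h i = 1) :: int)"
  define v where "v = (\<Sum>i<m. of_bool (R i \<and> \<not> R (Suc i mod m)) :: int)"
  have row: "fst c = Top \<longleftrightarrow> fst c \<noteq> Bottom" for c :: "'a crossing" by (cases "fst c") auto
  have "h i = 2 * of_bool (h i = 1) - of_bool (R i \<and> \<not> R (Suc i mod m)) - of_bool (\<not> R i \<and> R (Suc i mod m))"
    if i: "i < m" for i
    using arc_order_half_turns(2)[OF \<pi> nv[OF i] nv[OF sm, of i]]
    by (simp add: h_def curve_arc_def m_def R_def row)
  then have "(\<Sum>i<m. h i) = (\<Sum>i<m. 2 * of_bool (h i = 1) - of_bool (R i \<and> \<not> R (Suc i mod m)) - of_bool (\<not> R i \<and> R (Suc i mod m)))"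
    by (intro sum.cong) auto
  also have "\<dots> = 2 * p - v - (\<Sum>i<m. of_bool (\<not> R i \<and> R (Suc i mod m)))"
    by (simp add: sum_subtractf p_def v_def flip: sum_distrib_left)
  also have "\<dots> = 2 * (p - v)" using cyclic_changes[OF m, of R] by (simp add: v_def)
  finally have ind: "ind \<pi> \<gamma> = p - v" unfolding ind_def h_def m_def by simp
  \<comment> \<open>The crossings are classified by their own row and that of their successor, so
    that the two counts of no interest cancel against those in \<open>ps\<close>.\<close>
  have "of_nat m = (\<Sum>i<m. 1 :: bit)" by simp
  also have "\<dots> = (\<Sum>i<m. of_bool (\<not> R i) + of_bool (R i \<and> R (Suc i mod m)) + of_bool (R i \<and> \<not> R (Suc i mod m)))"
    by (intro sum.cong refl) auto
  also have "\<dots> = (\<Sum>i<m. of_bool (\<not> R i)) + (\<Sum>i<m. of_bool (R i \<and> R (Suc i mod m))) + of_int v"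
    by (simp add: sum.distrib v_def)
  finally have om: "of_nat m = (\<Sum>i<m. of_bool (\<not> R i)) + (\<Sum>i<m. of_bool (R i \<and> R (Suc i mod m))) + (of_int v :: bit)" .
  have "quad \<pi> (cycle_of_curve \<gamma>) = of_nat m + pair_sum (\<lambda>c d. of_bool (loops_cross \<pi> (label_of c) (label_of d))) \<gamma>"
    using quad_cycle_of_curve[OF \<pi>, of \<gamma>] valid unfolding m_def valid_crossing_def by blast
  also have "\<dots> = of_int v + of_int p + 1"
  proof -
    have p: "(\<Sum>i<m. of_bool (h i = 1)) = (of_int p :: bit)" by (simp add: p_def)
    show ?thesis unfolding om by (rule bit_rearrange[OF ps[unfolded sum.distrib p]])
  qed
  also have "\<dots> = of_int (ind \<pi> \<gamma> + 1)" unfolding ind by (simp add: add_ac)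
  finally show ?thesis .
qed

section \<open>Boundaries and the Arf invariant\<close>

text \<open>These are the unions of singularities, described without equivalence classes.\<close>

definition glue_invariant :: "'a lperm \<Rightarrow> (row \<times> nat) set \<Rightarrow> bool" where
  "glue_invariant \<pi> C \<longleftrightarrow> C \<subseteq> corners \<pi> \<and> (\<forall>(a, b)\<in>corner_glue \<pi>. a \<in> C \<longleftrightarrow> b \<in> C)"

lemma finite_corners: "finite (corners \<pi>)"
proof -
  have "(UNIV :: row set) = {Top, Bottom}" by (auto intro: row.exhaust)
  then have "finite (UNIV :: row set)" by (metis finite.simps)
  then show ?thesis by (simp add: corners_def)
qed

lemma corner_glue_corners:
  assumes "proper \<pi>" "(a, b) \<in> corner_glue \<pi>"
  shows "a \<in> corners \<pi>" "b \<in> corners \<pi>"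
  using assms(2) pos_less[OF assms(1), of _ Top] pos_less[OF assms(1), of _ Bottom]
  by (auto simp: corner_glue_def corners_def Suc_le_eq less_imp_le)

text \<open>Distinct singularities are disjoint, so a sum of their boundaries is the boundary of
  their union, and every set of corners closed under gluing is such a union.\<close>

lemma boundaries_eq:
  assumes \<pi>: "proper \<pi>"
  shows "boundaries \<pi> = boundary_of \<pi> ` {C. glue_invariant \<pi> C}"
proof -
  define E where "E = (corner_glue \<pi> \<union> (corner_glue \<pi>)\<inverse>)\<^sup>*"
  have sym: "(b, a) \<in> E" if "(a, b) \<in> E" for a b
    using that unfolding E_def by (rule symD[OF sym_rtrancl[OF sym_Un_converse]])
  have tr: "(a, c) \<in> E" if "(a, b) \<in> E" "(b, c) \<in> E" for a b c
    using that unfolding E_def by (rule rtrancl_trans)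
  have sing: "singularities \<pi> = (\<lambda>c. E `` {c}) ` corners \<pi>"
    by (auto simp: singularities_def quotient_def E_def)
  have E_inv: "b \<in> C" if "glue_invariant \<pi> C" "(a, b) \<in> E" "a \<in> C" for a b C
    using that(2,3) unfolding E_def
    by (induction rule: rtrancl_induct) (use that(1) in \<open>auto simp: glue_invariant_def\<close>)
  have "glue_invariant \<pi> (corners \<pi>)"
    using corner_glue_corners[OF \<pi>] by (auto simp: glue_invariant_def)
  then have E_corners: "E `` {c} \<subseteq> corners \<pi>" if "c \<in> corners \<pi>" for c
    using E_inv that by blast
  have disj: "v = v'" if v: "v \<in> singularities \<pi>" "v' \<in> singularities \<pi>" "p \<in> v" "p \<in> v'" for v v' p
  proof -
    obtain c where c: "v = E `` {c}" using v(1) unfolding sing by blast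
    obtain c' where c': "v' = E `` {c'}" using v(2) unfolding sing by blast
    have p: "(c, p) \<in> E" "(c', p) \<in> E" using v(3,4) c c' by simp_all
    have "E `` {c'} \<subseteq> E `` {c}" using tr[OF tr[OF p(1) sym[OF p(2)]]] by auto
    moreover have "E `` {c} \<subseteq> E `` {c'}" using tr[OF tr[OF p(2) sym[OF p(1)]]] by auto
    ultimately show ?thesis unfolding c c' by (rule equalityI[rotated])
  qed
  have sum: "(\<Sum>v\<in>W. boundary_of \<pi> v \<alpha>) = boundary_of \<pi> (\<Union>W) \<alpha>" if W: "W \<subseteq> singularities \<pi>" for W \<alpha>
  proof -
    have "finite (singularities \<pi>)" unfolding sing using finite_corners by (rule finite_imageI)
    then have fin: "finite W" using W finite_subset by blast
    have "(\<Sum>v\<in>W. of_bool (p \<in> v)) = (of_bool (p \<in> \<Union>W) :: bit)" for p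
    proof (cases "p \<in> \<Union>W")
      case True
      then obtain v where v: "v \<in> W" "p \<in> v" by blast
      have "(\<Sum>v'\<in>W. of_bool (p \<in> v')) = (\<Sum>v'\<in>W. if v' = v then 1 else (0 :: bit))"
        using disj[of _ v p] W v by (intro sum.cong refl) auto
      then show ?thesis using v fin True by simp
    next
      case False
      then show ?thesis by (intro trans[OF sum.neutral]) auto
    qed
    then show ?thesis by (simp add: boundary_of_def sum.distrib)
  qed
  show ?thesis
  proof
    show "boundaries \<pi> \<subseteq> boundary_of \<pi> ` {C. glue_invariant \<pi> C}"
    proof
      fix x assume "x \<in> boundaries \<pi>"
      then obtain W where W: "W \<subseteq> singularities \<pi>" "x = (\<lambda>\<alpha>. \<Sum>v\<in>W. boundary_of \<pi> v \<alpha>)"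
        by (auto simp: boundaries_def)
      have "glue_invariant \<pi> (\<Union>W)"
        unfolding glue_invariant_def
      proof (intro conjI ballI, safe)
        fix v r k assume "v \<in> W" "(r, k) \<in> v"
        then show "(r, k) \<in> corners \<pi>" using W(1) sing E_corners by blast
      next
        fix a b v assume g: "(a, b) \<in> corner_glue \<pi>" and v: "v \<in> W" "a \<in> v"
        then have "(a, b) \<in> E" by (auto simp: E_def)
        moreover obtain c where "v = E `` {c}" using v W(1) sing by blast
        ultimately have "b \<in> v" using v(2) tr by blast
        then show "b \<in> \<Union>W" using v by blast
      next
        fix a b v assume g: "(a, b) \<in> corner_glue \<pi>" and v: "v \<in> W" "b \<in> v"
        then have "(b, a) \<in> E" by (auto simp: E_def)
        moreover obtain c where "v = E `` {c}" using v W(1) sing by blast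
        ultimately have "a \<in> v" using v(2) tr by blast
        then show "a \<in> \<Union>W" using v by blast
      qed
      then show "x \<in> boundary_of \<pi> ` {C. glue_invariant \<pi> C}"
        using W sum by auto
    qed
    show "boundary_of \<pi> ` {C. glue_invariant \<pi> C} \<subseteq> boundaries \<pi>"
    proof (rule image_subsetI)
      fix C assume C: "C \<in> {C. glue_invariant \<pi> C}"
      define W where "W = {v \<in> singularities \<pi>. v \<subseteq> C}"
      have "\<Union>W = C"
      proof
        show "C \<subseteq> \<Union>W"
        proof
          fix c assume c: "c \<in> C"
          then have "c \<in> corners \<pi>" using C by (auto simp: glue_invariant_def)
          then have "E `` {c} \<in> W" using sing E_inv C c by (auto simp: W_def)
          moreover have "c \<in> E `` {c}" by (simp add: E_def)
          ultimately show "c \<in> \<Union>W" by blast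
        qed
      qed (auto simp: W_def)
      then have "boundary_of \<pi> C = (\<lambda>\<alpha>. \<Sum>v\<in>W. boundary_of \<pi> v \<alpha>)"
        using sum[of W] by (auto simp: W_def fun_eq_iff)
      then show "boundary_of \<pi> C \<in> boundaries \<pi>" by (auto simp: boundaries_def W_def)
    qed
  qed
qed

text \<open>A potential of \<open>x\<close> on the corners of row \<open>r\<close>: the sum of
  \<open>x\<close> over the sides between the left end and the corner \<open>k\<close>.\<close>

definition prefix_sum :: "'a lperm \<Rightarrow> ('a \<Rightarrow> bit) \<Rightarrow> row \<Rightarrow> nat \<Rightarrow> bit" where
  "prefix_sum \<pi> x r k = (\<Sum>\<beta>\<in>alphabet \<pi>. x \<beta> * of_bool (pos \<pi> r \<beta> < k))"

lemma intersection_form_delta_prefix: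
  assumes "proper \<pi>" "\<alpha> \<in> alphabet \<pi>"
  shows "intersection_form \<pi> (delta \<alpha>) x =
    prefix_sum \<pi> x Top (pos \<pi> Top \<alpha>) + prefix_sum \<pi> x Bottom (pos \<pi> Bottom \<alpha>)"
proof -
  have "(of_bool (loops_cross \<pi> \<alpha> \<beta>) :: bit) =
      of_bool (pos \<pi> Top \<beta> < pos \<pi> Top \<alpha>) + of_bool (pos \<pi> Bottom \<beta> < pos \<pi> Bottom \<alpha>)"
    if \<beta>: "\<beta> \<in> alphabet \<pi>" for \<beta>
  proof (cases "\<beta> = \<alpha>")
    case False
    then have "pos \<pi> Top \<beta> \<noteq> pos \<pi> Top \<alpha>" "pos \<pi> Bottom \<beta> \<noteq> pos \<pi> Bottom \<alpha>"
      using pos_inject assms \<beta> by metis+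
    then show ?thesis
      by (cases "pos \<pi> Top \<beta> < pos \<pi> Top \<alpha>"; cases "pos \<pi> Bottom \<beta> < pos \<pi> Bottom \<alpha>") (auto simp: loops_cross_def)
  qed (simp add: loops_cross_def)
  then show ?thesis
    unfolding intersection_form_delta[OF assms(2)] prefix_sum_def
    by (simp add: distrib_left flip: sum.distrib)
qed

lemma prefix_sum_0: "prefix_sum \<pi> x r 0 = 0"
  by (simp add: prefix_sum_def)

lemma prefix_sum_Suc:
  assumes "proper \<pi>" "\<alpha> \<in> alphabet \<pi>"
  shows "prefix_sum \<pi> x r (Suc (pos \<pi> r \<alpha>)) = prefix_sum \<pi> x r (pos \<pi> r \<alpha>) + x \<alpha>"
proof -
  have "x \<beta> * of_bool (pos \<pi> r \<beta> < Suc (pos \<pi> r \<alpha>)) =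
     x \<beta> * of_bool (pos \<pi> r \<beta> < pos \<pi> r \<alpha>) + (if \<beta> = \<alpha> then x \<alpha> else 0)" if "\<beta> \<in> alphabet \<pi>" for \<beta>
    using pos_inject[OF assms(1) that assms(2), of r] by (auto simp: less_Suc_eq)
  then have "prefix_sum \<pi> x r (Suc (pos \<pi> r \<alpha>)) =
     (\<Sum>\<beta>\<in>alphabet \<pi>. x \<beta> * of_bool (pos \<pi> r \<beta> < pos \<pi> r \<alpha>) + (if \<beta> = \<alpha> then x \<alpha> else 0))"
    unfolding prefix_sum_def by (intro sum.cong refl)
  then show ?thesis using assms(2) by (simp add: sum.distrib prefix_sum_def finite_alphabet)
qed

lemma prefix_sum_all:
  assumes "proper \<pi>"
  shows "prefix_sum \<pi> x r (length (fst \<pi>)) = (\<Sum>\<beta>\<in>alphabet \<pi>. x \<beta>)"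
  unfolding prefix_sum_def by (intro sum.cong refl) (simp add: pos_less[OF assms])

lemma glue_invariantD:
  assumes "glue_invariant \<pi> C"
  shows "(Top, 0) \<in> C \<longleftrightarrow> (Bottom, 0) \<in> C"
    "(Top, length (fst \<pi>)) \<in> C \<longleftrightarrow> (Bottom, length (fst \<pi>)) \<in> C"
    "\<alpha> \<in> alphabet \<pi> \<Longrightarrow> (Top, pos \<pi> Top \<alpha>) \<in> C \<longleftrightarrow> (Bottom, pos \<pi> Bottom \<alpha>) \<in> C"
    "\<alpha> \<in> alphabet \<pi> \<Longrightarrow> (Top, Suc (pos \<pi> Top \<alpha>)) \<in> C \<longleftrightarrow> (Bottom, Suc (pos \<pi> Bottom \<alpha>)) \<in> C"
  using assms unfolding glue_invariant_def corner_glue_def by blast+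

lemma boundary_of_row:
  assumes "glue_invariant \<pi> C" "\<alpha> \<in> alphabet \<pi>"
  shows "boundary_of \<pi> C \<alpha> = of_bool ((r, pos \<pi> r \<alpha>) \<in> C) + of_bool ((r, Suc (pos \<pi> r \<alpha>)) \<in> C)"
  using glue_invariantD(3,4)[OF assms(1,2)] assms(2) by (cases r) (simp_all add: boundary_of_def)

text \<open>Orthogonality to each \<open>delta \<alpha>\<close> says that the prefix sums agree on
  the left ends of the two copies of \<alpha>; adding \<open>x \<alpha>\<close>, they agree on the
  right ends too. The prefix sums thus respect the gluing, and \<open>x\<close> is the boundary of
  the set where they are 1. Conversely, the prefix sums of a boundary are the indicator of its set
  up to a constant, which is the same in both rows because the left ends are glued.\<close>

lemma radical_eq_boundaries:
  assumes \<pi>: "proper \<pi>"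
  shows "bit_form.rad (alphabet \<pi>) (intersection_form \<pi>) = boundaries \<pi>"
proof -
  interpret bit_quadratic "alphabet \<pi>" "intersection_form \<pi>" "quad \<pi>"
    using \<pi> by (rule quadratic_lperm)
  have rad: "x \<in> rad \<longleftrightarrow> x \<in> V \<and> (\<forall>\<alpha>\<in>alphabet \<pi>. intersection_form \<pi> (delta \<alpha>) x = 0)" for x
  proof
    assume "x \<in> rad"
    moreover have "delta \<alpha> \<in> V" if "\<alpha> \<in> alphabet \<pi>" for \<alpha> using that by (auto simp: V_def delta_def)
    ultimately show "x \<in> V \<and> (\<forall>\<alpha>\<in>alphabet \<pi>. intersection_form \<pi> (delta \<alpha>) x = 0)"
      by (simp add: rad_def sym[of "delta _"])
  next
    assume x: "x \<in> V \<and> (\<forall>\<alpha>\<in>alphabet \<pi>. intersection_form \<pi> (delta \<alpha>) x = 0)"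
    have "intersection_form \<pi> x y = 0" for y
    proof -
      have "intersection_form \<pi> y x = (\<Sum>\<alpha>\<in>alphabet \<pi>. y \<alpha> * intersection_form \<pi> (delta \<alpha>) x)"
        unfolding intersection_form_def[of \<pi> y]
        by (intro sum.cong refl) (simp add: intersection_form_delta sum_distrib_left mult.assoc)
      then show ?thesis using x sym by simp
    qed
    then show "x \<in> rad" using x by (simp add: rad_def)
  qed
  show ?thesis
    unfolding boundaries_eq[OF \<pi>]
  proof
    show "rad \<subseteq> boundary_of \<pi> ` {C. glue_invariant \<pi> C}"
    proof
      fix x assume x: "x \<in> rad"
      let ?X = "prefix_sum \<pi> x"
      define C where "C = {(r, k) \<in> corners \<pi>. ?X r k = 1}"
      have mem: "(r, k) \<in> C \<longleftrightarrow> ?X r k = 1" if "k \<le> length (fst \<pi>)" for r k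
        using that by (simp add: C_def corners_def)
      have X: "?X Top (pos \<pi> Top \<alpha>) = ?X Bottom (pos \<pi> Bottom \<alpha>)" if \<alpha>: "\<alpha> \<in> alphabet \<pi>" for \<alpha>
        using x rad intersection_form_delta_prefix[OF \<pi> \<alpha>, of x] \<alpha> by (simp add: bit_add_eq_0_iff)
      have pos: "pos \<pi> r \<alpha> \<le> length (fst \<pi>)" "Suc (pos \<pi> r \<alpha>) \<le> length (fst \<pi>)" if "\<alpha> \<in> alphabet \<pi>" for r \<alpha>
        using pos_less[OF \<pi> that, of r] by auto
      have "(a \<in> C) = (b \<in> C)" if "(a, b) \<in> corner_glue \<pi>" for a b
        using that unfolding corner_glue_def
        by (auto simp: mem pos prefix_sum_0 prefix_sum_all[OF \<pi>] X prefix_sum_Suc[OF \<pi>])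
      then have g: "glue_invariant \<pi> C" by (auto simp: glue_invariant_def C_def)
      have "x = boundary_of \<pi> C"
      proof
        fix \<alpha>
        show "x \<alpha> = boundary_of \<pi> C \<alpha>"
        proof (cases "\<alpha> \<in> alphabet \<pi>")
          case True
          have "boundary_of \<pi> C \<alpha> = of_bool (?X Top (pos \<pi> Top \<alpha>) = 1) + of_bool (?X Top (Suc (pos \<pi> Top \<alpha>)) = 1)"
            unfolding boundary_of_def mem[OF pos(1)[OF True]] mem[OF pos(2)[OF True]] using True by simp
          then show ?thesis
            unfolding prefix_sum_Suc[OF \<pi> True] by (cases "?X Top (pos \<pi> Top \<alpha>)"; cases "x \<alpha>") simp_all
        next
          case False
          then show ?thesis using x rad by (simp add: boundary_of_def V_def)
        qed
      qed
      then show "x \<in> boundary_of \<pi> ` {C. glue_invariant \<pi> C}" using g by blast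
    qed
    show "boundary_of \<pi> ` {C. glue_invariant \<pi> C} \<subseteq> rad"
    proof (rule image_subsetI)
      fix C assume "C \<in> {C. glue_invariant \<pi> C}"
      then have g: "glue_invariant \<pi> C" by simp
      let ?x = "boundary_of \<pi> C"
      have ps: "prefix_sum \<pi> ?x r k = of_bool ((r, 0) \<in> C) + of_bool ((r, k) \<in> C)"
        if "k \<le> length (fst \<pi>)" for r k
        using that
      proof (induction k)
        case (Suc k)
        define \<alpha> where "\<alpha> = labels_of \<pi> r ! k"
        have \<alpha>: "pos \<pi> r \<alpha> = k" using pos_nth[OF \<pi>] Suc.prems by (simp add: \<alpha>_def)
        have "k < length (labels_of \<pi> r)" using Suc.prems proper_length[OF \<pi>] by simp
        then have A: "\<alpha> \<in> alphabet \<pi>" unfolding \<alpha>_def alphabet_def using \<pi>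
          by (cases r) (auto simp: proper_def dest: nth_mem)
        show ?case
          using prefix_sum_Suc[OF \<pi> A, of ?x r] boundary_of_row[OF g A, of r] Suc unfolding \<alpha>
          by (simp add: add.assoc)
      qed (simp add: prefix_sum_0)
      have "intersection_form \<pi> (delta \<alpha>) ?x = 0" if \<alpha>: "\<alpha> \<in> alphabet \<pi>" for \<alpha>
        using pos_less[OF \<pi> \<alpha>, of Top] pos_less[OF \<pi> \<alpha>, of Bottom] glue_invariantD(1,3)[OF g] \<alpha>
        by (simp add: intersection_form_delta_prefix[OF \<pi> \<alpha>] ps)
      then show "?x \<in> rad" by (simp add: rad V_def boundary_of_def)
    qed
  qed
qed

section \<open>Uniqueness of the spin form and of the Arf invariant\<close>

lemma simple_loop:
  assumes "\<alpha> \<in> alphabet \<pi>"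
  shows "simple_closed_curve \<pi> [(Top, \<alpha>, 1 / 2)]" "cycle_of_curve [(Top, \<alpha>, 1 / 2)] = delta \<alpha>"
    "ind \<pi> [(Top, \<alpha>, 1 / 2)] = 0"
  using assms by (auto simp: simple_closed_curve_def cycle_of_curve_def delta_def fun_eq_iff ind_def curve_arc_def)

text \<open>The loop crossing only the side \<alpha>, and that once, has index 0, which forces the
  value 1 on \<open>delta \<alpha>\<close>; the rule for sums then determines the form on all
  cycles.\<close>

lemma spin_form_unique:
  assumes \<pi>: "proper \<pi>" and \<phi>: "spin_form \<pi> \<phi>" and x: "x \<in> cycles \<pi>"
  shows "\<phi> x = quad \<pi> x"
proof -
  have add: "\<phi> (\<lambda>\<alpha>. x \<alpha> + y \<alpha>) = \<phi> x + \<phi> y + intersection_form \<pi> x y" if "x \<in> cycles \<pi>" "y \<in> cycles \<pi>" for x y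
    using \<phi> that by (simp add: spin_form_def)
  have z: "(\<lambda>\<alpha>. 0) \<in> cycles \<pi>" by (simp add: cycles_def)
  have "\<phi> (\<lambda>\<alpha>. of_bool (\<alpha> \<in> Y)) = quad \<pi> (\<lambda>\<alpha>. of_bool (\<alpha> \<in> Y))" if "finite Y" "Y \<subseteq> alphabet \<pi>" for Y
    using that
  proof (induction Y)
    case empty
    have "intersection_form \<pi> (\<lambda>\<alpha>. 0) (\<lambda>\<alpha>. 0) = 0" by (simp add: intersection_form_def)
    then have "\<phi> (\<lambda>\<alpha>. 0) = 0" using add[OF z z] by simp
    then show ?case by (simp add: quad_def)
  next
    case (insert a Y)
    have "\<phi> (delta a) = of_int (ind \<pi> [(Top, a, 1 / 2)] + 1)"
    proof -
      have "a \<in> alphabet \<pi>" using insert.prems by simp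
      from simple_loop(1,2)[OF this] show ?thesis using \<phi> unfolding spin_form_def by metis
    qed
    then have d: "\<phi> (delta a) = quad \<pi> (delta a)"
      using insert.prems by (simp add: simple_loop quad_delta)
    have "delta a \<in> cycles \<pi>" "(\<lambda>\<alpha>. of_bool (\<alpha> \<in> Y)) \<in> cycles \<pi>"
      using insert.prems by (auto simp: cycles_def delta_def)
    moreover have "(\<lambda>\<alpha>. of_bool (\<alpha> \<in> insert a Y)) = (\<lambda>\<alpha>. delta a \<alpha> + of_bool (\<alpha> \<in> Y))"
      using insert.hyps by (auto simp: delta_def fun_eq_iff)
    ultimately show ?case using insert d by (simp only: add quad_add[OF \<pi>] insert_subset simp_thms)
  qed
  note * = this
  have sub: "{\<alpha>. x \<alpha> = 1} \<subseteq> alphabet \<pi>"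
  proof
    fix \<alpha> assume "\<alpha> \<in> {\<alpha>. x \<alpha> = 1}"
    then show "\<alpha> \<in> alphabet \<pi>" using x by (cases "\<alpha> \<in> alphabet \<pi>") (simp_all add: cycles_def)
  qed
  have "\<phi> (\<lambda>\<alpha>. of_bool (x \<alpha> = 1)) = quad \<pi> (\<lambda>\<alpha>. of_bool (x \<alpha> = 1))"
    using *[OF finite_subset[OF sub finite_alphabet] sub] by simp
  moreover have "(\<lambda>\<alpha>. of_bool (x \<alpha> = 1)) = x" by (auto simp: fun_eq_iff of_bool_def)
  ultimately show ?thesis by simp
qed

text \<open>A boundary lies in the radical, so adding it changes \<open>quad\<close> by the value on
  the boundary alone. Its vanishing there is what makes the form descend to homology.\<close>

lemma spin_form_quad:
  assumes \<pi>: "proper \<pi>" and q0: "\<And>x. x \<in> boundaries \<pi> \<Longrightarrow> quad \<pi> x = 0"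
  shows "spin_form \<pi> (quad \<pi>)"
proof -
  interpret bit_quadratic "alphabet \<pi>" "intersection_form \<pi>" "quad \<pi>"
    using \<pi> by (rule quadratic_lperm)
  have "quad \<pi> x = quad \<pi> y" if "x \<in> cycles \<pi>" "y \<in> cycles \<pi>" "homologous \<pi> x y" for x y
  proof -
    have z: "(\<lambda>\<alpha>. x \<alpha> + y \<alpha>) \<in> boundaries \<pi>" using that by (simp add: homologous_def)
    then have "(\<lambda>\<alpha>. x \<alpha> + y \<alpha>) \<in> rad" "y \<in> V" using that(2) V_eq_cycles[OF \<pi>] radical_eq_boundaries[OF \<pi>] by simp_all
    then have "intersection_form \<pi> (\<lambda>\<alpha>. x \<alpha> + y \<alpha>) y = 0" unfolding rad_def by blast
    then have "intersection_form \<pi> x y = 0" by (simp add: add_left alt)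
    then show ?thesis using q0[OF z] by (simp add: quad_add[OF \<pi>] bit_add_eq_0_iff)
  qed
  then show ?thesis
    using quad_add[OF \<pi>] quad_simple_closed_curve[OF \<pi>] by (simp add: spin_form_def)
qed

text \<open>Counting cycles fixes \<open>g\<close>, and the Gauss sum involves no basis; so all
  symplectic bases yield the same Arf invariant. Together with the existence of a basis and of the
  spin form, this makes the definite description of the spin parity meaningful.\<close>

lemma gauss_sum_spin_parity:
  assumes \<pi>: "proper \<pi>" and q0: "\<And>x. x \<in> boundaries \<pi> \<Longrightarrow> quad \<pi> x = 0"
  obtains g where "(\<Sum>x\<in>cycles \<pi>. sg (quad \<pi> x)) = int (card (boundaries \<pi>)) * 2 ^ g * sg (spin_parity \<pi>)"
    "2 ^ card (alphabet \<pi>) = card (boundaries \<pi>) * 4 ^ g"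
proof -
  interpret bit_quadratic "alphabet \<pi>" "intersection_form \<pi>" "quad \<pi>"
    using \<pi> by (rule quadratic_lperm)
  note V = V_eq_cycles[OF \<pi>] and R = radical_eq_boundaries[OF \<pi>]
  have basis: "symplectic_basis \<pi> g a b \<longleftrightarrow> sympl g a b \<and> spans g a b" for g a b
    unfolding symplectic_basis_def sympl_def spans_def V R homologous_def by blast
  have q0': "quad \<pi> x = 0" if "x \<in> rad" for x using q0 that R by simp
  let ?P = "\<lambda>s. \<exists>\<phi>. spin_form \<pi> \<phi> \<and> has_arf_invariant \<pi> \<phi> s"
  have gauss: "\<exists>g. (\<Sum>x\<in>cycles \<pi>. sg (quad \<pi> x)) = int (card (boundaries \<pi>)) * 2 ^ g * sg s
      \<and> 2 ^ card (alphabet \<pi>) = card (boundaries \<pi>) * 4 ^ g" if s: "?P s" for s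
  proof -
    obtain \<phi> g a b where \<phi>: "spin_form \<pi> \<phi>" and ab: "sympl g a b" "spans g a b"
      and s: "s = (\<Sum>i<g. \<phi> (a i) * \<phi> (b i))"
      using s unfolding has_arf_invariant_def basis by blast
    have "a i \<in> cycles \<pi>" "b i \<in> cycles \<pi>" if "i < g" for i using ab(1) that V by (auto simp: sympl_def)
    then have "s = (\<Sum>i<g. quad \<pi> (a i) * quad \<pi> (b i))"
      unfolding s using spin_form_unique[OF \<pi> \<phi>] by (intro sum.cong) auto
    then show ?thesis using gauss_sum[OF ab q0'] V R card_V by auto
  qed
  obtain g u v where uv: "sympl g u v" "spans g u v" by (rule symplectic_basis_exists)
  have ex: "?P (\<Sum>i<g. quad \<pi> (u i) * quad \<pi> (v i))"
    using spin_form_quad[OF \<pi> q0] uv unfolding has_arf_invariant_def basis by blast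
  have "s = s'" if ss: "?P s" "?P s'" for s s'
  proof -
    obtain g where g: "(\<Sum>x\<in>cycles \<pi>. sg (quad \<pi> x)) = int (card (boundaries \<pi>)) * 2 ^ g * sg s"
      "2 ^ card (alphabet \<pi>) = card (boundaries \<pi>) * 4 ^ g" using gauss[OF ss(1)] by blast
    obtain g' where g': "(\<Sum>x\<in>cycles \<pi>. sg (quad \<pi> x)) = int (card (boundaries \<pi>)) * 2 ^ g' * sg s'"
      "2 ^ card (alphabet \<pi>) = card (boundaries \<pi>) * 4 ^ g'" using gauss[OF ss(2)] by blast
    have c: "card (boundaries \<pi>) \<noteq> 0" using g(2) by (metis mult_is_0 power_not_zero zero_neq_numeral)
    have "card (boundaries \<pi>) * 4 ^ g = card (boundaries \<pi>) * 4 ^ g'" using g(2) g'(2) by metis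
    then have "g = g'" using c by simp
    moreover from this have "int (card (boundaries \<pi>)) * 2 ^ g * sg s = int (card (boundaries \<pi>)) * 2 ^ g * sg s'"
      using g(1) g'(1) by metis
    ultimately show ?thesis using c by (simp add: sg_inject)
  qed
  note uniq = this
  have "?P (spin_parity \<pi>)" unfolding spin_parity_def by (rule theI[of ?P, OF ex]) (rule uniq[OF _ ex])
  from gauss[OF this] show ?thesis using that by blast
qed

section \<open>Standard permutations\<close>

text \<open>An invariant set is a union of orbits, and the sets
  \<open>{j\<in>S. (\<tau>b j \<in> g) \<noteq> (j \<in> g)}\<close> of disjoint orbits add up mod
  2. Going around one orbit of odd length preserves the sign, and the translated set stays
  odd.\<close>

lemma inv_sign_invariant_shift:
  assumes t: "numbering \<tau>t S P" and b: "numbering \<tau>b S Q"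
    and \<sigma>: "\<sigma> permutes S" "\<And>j. j \<in> S \<Longrightarrow> \<sigma> (\<tau>b j) = \<tau>t j"
    and odd: "\<And>y. y \<in> S \<Longrightarrow> odd (card (orbit \<sigma> y))"
    and Y: "Y \<subseteq> S" "odd (card Y)"
    and "g \<subseteq> S" "\<And>j. j \<in> g \<Longrightarrow> \<sigma> j \<in> g"
  shows "inv_sign P Q (sym_diff Y {j\<in>S. (\<tau>b j \<in> g) \<noteq> (j \<in> g)}) = inv_sign P Q Y"
  using assms(8-)
proof (induction "card g" arbitrary: g rule: less_induct)
  case less
  have fin: "finite S" using numberingD(1)[OF t] .
  show ?case
  proof (cases "g = {}")
    case False
    then obtain y where y: "y \<in> g" by blast
    define Ob where "Ob = orbit \<sigma> y"
    have p: "permutation \<sigma>" using \<sigma>(1) fin permutation_permutes by blast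
    have yO: "y \<in> Ob" unfolding Ob_def by (rule permutation_self_in_orbit[OF p])
    have Og: "Ob \<subseteq> g" unfolding Ob_def by (rule orbit_subset_closed) (use less.prems y in auto)
    have yS: "y \<in> S" using y less.prems by blast
    have fg: "finite g" using less.prems(1) fin finite_subset by blast
    let ?V = "\<lambda>g. {j\<in>S. (\<tau>b j \<in> g) \<noteq> (j \<in> g)}"
    have "card (g - Ob) < card g" using fg y yO by (intro psubset_card_mono) auto
    moreover have "\<sigma> j \<in> g - Ob" if "j \<in> g - Ob" for j
      using that less.prems(2) orbit_closed[OF \<sigma>(1) fin] by (auto simp: Ob_def)
    moreover have "g - Ob \<subseteq> S" using less.prems(1) by blast
    ultimately have IH: "inv_sign P Q (sym_diff Y (?V (g - Ob))) = inv_sign P Q Y"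
      by (intro less.hyps)
    have fY: "finite Y" using Y fin finite_subset by blast
    have "even (card (?V (g - Ob)))" using less.prems(1) by (intro even_card_boundary[OF b]) auto
    then have odd': "odd (card (sym_diff Y (?V (g - Ob))))"
      using even_card_sym_diff[of Y "?V (g - Ob)"] fY fin Y(2) by simp
    have "sym_diff Y (?V g) = sym_diff (sym_diff Y (?V (g - Ob))) (?V Ob)"
      using Og Y(1) by blast
    moreover have "inv_sign P Q (sym_diff (sym_diff Y (?V (g - Ob))) (?V Ob)) = inv_sign P Q (sym_diff Y (?V (g - Ob)))"
      using inv_sign_orbit_shift[OF t b \<sigma> yS _ odd'] Y(1) odd[OF yS] by (simp add: Ob_def subset_iff)
    ultimately show ?thesis using IH by simp
  qed simp
qed

text \<open>An invariant set avoiding \<open>s\<close> is the union of an arbitrary collection of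
  orbits other than the one of \<open>s\<close>.\<close>

lemma card_invariant_sets:
  assumes \<sigma>: "\<sigma> permutes S" and fin: "finite S" and s: "s \<in> S"
  shows "card {g. g \<subseteq> S \<and> (\<forall>j\<in>S. \<sigma> j \<in> g \<longleftrightarrow> j \<in> g) \<and> s \<notin> g} = 2 ^ (card (orbit \<sigma> ` S) - 1)"
proof -
  let ?I = "{g. g \<subseteq> S \<and> (\<forall>j\<in>S. \<sigma> j \<in> g \<longleftrightarrow> j \<in> g) \<and> s \<notin> g}"
  let ?O = "orbit \<sigma> ` S - {orbit \<sigma> s}"
  have p: "permutation \<sigma>" using \<sigma> fin permutation_permutes by blast
  have self: "j \<in> orbit \<sigma> j" for j by (rule permutation_self_in_orbit[OF p])
  have eq: "orbit \<sigma> i = orbit \<sigma> j" if "i \<in> orbit \<sigma> j" for i j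
    using orbit_cyclic_eq3[OF cyclic_on_orbit[OF \<sigma> fin] that] .
  have sub: "orbit \<sigma> j \<subseteq> S" if "j \<in> S" for j using permutes_orbit_subset[OF \<sigma> that] .
  have "bij_betw (\<lambda>W. \<Union>W) (Pow ?O) ?I"
  proof (rule bij_betw_byWitness[where f' = "\<lambda>g. orbit \<sigma> ` g"])
    show "\<forall>W\<in>Pow ?O. orbit \<sigma> ` \<Union>W = W"
    proof
      fix W assume W: "W \<in> Pow ?O"
      show "orbit \<sigma> ` \<Union>W = W"
      proof
        show "orbit \<sigma> ` \<Union>W \<subseteq> W"
        proof (rule image_subsetI)
          fix i assume "i \<in> \<Union>W"
          then obtain j where "orbit \<sigma> j \<in> W" "i \<in> orbit \<sigma> j" using W by blast
          then show "orbit \<sigma> i \<in> W" using eq by metis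
        qed
        show "W \<subseteq> orbit \<sigma> ` \<Union>W"
        proof
          fix v assume v: "v \<in> W"
          then obtain j where "v = orbit \<sigma> j" using W by blast
          then show "v \<in> orbit \<sigma> ` \<Union>W" using v self by blast
        qed
      qed
    qed
    show "\<forall>g\<in>?I. \<Union>(orbit \<sigma> ` g) = g"
    proof
      fix g assume g: "g \<in> ?I"
      have "orbit \<sigma> j \<subseteq> g" if "j \<in> g" for j
        by (rule orbit_subset_closed) (use g that in auto)
      then show "\<Union>(orbit \<sigma> ` g) = g" using self by blast
    qed
    show "(\<lambda>W. \<Union>W) ` Pow ?O \<subseteq> ?I"
    proof (rule image_subsetI)
      fix W assume W: "W \<in> Pow ?O"
      have "\<Union>W \<subseteq> S" using W sub by blast
      moreover have "\<sigma> j \<in> \<Union>W \<longleftrightarrow> j \<in> \<Union>W" for j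
      proof -
        have "\<sigma> j \<in> v \<longleftrightarrow> j \<in> v" if v: "v \<in> W" for v
        proof -
          obtain i where "v = orbit \<sigma> i" using W v by blast
          then show ?thesis using orbit_closed[OF \<sigma> fin] by simp
        qed
        then show ?thesis by blast
      qed
      moreover have "s \<notin> \<Union>W"
      proof
        assume "s \<in> \<Union>W"
        then obtain v where v: "v \<in> W" "s \<in> v" by blast
        then obtain i where "v = orbit \<sigma> i" using W v(1) by blast
        then have "v = orbit \<sigma> s" using eq v(2) by metis
        then show False using v(1) W by blast
      qed
      ultimately show "\<Union>W \<in> ?I" by blast
    qed
    show "image (orbit \<sigma>) ` ?I \<subseteq> Pow ?O"
    proof (rule image_subsetI)
      fix g assume g: "g \<in> ?I"
      have sub': "orbit \<sigma> j \<subseteq> g" if "j \<in> g" for j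
        by (rule orbit_subset_closed) (use g that in auto)
      have "orbit \<sigma> j \<noteq> orbit \<sigma> s" if "j \<in> g" for j
        using sub'[OF that] self[of s] g by blast
      moreover have "g \<subseteq> S" using g by simp
      ultimately show "orbit \<sigma> ` g \<in> Pow ?O"
        by (intro PowI image_subsetI DiffI imageI) auto
    qed
  qed
  from bij_betw_same_card[OF this] have "card ?I = card (Pow ?O)" by (rule sym)
  also have "\<dots> = 2 ^ (card (orbit \<sigma> ` S) - 1)"
    using fin s by (simp add: card_Pow)
  finally show ?thesis .
qed

section \<open>Rows and positions of a standard permutation\<close>

locale factor_pair =
  fixes N :: nat and star :: nat and \<tau>t \<tau>b \<sigma> :: "nat \<Rightarrow> nat"
  assumes star: "star \<in> {1..N}"
    and cyc: "full_cycle N \<tau>t" "full_cycle N \<tau>b"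
    and \<sigma>: "\<sigma> permutes {1..N}" and \<tau>t: "\<tau>t = \<sigma> \<circ> \<tau>b"
begin

definition S :: "nat set" where
  "S = {1..N}"

lemma finite_S: "finite S" and card_S: "card S = N" and star_S: "star \<in> S" and \<sigma>_S: "\<sigma> permutes S"
  using star \<sigma> by (simp_all add: S_def)

definition \<pi> :: "label lperm" where
  "\<pi> = standard_perm N star \<tau>t \<tau>b"

text \<open>The label \<open>R_bot\<close> closes both rows up to cycles of length \<open>N\<close>, in the place of \<open>star\<close>.\<close>

definition emb :: "nat \<Rightarrow> label" where
  "emb j = (if j = star then R_bot else Lab j)"

definition tau :: "row \<Rightarrow> nat \<Rightarrow> nat" where
  "tau r = (case r of Top \<Rightarrow> \<tau>t | Bottom \<Rightarrow> \<tau>b)"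

lemma tau_simps [simp]: "tau Top = \<tau>t" "tau Bottom = \<tau>b"
  by (simp_all add: tau_def)

lemma N_pos: "0 < N"
  using star by auto

lemma inj_emb: "inj emb"
  by (auto simp: inj_def emb_def split: if_splits)

lemma tau_permutes: "tau r permutes S" "cyclic_on (tau r) S"
  using cyc by (cases r; simp add: full_cycle_def S_def)+

lemma tau_enum:
  "(\<lambda>k. (tau r ^^ k) star) ` {..<N} = S" "inj_on (\<lambda>k. (tau r ^^ k) star) {..<N}" "(tau r ^^ N) star = star"
proof -
  have p: "permutation (tau r)" using tau_permutes(1) finite_S permutation_permutes by blast
  have "orbit (tau r) star = S" using orbit_cyclic_eq3[OF tau_permutes(2) star_S] .
  note O = orbit_enum[OF p, of star, unfolded this card_S]
  show "(\<lambda>k. (tau r ^^ k) star) ` {..<N} = S" by (rule O(1)[symmetric])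
  show "inj_on (\<lambda>k. (tau r ^^ k) star) {..<N}" "(tau r ^^ N) star = star" by (rule O)+
qed

lemma tau_power_star: "k < N \<Longrightarrow> (tau r ^^ k) star = star \<longleftrightarrow> k = 0"
  using inj_onD[OF tau_enum(2)[of r], of k 0] N_pos by auto

text \<open>The exponents run from 1 to \<open>N\<close> on top and from 0 to \<open>N - 1\<close>
  at the bottom, because \<open>R_bot\<close>, which stands for \<open>star\<close>, ends the top
  row and begins the bottom row.\<close>

lemma labels_top: "labels_of \<pi> Top = R_top # map (\<lambda>k. emb ((\<tau>t ^^ k) star)) [Suc 0..<Suc N]"
proof -
  have "map (\<lambda>k. Lab ((\<tau>t ^^ k) star)) [Suc 0..<N] = map (\<lambda>k. emb ((\<tau>t ^^ k) star)) [Suc 0..<N]"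
    using tau_power_star[of _ Top] by (auto simp: emb_def)
  moreover have "[Suc 0..<Suc N] = [Suc 0..<N] @ [N]" using N_pos by simp
  moreover have "emb ((\<tau>t ^^ N) star) = R_bot" using tau_enum(3)[of Top] by (simp add: emb_def)
  ultimately show ?thesis by (simp add: \<pi>_def standard_perm_def del: upt_Suc)
qed

lemma labels_bottom: "labels_of \<pi> Bottom = map (\<lambda>k. emb ((\<tau>b ^^ k) star)) [0..<N] @ [R_top]"
proof -
  have "map (\<lambda>k. Lab ((\<tau>b ^^ k) star)) [Suc 0..<N] = map (\<lambda>k. emb ((\<tau>b ^^ k) star)) [Suc 0..<N]"
    using tau_power_star[of _ Bottom] by (auto simp: emb_def)
  moreover have "[0..<N] = 0 # [Suc 0..<N]" using N_pos by (simp add: upt_conv_Cons)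
  ultimately show ?thesis by (simp add: \<pi>_def standard_perm_def emb_def)
qed

lemma emb_enum_set: "(\<lambda>k. emb ((tau r ^^ k) star)) ` {..<N} = emb ` S"
  using tau_enum(1)[of r] by (metis image_image)

lemma R_top_notin: "R_top \<notin> emb ` S"
  by (auto simp: emb_def split: if_splits)

lemma enum_shift: "(\<lambda>k. (tau r ^^ k) star) ` {Suc 0..<Suc N} = S"
proof -
  have "{Suc 0..<Suc N} = insert N ({..<N} - {0})" using N_pos by auto
  then have "(\<lambda>k. (tau r ^^ k) star) ` {Suc 0..<Suc N} = insert star ((\<lambda>k. (tau r ^^ k) star) ` ({..<N} - {0}))"
    using tau_enum(3)[of r] by simp
  also have "\<dots> = (\<lambda>k. (tau r ^^ k) star) ` insert 0 ({..<N} - {0})" by (simp only: image_insert funpow_0)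
  also have "insert 0 ({..<N} - {0}) = {..<N}" using N_pos by auto
  finally show ?thesis using tau_enum(1) by simp
qed

lemma inj_enum_shift: "inj_on (\<lambda>k. (tau r ^^ k) star) {Suc 0..<Suc N}"
  by (rule eq_card_imp_inj_on) (simp_all add: enum_shift card_S)

lemma proper: "proper \<pi>"
proof -
  define A where "A = map (\<lambda>k. emb ((\<tau>t ^^ k) star)) [Suc 0..<Suc N]"
  define B where "B = map (\<lambda>k. emb ((\<tau>b ^^ k) star)) [0..<N]"
  have e: "inj_on (\<lambda>k. emb (f k)) K" if "inj_on f K" for f and K :: "nat set"
    using comp_inj_on[OF that inj_on_subset[OF inj_emb subset_UNIV]] by (simp add: comp_def)
  have tb: "fst \<pi> = R_top # A" "snd \<pi> = B @ [R_top]"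
    using labels_top labels_bottom by (simp_all add: A_def B_def)
  have A: "set A = emb ` S"
    unfolding A_def set_map set_upt using arg_cong[OF enum_shift[of Top], of "image emb"] by (simp add: image_image)
  have B: "set B = emb ` S"
    unfolding B_def set_map set_upt atLeast0LessThan using emb_enum_set[of Bottom] by simp
  have "distinct A" "distinct B"
    unfolding A_def B_def distinct_map set_upt atLeast0LessThan
    using e[OF inj_enum_shift[of Top]] e[OF tau_enum(2)[of Bottom]] by simp_all
  then show ?thesis
    unfolding proper_def tb using A B R_top_notin by simp
qed

lemma length_\<pi>: "length (fst \<pi>) = Suc N"
  using labels_top by simp

lemma alphabet_\<pi>: "alphabet \<pi> = insert R_top (emb ` S)"
proof -
  have "set (map (\<lambda>k. emb ((\<tau>t ^^ k) star)) [Suc 0..<Suc N]) = emb ` S"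
    using arg_cong[OF enum_shift[of Top], of "image emb"] by (simp add: image_image del: upt_Suc)
  then show ?thesis using labels_top by (simp add: alphabet_def del: upt_Suc set_map)
qed

lemma pos_R_top: "pos \<pi> Top R_top = 0" "pos \<pi> Bottom R_top = N"
proof -
  have "labels_of \<pi> Top ! 0 = R_top" "labels_of \<pi> Bottom ! N = R_top"
    unfolding labels_top labels_bottom by (simp_all add: nth_append)
  then show "pos \<pi> Top R_top = 0" "pos \<pi> Bottom R_top = N"
    using pos_nth[OF proper, of 0 Top] pos_nth[OF proper, of N Bottom] length_\<pi> by simp_all
qed

lemma pos_top: "1 \<le> k \<Longrightarrow> k \<le> N \<Longrightarrow> pos \<pi> Top (emb ((\<tau>t ^^ k) star)) = k"
proof -
  assume k: "1 \<le> k" "k \<le> N"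
  then have "labels_of \<pi> Top ! k = emb ((\<tau>t ^^ k) star)"
    unfolding labels_top by (cases k) (simp_all del: upt_Suc funpow.simps)
  then show ?thesis using pos_nth[OF proper, of k Top] length_\<pi> k by simp
qed

lemma pos_bottom: "k < N \<Longrightarrow> pos \<pi> Bottom (emb ((\<tau>b ^^ k) star)) = k"
proof -
  assume k: "k < N"
  then have "labels_of \<pi> Bottom ! k = emb ((\<tau>b ^^ k) star)"
    unfolding labels_bottom by (simp add: nth_append)
  then show ?thesis using pos_nth[OF proper, of k Bottom] length_\<pi> k by simp
qed

text \<open>The top cycle is opened just before \<open>\<tau>t star\<close>; the shift by one is the
  place taken by \<open>R_top\<close> at the head of the row.\<close>

lemma numbering_top: obtains P where "numbering \<tau>t S P" "\<And>j. j \<in> S \<Longrightarrow> pos \<pi> Top (emb j) = Suc (P j)"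
proof -
  have t: "\<tau>t star \<in> S" using permutes_in_image[OF tau_permutes(1)[of Top], of star] star_S by simp
  obtain P where P: "numbering \<tau>t S P" "\<And>k. k < card S \<Longrightarrow> P ((\<tau>t ^^ k) (\<tau>t star)) = k"
    using cyclic_on_imp_numbering[OF tau_permutes(1)[of Top] finite_S tau_permutes(2)[of Top]] t by auto
  have "pos \<pi> Top (emb j) = Suc (P j)" if j: "j \<in> S" for j
  proof -
    obtain k where k: "k \<in> {Suc 0..<Suc N}" "j = (\<tau>t ^^ k) star" using j unfolding enum_shift[of Top, symmetric] by auto
    then obtain l where l: "k = Suc l" by (cases k) auto
    have "P j = l" using P(2)[of l] k by (simp add: l funpow_swap1 card_S)
    then show ?thesis using pos_top[of k] k l by simp
  qed
  then show ?thesis using that P by blast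
qed

lemma numbering_bottom: obtains Q where "numbering \<tau>b S Q" "\<And>j. j \<in> S \<Longrightarrow> pos \<pi> Bottom (emb j) = Q j"
proof -
  obtain Q where Q: "numbering \<tau>b S Q" "\<And>k. k < card S \<Longrightarrow> Q ((\<tau>b ^^ k) star) = k"
    using cyclic_on_imp_numbering[OF tau_permutes(1)[of Bottom] finite_S tau_permutes(2)[of Bottom] star_S] by auto
  have "pos \<pi> Bottom (emb j) = Q j" if j: "j \<in> S" for j
  proof -
    obtain k where k: "k < N" "j = (\<tau>b ^^ k) star" using j unfolding tau_enum(1)[of Bottom, symmetric] by auto
    then show ?thesis using pos_bottom[of k] Q(2)[of k] by (simp add: card_S)
  qed
  then show ?thesis using that Q by blast
qed

end

section \<open>The Gauss sum of a standard permutation\<close>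

lemma bit_sum_restrict:
  assumes "finite A" "Y \<subseteq> A"
  shows "(\<Sum>\<alpha>\<in>A. of_bool (\<alpha> \<in> Y) * f \<alpha>) = (\<Sum>\<alpha>\<in>Y. f \<alpha> :: bit)"
proof -
  have "(\<Sum>\<alpha>\<in>Y. f \<alpha>) = (\<Sum>\<alpha>\<in>Y. of_bool (\<alpha> \<in> Y) * f \<alpha>)" by (intro sum.cong) auto
  also have "\<dots> = (\<Sum>\<alpha>\<in>A. of_bool (\<alpha> \<in> Y) * f \<alpha>)"
    using assms by (intro sum.mono_neutral_left) auto
  finally show ?thesis by (rule sym)
qed

lemma sg_quad_indicator:
  assumes "Y \<subseteq> alphabet \<pi>"
  shows "sg (quad \<pi> (\<lambda>\<alpha>. of_bool (\<alpha> \<in> Y))) = (- 1) ^ card Y * inv_sign (pos \<pi> Top) (pos \<pi> Bottom) Y"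
proof -
  let ?c = "\<lambda>\<alpha> \<beta>. of_bool (pos \<pi> Top \<alpha> < pos \<pi> Top \<beta> \<and> pos \<pi> Bottom \<beta> < pos \<pi> Bottom \<alpha>) :: bit"
  have "(\<Sum>\<alpha>\<in>alphabet \<pi>. of_bool (\<alpha> \<in> Y)) = (\<Sum>\<alpha>\<in>Y. 1 :: bit)"
    using bit_sum_restrict[OF finite_alphabet assms, of "\<lambda>_. 1"] by simp
  moreover have "(\<Sum>\<alpha>\<in>alphabet \<pi>. \<Sum>\<beta>\<in>alphabet \<pi>. of_bool (\<alpha> \<in> Y) * of_bool (\<beta> \<in> Y) * ?c \<alpha> \<beta>)
      = (\<Sum>\<alpha>\<in>Y. \<Sum>\<beta>\<in>Y. ?c \<alpha> \<beta>)"
    unfolding mult.assoc sum_distrib_left[symmetric] bit_sum_restrict[OF finite_alphabet assms] ..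
  ultimately have "quad \<pi> (\<lambda>\<alpha>. of_bool (\<alpha> \<in> Y)) = (\<Sum>\<alpha>\<in>Y. 1) + (\<Sum>\<alpha>\<in>Y. \<Sum>\<beta>\<in>Y. ?c \<alpha> \<beta>)"
    by (simp only: quad_def)
  then show ?thesis by (simp add: sg_add sg_sum sg_of_bool inv_sign_def prod_constant del: sum_constant)
qed

lemma sum_Pow_insert:
  assumes "finite A" "a \<notin> A"
  shows "(\<Sum>Y\<in>Pow (insert a A). f Y) = (\<Sum>Y\<in>Pow A. f Y + f (insert a Y) :: int)"
proof -
  have "inj_on (insert a) (Pow A)" using assms(2) by (intro inj_onI) (metis Diff_insert_absorb PowD subsetD)
  moreover have "Pow A \<inter> insert a ` Pow A = {}" using assms(2) by auto
  ultimately show ?thesis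
    using assms(1) by (simp add: Pow_insert sum.union_disjoint sum.reindex sum.distrib)
qed

context factor_pair
begin

lemma \<tau>t_S: "j \<in> S \<Longrightarrow> \<tau>t j \<in> S" and \<tau>b_S: "j \<in> S \<Longrightarrow> \<tau>b j \<in> S"
  using permutes_in_image[OF tau_permutes(1)[of Top]] permutes_in_image[OF tau_permutes(1)[of Bottom]] by simp_all

text \<open>\<open>R_top\<close> is first on top and last at the bottom, hence inverted with every
  other label. Its \<open>card Z\<close> inversions cancel the sign \<open>(- 1) ^ card Z\<close> of
  the weight, and its own weight leaves the factor \<open>- 1\<close>.\<close>

lemma sg_quad:
  assumes P: "\<And>j. j \<in> S \<Longrightarrow> pos \<pi> Top (emb j) = Suc (P j)" and Q: "\<And>j. j \<in> S \<Longrightarrow> pos \<pi> Bottom (emb j) = Q j"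
    and Qn: "numbering \<tau>b S Q" and Z: "Z \<subseteq> S"
  shows "sg (quad \<pi> (\<lambda>\<alpha>. of_bool (\<alpha> \<in> emb ` Z))) = (- 1) ^ card Z * inv_sign P Q Z"
    "sg (quad \<pi> (\<lambda>\<alpha>. of_bool (\<alpha> \<in> insert R_top (emb ` Z)))) = - inv_sign P Q Z"
proof -
  let ?p = "pos \<pi> Top" and ?q = "pos \<pi> Bottom"
  have fin: "finite Z" using Z finite_S finite_subset by blast
  have inj: "inj_on emb Z" using inj_emb by (rule inj_on_subset) simp
  have cE: "card (emb ` Z) = card Z" using inj by (rule card_image)
  have nR: "R_top \<notin> emb ` Z" using R_top_notin Z by blast
  have E: "inv_sign ?p ?q (emb ` Z) = inv_sign P Q Z"
    unfolding inv_sign_image[OF inj]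
  proof (rule inv_sign_cong[OF fin])
    fix a b assume "a \<in> Z" "b \<in> Z"
    then have "a \<in> S" "b \<in> S" using Z by auto
    then show "crossing_pair (?p \<circ> emb) (?q \<circ> emb) a b = crossing_pair P Q a b"
      by (simp add: crossing_pair_def P Q)
  qed
  show "sg (quad \<pi> (\<lambda>\<alpha>. of_bool (\<alpha> \<in> emb ` Z))) = (- 1) ^ card Z * inv_sign P Q Z"
    using Z by (subst sg_quad_indicator) (auto simp: alphabet_\<pi> E cE)
  have "crossing_pair ?p ?q R_top b" if b: "b \<in> emb ` Z" for b
  proof -
    obtain j where j: "j \<in> S" "b = emb j" using b Z by blast
    then show ?thesis using numberingD(7)[OF Qn j(1)] by (simp add: crossing_pair_def pos_R_top P Q card_S)
  qed
  then have "(\<Prod>b\<in>emb ` Z. sb (crossing_pair ?p ?q R_top b)) = (- 1) ^ card Z"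
    by (simp add: prod_constant cE)
  then have i: "inv_sign ?p ?q (insert R_top (emb ` Z)) = inv_sign P Q Z * (- 1) ^ card Z"
    using fin nR by (simp add: inv_sign_insert E)
  have c: "card (insert R_top (emb ` Z)) = Suc (card Z)" using fin nR cE by simp
  have "insert R_top (emb ` Z) \<subseteq> alphabet \<pi>" using Z by (auto simp: alphabet_\<pi>)
  from sg_quad_indicator[OF this]
  show "sg (quad \<pi> (\<lambda>\<alpha>. of_bool (\<alpha> \<in> insert R_top (emb ` Z)))) = - inv_sign P Q Z"
    unfolding i c by (cases "even (card Z)") simp_all
qed

text \<open>The contributions of \<open>Z\<close> with and without \<open>R_top\<close> cancel for
  even \<open>card Z\<close> and coincide for odd \<open>card Z\<close>. This is where the
  restriction to odd subsets in \<open>theta\<close> comes from.\<close>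

lemma sum_sg_quad: "(\<Sum>x\<in>cycles \<pi>. sg (quad \<pi> x)) = - 2 * theta_of S \<sigma> \<tau>b"
proof -
  obtain P where P: "numbering \<tau>t S P" "\<And>j. j \<in> S \<Longrightarrow> pos \<pi> Top (emb j) = Suc (P j)" by (rule numbering_top) blast
  obtain Q where Q: "numbering \<tau>b S Q" "\<And>j. j \<in> S \<Longrightarrow> pos \<pi> Bottom (emb j) = Q j" by (rule numbering_bottom) blast
  let ?F = "\<lambda>Y. sg (quad \<pi> (\<lambda>\<alpha>. of_bool (\<alpha> \<in> Y)))"
  have bij: "bij_betw (\<lambda>Y \<alpha>. of_bool (\<alpha> \<in> Y)) (Pow (alphabet \<pi>)) (cycles \<pi>)"
    using bit_form.bij_betw_V[OF bit_quadratic.axioms(1)[OF quadratic_lperm[OF proper]]]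
    unfolding V_eq_cycles[OF proper] .
  have "(\<Sum>x\<in>cycles \<pi>. sg (quad \<pi> x)) = (\<Sum>Y\<in>Pow (alphabet \<pi>). ?F Y)"
    using sum.reindex_bij_betw[OF bij, of "\<lambda>x. sg (quad \<pi> x)"] by simp
  also have "\<dots> = (\<Sum>Y\<in>Pow (emb ` S). ?F Y + ?F (insert R_top Y))"
    unfolding alphabet_\<pi> using finite_S R_top_notin by (intro sum_Pow_insert) auto
  also have "\<dots> = (\<Sum>Z\<in>Pow S. ?F (emb ` Z) + ?F (insert R_top (emb ` Z)))"
  proof -
    have "inj_on emb S" using inj_emb by (rule inj_on_subset) simp
    from sum.reindex[OF inj_on_image_Pow[OF this], of "\<lambda>Y. ?F Y + ?F (insert R_top Y)"]
    show ?thesis by (simp only: image_Pow_surj[OF refl] comp_def)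
  qed
  also have "\<dots> = (\<Sum>Z\<in>Pow S. if odd (card Z) then - 2 * inv_sign P Q Z else 0)"
    using sg_quad[OF P(2) Q(2,1)] by (intro sum.cong refl) auto
  also have "\<dots> = (\<Sum>Z | Z \<subseteq> S \<and> odd (card Z). - 2 * inv_sign P Q Z)"
    using finite_S by (simp add: sum.inter_filter[symmetric] Pow_def Collect_conj_eq)
  also have "\<dots> = - 2 * theta P Q S" by (simp add: theta_def sum_distrib_left)
  also have "theta P Q S = theta_of S \<sigma> \<tau>b"
    using theta_of_eq[of \<sigma> \<tau>b S P Q] P(1) Q(1) \<tau>t by simp
  finally show ?thesis .
qed

text \<open>The boundary of the singularities that belong to the cycles of \<sigma> contained in
  \<open>g\<close>: the side \<open>emb j\<close> leads from a corner named \<open>j\<close> to one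
  named \<open>\<tau>b j\<close>, and \<open>R_top\<close> leads from \<open>star\<close> to
  \<open>\<tau>t star\<close>.\<close>

definition chain_of :: "nat set \<Rightarrow> label \<Rightarrow> bit" where
  "chain_of g \<alpha> = (if \<alpha> = R_top then of_bool (star \<in> g) + of_bool (\<tau>t star \<in> g)
    else if \<alpha> \<in> emb ` S then (let j = inv emb \<alpha> in of_bool (j \<in> g) + of_bool (\<tau>b j \<in> g)) else 0)"

lemma emb_neq_R_top: "emb j \<noteq> R_top"
  by (simp add: emb_def)

lemma chain_of_simps:
  "chain_of g R_top = of_bool (star \<in> g) + of_bool (\<tau>t star \<in> g)"
  "j \<in> S \<Longrightarrow> chain_of g (emb j) = of_bool (j \<in> g) + of_bool (\<tau>b j \<in> g)"
  "\<alpha> \<notin> alphabet \<pi> \<Longrightarrow> chain_of g \<alpha> = 0"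
  using inj_emb by (simp_all add: chain_of_def alphabet_\<pi> inv_f_f emb_neq_R_top)

definition invariant :: "nat set \<Rightarrow> bool" where
  "invariant g \<longleftrightarrow> g \<subseteq> S \<and> (\<forall>j\<in>S. \<sigma> j \<in> g \<longleftrightarrow> j \<in> g)"

lemma invariant_tau: "invariant g \<Longrightarrow> j \<in> S \<Longrightarrow> \<tau>t j \<in> g \<longleftrightarrow> \<tau>b j \<in> g"
  using \<tau>b_S by (simp add: invariant_def \<tau>t)

text \<open>Each corner is named by the element whose side begins there. Gluing left ends then
  preserves names, and gluing right ends identifies \<open>\<tau>b j\<close> with
  \<open>\<tau>t j = \<sigma> (\<tau>b j)\<close>; so a glue-invariant set of corners is an
  invariant set of names.\<close>

lemma boundary_chain:
  assumes C: "glue_invariant \<pi> C"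
  obtains g where "invariant g" "boundary_of \<pi> C = chain_of g"
proof
  define g where "g = {j \<in> S. (Bottom, pos \<pi> Bottom (emb j)) \<in> C}"
  note G = glue_invariantD[OF C]
  have A: "emb j \<in> alphabet \<pi>" if "j \<in> S" for j using that by (simp add: alphabet_\<pi>)
  have RA: "R_top \<in> alphabet \<pi>" by (simp add: alphabet_\<pi>)
  have g: "j \<in> g \<longleftrightarrow> (Bottom, pos \<pi> Bottom (emb j)) \<in> C" "j \<in> g \<longleftrightarrow> (Top, pos \<pi> Top (emb j)) \<in> C"
    if "j \<in> S" for j
    using that G(3)[OF A[OF that]] by (simp_all add: g_def)
  have pb0: "pos \<pi> Bottom (emb star) = 0" using pos_bottom[of 0] N_pos by simp
  have pt1: "pos \<pi> Top (emb (\<tau>t star)) = 1" using pos_top[of 1] N_pos by simp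
  have star0: "star \<in> g \<longleftrightarrow> (Top, 0) \<in> C" using g(1)[OF star_S] pb0 G(1) by simp
  have R1: "(Top, 1) \<in> C \<longleftrightarrow> \<tau>t star \<in> g" using g(2)[OF \<tau>t_S[OF star_S]] pt1 by simp
  have bot: "(Bottom, Suc (pos \<pi> Bottom (emb j))) \<in> C \<longleftrightarrow> \<tau>b j \<in> g" if j: "j \<in> S" for j
  proof -
    obtain k where k: "k < N" "j = (\<tau>b ^^ k) star" using j unfolding tau_enum(1)[of Bottom, symmetric] by auto
    show ?thesis
    proof (cases "Suc k = N")
      \<comment> \<open>The right end of this side is the left end of \<open>R_top\<close> at the
        bottom, which is glued to the left end of the polygon and is therefore named
        \<open>star\<close>.\<close>
      case True
      have "\<tau>b j = (\<tau>b ^^ N) star" using k True by auto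
      then have "\<tau>b j = star" using tau_enum(3)[of Bottom] by simp
      moreover have "(Bottom, N) \<in> C \<longleftrightarrow> (Top, 0) \<in> C" using G(3)[OF RA] pos_R_top by simp
      ultimately show ?thesis using pos_bottom[OF k(1)] k(2) True star0 by simp
    next
      case False
      then have "pos \<pi> Bottom (emb (\<tau>b j)) = Suc k" using pos_bottom[of "Suc k"] k by simp
      then show ?thesis using g(1)[OF \<tau>b_S[OF j]] pos_bottom[OF k(1)] k(2) by simp
    qed
  qed
  have top: "(Top, Suc (pos \<pi> Top (emb j))) \<in> C \<longleftrightarrow> \<tau>t j \<in> g" if j: "j \<in> S" for j
  proof -
    obtain k where k: "1 \<le> k" "k \<le> N" "j = (\<tau>t ^^ k) star" using j unfolding enum_shift[of Top, symmetric] by auto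
    show ?thesis
    proof (cases "k = N")
      \<comment> \<open>This side ends at the right end of the polygon. That corner is the right end
        of \<open>R_top\<close>, which on top is the corner where \<open>\<tau>t star\<close>
        begins.\<close>
      case True
      then have "j = star" using k tau_enum(3)[of Top] by simp
      moreover have "(Top, Suc N) \<in> C \<longleftrightarrow> (Bottom, Suc N) \<in> C" using G(2) length_\<pi> by simp
      moreover have "(Bottom, Suc N) \<in> C \<longleftrightarrow> (Top, 1) \<in> C" using G(4)[OF RA] pos_R_top by simp
      ultimately show ?thesis using pos_top[OF k(1,2)] k(3) True R1 by simp
    next
      case False
      then have "pos \<pi> Top (emb (\<tau>t j)) = Suc k" using pos_top[of "Suc k"] k by simp
      then show ?thesis using g(2)[OF \<tau>t_S[OF j]] pos_top[OF k(1,2)] k(3) by simp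
    qed
  qed
  show "invariant g"
    unfolding invariant_def
  proof (intro conjI ballI)
    show "g \<subseteq> S" by (auto simp: g_def)
    fix i assume i: "i \<in> S"
    then obtain j where j: "j \<in> S" "i = \<tau>b j"
      using permutes_image[OF tau_permutes(1)[of Bottom]] by auto
    have "\<tau>t j \<in> g \<longleftrightarrow> \<tau>b j \<in> g" using bot[OF j(1)] top[OF j(1)] G(4)[OF A[OF j(1)]] by simp
    then show "\<sigma> i \<in> g \<longleftrightarrow> i \<in> g" using j by (simp add: \<tau>t)
  qed
  show "boundary_of \<pi> C = chain_of g"
  proof
    fix \<alpha>
    consider "\<alpha> = R_top" | j where "j \<in> S" "\<alpha> = emb j" | "\<alpha> \<notin> alphabet \<pi>"
      by (auto simp: alphabet_\<pi>)
    then show "boundary_of \<pi> C \<alpha> = chain_of g \<alpha>"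
    proof cases
      case 1
      then show ?thesis
        unfolding 1 boundary_of_row[OF C RA, of Top] chain_of_simps pos_R_top using star0 R1 by simp
    next
      case 2
      then show ?thesis
        unfolding 2(2) boundary_of_row[OF C A[OF 2(1)], of Bottom] chain_of_simps(2)[OF 2(1)]
        using g(1)[OF 2(1)] bot[OF 2(1)] by simp
    next
      case 3
      then show ?thesis by (simp add: chain_of_simps boundary_of_def)
    qed
  qed
qed

lemma chain_boundary:
  assumes g: "invariant g"
  shows "chain_of g \<in> boundaries \<pi>"
proof -
  \<comment> \<open>The corner \<open>k\<close> of row \<open>r\<close> is named
    \<open>(tau r ^^ k) star\<close>. At the right ends of the rows the powers wrap around,
    consistently with the gluings of \<open>R_top\<close>.\<close>
  define C where "C = {(r, k) \<in> corners \<pi>. (tau r ^^ k) star \<in> g}"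
  have mem: "(r, k) \<in> C \<longleftrightarrow> (tau r ^^ k) star \<in> g" if "k \<le> Suc N" for r k
    using that by (simp add: C_def corners_def length_\<pi>)
  have pos: "(\<tau>b ^^ pos \<pi> Bottom (emb j)) star = j" "(\<tau>t ^^ pos \<pi> Top (emb j)) star = j"
    "pos \<pi> Bottom (emb j) < N" "pos \<pi> Top (emb j) \<le> N" if j: "j \<in> S" for j
  proof -
    obtain k where k: "k < N" "j = (\<tau>b ^^ k) star" using j unfolding tau_enum(1)[of Bottom, symmetric] by auto
    then show "(\<tau>b ^^ pos \<pi> Bottom (emb j)) star = j" "pos \<pi> Bottom (emb j) < N" using pos_bottom by simp_all
    obtain k where k: "1 \<le> k" "k \<le> N" "j = (\<tau>t ^^ k) star" using j unfolding enum_shift[of Top, symmetric] by auto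
    then show "(\<tau>t ^^ pos \<pi> Top (emb j)) star = j" "pos \<pi> Top (emb j) \<le> N" using pos_top by simp_all
  qed
  have l: "(Top, pos \<pi> Top (emb j)) \<in> C \<longleftrightarrow> j \<in> g" "(Bottom, pos \<pi> Bottom (emb j)) \<in> C \<longleftrightarrow> j \<in> g"
    "(Top, Suc (pos \<pi> Top (emb j))) \<in> C \<longleftrightarrow> \<tau>t j \<in> g" "(Bottom, Suc (pos \<pi> Bottom (emb j))) \<in> C \<longleftrightarrow> \<tau>b j \<in> g"
    if "j \<in> S" for j
    using pos[OF that] by (simp_all add: mem)
  have tN: "(\<tau>t ^^ N) star = star" "(\<tau>b ^^ N) star = star" using tau_enum(3)[of Top] tau_enum(3)[of Bottom] by simp_all
  have R: "(Top, 0) \<in> C \<longleftrightarrow> star \<in> g" "(Bottom, 0) \<in> C \<longleftrightarrow> star \<in> g" "(Bottom, N) \<in> C \<longleftrightarrow> star \<in> g"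
    "(Top, Suc 0) \<in> C \<longleftrightarrow> \<tau>t star \<in> g" "(Top, Suc N) \<in> C \<longleftrightarrow> \<tau>t star \<in> g" "(Bottom, Suc N) \<in> C \<longleftrightarrow> \<tau>t star \<in> g"
    using tN invariant_tau[OF g star_S] by (simp_all add: mem)
  have "(a \<in> C) = (b \<in> C)" if ab: "(a, b) \<in> corner_glue \<pi>" for a b
  proof -
    consider "a = (Top, 0)" "b = (Bottom, 0)" | "a = (Top, Suc N)" "b = (Bottom, Suc N)"
      | "a = (Top, 0)" "b = (Bottom, N)" | "a = (Top, Suc 0)" "b = (Bottom, Suc N)"
      | j where "j \<in> S" "a = (Top, pos \<pi> Top (emb j))" "b = (Bottom, pos \<pi> Bottom (emb j))"
      | j where "j \<in> S" "a = (Top, Suc (pos \<pi> Top (emb j)))" "b = (Bottom, Suc (pos \<pi> Bottom (emb j)))"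
      using ab unfolding corner_glue_def alphabet_\<pi> length_\<pi> by (auto simp: pos_R_top)
    then show ?thesis by cases (simp_all add: R l invariant_tau[OF g])
  qed
  then have C: "glue_invariant \<pi> C" by (auto simp: glue_invariant_def C_def)
  have "boundary_of \<pi> C = chain_of g"
  proof
    fix \<alpha>
    consider "\<alpha> = R_top" | j where "j \<in> S" "\<alpha> = emb j" | "\<alpha> \<notin> alphabet \<pi>"
      by (auto simp: alphabet_\<pi>)
    then show "boundary_of \<pi> C \<alpha> = chain_of g \<alpha>"
    proof cases
      case 1
      have RA: "R_top \<in> alphabet \<pi>" by (simp add: alphabet_\<pi>)
      show ?thesis
        unfolding 1 boundary_of_row[OF C RA, of Top] chain_of_simps pos_R_top R ..
    next
      case 2
      have A: "emb j \<in> alphabet \<pi>" using 2 by (simp add: alphabet_\<pi>)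
      show ?thesis
        unfolding 2(2) boundary_of_row[OF C A, of Bottom] chain_of_simps(2)[OF 2(1)] l[OF 2(1)] ..
    next
      case 3
      then show ?thesis by (simp add: chain_of_simps boundary_of_def)
    qed
  qed
  then show ?thesis unfolding boundaries_eq[OF proper] using C by (metis imageI mem_Collect_eq)
qed

lemma boundaries_eq_chains: "boundaries \<pi> = chain_of ` {g. invariant g}"
proof
  show "boundaries \<pi> \<subseteq> chain_of ` {g. invariant g}"
  proof
    fix x assume "x \<in> boundaries \<pi>"
    then obtain C where C: "glue_invariant \<pi> C" "x = boundary_of \<pi> C" using boundaries_eq[OF proper] by auto
    obtain g where "invariant g" "boundary_of \<pi> C = chain_of g" using boundary_chain[OF C(1)] .
    then show "x \<in> chain_of ` {g. invariant g}" using C(2) by blast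
  qed
qed (use chain_boundary in blast)

text \<open>An invariant set and its complement have the same boundary, so the sets avoiding
  \<open>star\<close> represent all boundaries. They are distinguished by them: starting from
  \<open>star\<close>, the chain tells membership step by step along \<open>\<tau>b\<close>.\<close>

lemma card_boundaries: "card (boundaries \<pi>) = 2 ^ (card (orbit \<sigma> ` S) - 1)"
proof -
  let ?I = "{g. g \<subseteq> S \<and> (\<forall>j\<in>S. \<sigma> j \<in> g \<longleftrightarrow> j \<in> g) \<and> star \<notin> g}"
  have I: "?I = {g. invariant g \<and> star \<notin> g}" by (auto simp: invariant_def)
  have compl: "invariant (S - g)" "chain_of (S - g) = chain_of g" if g: "invariant g" for g
  proof -
    show "invariant (S - g)" using g permutes_in_image[OF \<sigma>_S] by (auto simp: invariant_def)
    show "chain_of (S - g) = chain_of g"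
    proof
      fix \<alpha>
      consider "\<alpha> = R_top" | j where "j \<in> S" "\<alpha> = emb j" | "\<alpha> \<notin> alphabet \<pi>"
        by (auto simp: alphabet_\<pi>)
      then show "chain_of (S - g) \<alpha> = chain_of g \<alpha>"
      proof cases
        case 1
        then show ?thesis unfolding 1 chain_of_simps using star_S \<tau>t_S[OF star_S]
          by (cases "star \<in> g"; cases "\<tau>t star \<in> g") simp_all
      next
        case 2
        then show ?thesis unfolding 2(2) chain_of_simps(2)[OF 2(1)] using 2(1) \<tau>b_S[OF 2(1)]
          by (cases "j \<in> g"; cases "\<tau>b j \<in> g") simp_all
      next
        case 3
        then show ?thesis by (simp add: chain_of_simps)
      qed
    qed
  qed
  have "chain_of ` {g. invariant g} = chain_of ` ?I"
  proof
    show "chain_of ` {g. invariant g} \<subseteq> chain_of ` ?I"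
    proof (rule image_subsetI)
      fix g assume "g \<in> {g. invariant g}"
      then have g: "invariant g" by simp
      show "chain_of g \<in> chain_of ` ?I"
      proof (cases "star \<in> g")
        case True
        then have "S - g \<in> ?I" unfolding I using compl(1)[OF g] by simp
        then have "chain_of (S - g) \<in> chain_of ` ?I" by (rule imageI)
        then show ?thesis unfolding compl(2)[OF g] .
      next
        case False
        then have "g \<in> ?I" unfolding I using g by simp
        then show ?thesis by (rule imageI)
      qed
    qed
    show "chain_of ` ?I \<subseteq> chain_of ` {g. invariant g}" unfolding I by (rule image_mono) blast
  qed
  moreover have "inj_on chain_of ?I"
  proof (rule inj_onI)
    fix g h assume gh: "g \<in> ?I" "h \<in> ?I" and eq: "chain_of g = chain_of h"
    have "(\<tau>b ^^ k) star \<in> g \<longleftrightarrow> (\<tau>b ^^ k) star \<in> h" for k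
    proof (induction k)
      case 0
      then show ?case using gh by simp
    next
      case (Suc k)
      let ?j = "(\<tau>b ^^ k) star"
      have j: "?j \<in> S" using star_S \<tau>b_S by (induction k) auto
      have "chain_of g (emb ?j) = chain_of h (emb ?j)" using eq by simp
      then have "(of_bool (?j \<in> g) + of_bool (\<tau>b ?j \<in> g) :: bit) = of_bool (?j \<in> h) + of_bool (\<tau>b ?j \<in> h)"
        unfolding chain_of_simps(2)[OF j] .
      then have "\<tau>b ?j \<in> g \<longleftrightarrow> \<tau>b ?j \<in> h"
        unfolding Suc.IH by (cases "\<tau>b ?j \<in> g"; cases "\<tau>b ?j \<in> h") simp_all
      then show ?case by simp
    qed
    then have "j \<in> g \<longleftrightarrow> j \<in> h" if "j \<in> S" for j
      using that unfolding tau_enum(1)[of Bottom, symmetric] by auto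
    moreover have "g \<subseteq> S" "h \<subseteq> S" using gh by simp_all
    ultimately show "g = h" by (metis subset_antisym subsetD subsetI)
  qed
  ultimately have "card (boundaries \<pi>) = card ?I" unfolding boundaries_eq_chains by (simp add: card_image)
  then show ?thesis using card_invariant_sets[OF \<sigma>_S finite_S star_S] by simp
qed

text \<open>Signs are under control for odd sets only, whereas a boundary meets the labels from
  \<open>S\<close> in an even number; so the form is evaluated at \<open>x\<close> plus the loop of
  \<open>R_bot\<close>. The support of that sum within \<open>S\<close> is the translate
  \<open>Z\<close> of \<open>{star}\<close> along an invariant set and has the sign of a singleton.
  As \<open>x\<close> is in the radical and the loop has value 1, the value on \<open>x\<close> must
  be 0.\<close>

lemma quad_boundary:
  assumes odd: "\<And>y. y \<in> S \<Longrightarrow> odd (card (orbit \<sigma> y))" and x: "x \<in> boundaries \<pi>"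
  shows "quad \<pi> x = 0"
proof -
  obtain P where P: "numbering \<tau>t S P" "\<And>j. j \<in> S \<Longrightarrow> pos \<pi> Top (emb j) = Suc (P j)" by (rule numbering_top) blast
  obtain Q where Q: "numbering \<tau>b S Q" "\<And>j. j \<in> S \<Longrightarrow> pos \<pi> Bottom (emb j) = Q j" by (rule numbering_bottom) blast
  obtain g where g: "invariant g" "x = chain_of g" using x boundaries_eq_chains by blast
  have gS: "g \<subseteq> S" "\<And>j. j \<in> g \<Longrightarrow> \<sigma> j \<in> g" using g(1) by (auto simp: invariant_def)
  let ?V = "{j\<in>S. (\<tau>b j \<in> g) \<noteq> (j \<in> g)}"
  define Z where "Z = sym_diff {star} ?V"
  have ZS: "Z \<subseteq> S" using star_S by (auto simp: Z_def)
  have "finite ?V" using finite_S by simp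
  then have oddZ: "odd (card Z)"
    unfolding Z_def using even_card_sym_diff[of "{star}" ?V] even_card_boundary[OF Q(1) gS(1)] by simp
  have "inv_sign P Q Z = inv_sign P Q {star}"
    unfolding Z_def using star_S \<tau>t
    by (intro inv_sign_invariant_shift[OF P(1) Q(1) \<sigma>_S _ odd _ _ gS]) auto
  also have "\<dots> = 1" by (simp add: inv_sign_def)
  finally have E: "inv_sign P Q Z = 1" .
  let ?u = "\<lambda>\<alpha>. delta R_bot \<alpha> + x \<alpha>"
  have embs: "emb star = R_bot" by (simp add: emb_def)
  then have R_bot: "R_bot \<in> alphabet \<pi>" using imageI[OF star_S, of emb] by (simp add: alphabet_\<pi>)
  have "sg (quad \<pi> ?u) = - 1"
  proof -
    \<comment> \<open>For the odd set \<open>Z\<close> both formulas of \<open>sg_quad\<close> give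
      \<open>- 1\<close>, so it does not matter whether \<open>R_top\<close> belongs to the
      support.\<close>
    define Y where "Y = (if x R_top = 1 then insert R_top (emb ` Z) else emb ` Z)"
    have "?u = (\<lambda>\<alpha>. of_bool (\<alpha> \<in> Y))"
    proof
      fix \<alpha>
      consider "\<alpha> = R_top" | j where "j \<in> S" "\<alpha> = emb j" | "\<alpha> \<notin> alphabet \<pi>"
        by (auto simp: alphabet_\<pi>)
      then show "?u \<alpha> = of_bool (\<alpha> \<in> Y)"
      proof cases
        case 1
        have "R_top \<notin> emb ` Z" using R_top_notin ZS by blast
        then show ?thesis unfolding 1 by (cases "x R_top") (simp_all add: delta_def Y_def)
      next
        case 2
        have "emb j \<in> Y \<longleftrightarrow> j \<in> Z" using inj_emb R_top_notin 2(1) by (auto simp: Y_def inj_image_mem_iff emb_neq_R_top)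
        also have "\<dots> \<longleftrightarrow> (j = star) \<noteq> ((\<tau>b j \<in> g) \<noteq> (j \<in> g))" using 2(1) by (auto simp: Z_def)
        finally have "emb j \<in> Y \<longleftrightarrow> (j = star) \<noteq> ((\<tau>b j \<in> g) \<noteq> (j \<in> g))" .
        moreover have "emb j = R_bot \<longleftrightarrow> j = star" by (simp add: emb_def)
        ultimately show ?thesis
          unfolding 2(2) g(2) chain_of_simps(2)[OF 2(1)] delta_def
          by (cases "j = star"; cases "j \<in> g"; cases "\<tau>b j \<in> g") simp_all
      next
        case 3
        have "Y \<subseteq> alphabet \<pi>" using ZS by (auto simp: Y_def alphabet_\<pi>)
        then have "\<alpha> \<notin> Y" "\<alpha> \<noteq> R_bot" using 3 R_bot by auto
        then show ?thesis using 3 by (simp add: delta_def g(2) chain_of_simps)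
      qed
    qed
    moreover have "sg (quad \<pi> (\<lambda>\<alpha>. of_bool (\<alpha> \<in> Y))) = - 1"
      using sg_quad[OF P(2) Q(2,1) ZS] E oddZ by (simp add: Y_def)
    ultimately show ?thesis by simp
  qed
  moreover have "intersection_form \<pi> (delta R_bot) x = 0"
  proof -
    interpret bit_quadratic "alphabet \<pi>" "intersection_form \<pi>" "quad \<pi>"
      using proper by (rule quadratic_lperm)
    have "x \<in> rad" using x radical_eq_boundaries[OF proper] by simp
    moreover have "delta R_bot \<in> V" using R_bot by (auto simp: V_def delta_def)
    ultimately show ?thesis using sym[of "delta R_bot" x] by (simp add: rad_def)
  qed
  ultimately show ?thesis
    by (cases "quad \<pi> x") (simp_all add: quad_add[OF proper] quad_delta R_bot)
qed

end

section \<open>The recursion\<close>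

text \<open>With \<open>k\<close> cycles the boundaries number \<open>2 ^ (k - 1)\<close>, and
  comparing with the \<open>2 ^ Suc N\<close> cycles gives \<open>N + 1 = k - 1 + 2 * g\<close>. The
  Gauss sum has absolute value \<open>2 ^ (k - 1 + g)\<close>, half of which belongs to
  \<open>theta\<close>; and \<open>k + g - 2\<close> is half of \<open>N + k - 2\<close>.\<close>

lemma (in factor_pair) theta_of_spin_parity:
  assumes odd: "\<And>y. y \<in> S \<Longrightarrow> odd (card (orbit \<sigma> y))"
  shows "theta_of S \<sigma> \<tau>b = - sg (spin_parity \<pi>) * 2 ^ ((N + card (orbit \<sigma> ` S) - 2) div 2)"
proof -
  define k where "k = card (orbit \<sigma> ` S)"
  have k: "1 \<le> k" "k \<le> N"
    unfolding k_def using finite_S star_S card_image_le[OF finite_S, of "orbit \<sigma>"] card_S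
    by (auto simp: Suc_le_eq card_gt_0_iff)
  obtain g where g: "(\<Sum>x\<in>cycles \<pi>. sg (quad \<pi> x)) = int (card (boundaries \<pi>)) * 2 ^ g * sg (spin_parity \<pi>)"
    "2 ^ card (alphabet \<pi>) = card (boundaries \<pi>) * 4 ^ g"
  proof (rule gauss_sum_spin_parity[OF proper])
    show "quad \<pi> x = 0" if "x \<in> boundaries \<pi>" for x using odd that by (rule quad_boundary)
  qed
  have bd: "card (boundaries \<pi>) = 2 ^ (k - 1)" using card_boundaries by (simp add: k_def)
  have "inj_on emb S" using inj_emb by (rule inj_on_subset) simp
  then have "card (alphabet \<pi>) = Suc N"
    unfolding alphabet_\<pi> using R_top_notin finite_S card_S by (simp add: card_image)
  then have "(2 :: nat) ^ Suc N = 2 ^ (k - 1) * 4 ^ g" using g(2) unfolding bd by (simp only:)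
  also have "\<dots> = 2 ^ (k - 1 + 2 * g)" by (simp add: power_add power_mult)
  finally have "(2 :: nat) ^ Suc N = 2 ^ (k - 1 + 2 * g)" .
  then have N: "Suc N = k - 1 + 2 * g" by (rule power_inject_exp[THEN iffD1, rotated]) simp
  then have "N + k - 2 = 2 * (k + g - 2)" and kg: "k - 1 + g = Suc (k + g - 2)" using k by arith+
  then have e: "(N + k - 2) div 2 = k + g - 2" by simp
  have "- 2 * theta_of S \<sigma> \<tau>b = int (2 ^ (k - 1)) * 2 ^ g * sg (spin_parity \<pi>)"
    unfolding sum_sg_quad[symmetric] g(1) bd ..
  also have "\<dots> = 2 ^ (k - 1 + g) * sg (spin_parity \<pi>)" by (simp only: power_add of_nat_power of_nat_numeral)
  also have "\<dots> = 2 * (2 ^ (k + g - 2) * sg (spin_parity \<pi>))" unfolding kg by simp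
  finally have "theta_of S \<sigma> \<tau>b = - (2 ^ (k + g - 2) * sg (spin_parity \<pi>))" by linarith
  also have "\<dots> = - sg (spin_parity \<pi>) * 2 ^ (k + g - 2)" by (simp only: mult.commute mult_minus_left)
  finally show ?thesis unfolding k_def[symmetric] e .
qed

definition spin_exponent :: "nat multiset \<Rightarrow> nat" where
  "spin_exponent p = (sum_mset p + size p - 2) div 2"

lemma orbit_card_cycle_type: "finite S \<Longrightarrow> y \<in> S \<Longrightarrow> card (orbit \<sigma> y) \<in># cycle_type \<sigma> S"
  by (simp add: cycle_type_def)

lemma cycle_type_orbit:
  assumes "finite S" "m \<in># cycle_type \<sigma> S"
  obtains y where "y \<in> S" "card (orbit \<sigma> y) = m"
  using assms by (auto simp: cycle_type_def)

lemma size_cycle_type: "size (cycle_type \<sigma> S) = card (orbit \<sigma> ` S)"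
  by (simp add: cycle_type_def)

lemma card_diff_bit:
  assumes "finite F"
  shows "int (card {\<tau>\<in>F. f \<tau> = 1}) - int (card {\<tau>\<in>F. f \<tau> = 0}) = (\<Sum>\<tau>\<in>F. - sg (f \<tau>))"
proof -
  have "- sg (f \<tau>) = of_bool (f \<tau> = 1) - of_bool (f \<tau> = 0)" for \<tau> by (cases "f \<tau>") simp_all
  then have "(\<Sum>\<tau>\<in>F. - sg (f \<tau>)) = (\<Sum>\<tau>\<in>F. of_bool (f \<tau> = 1)) - (\<Sum>\<tau>\<in>F. of_bool (f \<tau> = 0))"
    by (simp only: sum_subtractf)
  then show ?thesis using assms by (simp add: sum.If_cases of_bool_def Int_def)
qed

text \<open>A pair in the definition of the spin count is determined by its bottom cycle, and every
  pair contributes the same absolute value to the sum. The sign \<open>- sg\<close> is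
  \<open>1\<close> for parity 1 and \<open>- 1\<close> for parity 0, in accordance with the
  difference \<open>c_1 - c_0\<close>.\<close>

lemma spin_diff_spin_sum:
  assumes odd: "\<forall>n\<in>#p. odd n" and ne: "p \<noteq> {#}"
    and \<sigma>': "\<sigma>' permutes S'" "finite S'" "cycle_type \<sigma>' S' = p"
  shows "spin_sum S' \<sigma>' = spin_diff p * 2 ^ spin_exponent p"
proof -
  define N where "N = sum_mset p"
  have pos: "\<forall>n\<in>#p. 0 < n" using odd by (auto intro: odd_pos)
  obtain \<sigma> star where bc: "base_choice p = (\<sigma>, star)" by fastforce
  note B = base_choice[OF pos ne bc, folded N_def]
  let ?S = "{1..N}"
  let ?F = "factor_set ?S \<sigma>"
  let ?par = "\<lambda>\<tau>. spin_parity (standard_perm N star (\<sigma> \<circ> \<tau>) \<tau>)"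
  have fc: "full_cycle N \<tau> \<longleftrightarrow> \<tau> permutes ?S \<and> cyclic_on \<tau> ?S" for \<tau>
    by (simp add: full_cycle_def)
  have count: "spin_count s p = card {\<tau>\<in>?F. ?par \<tau> = s}" for s
  proof -
    have "{(\<tau>t, \<tau>b). full_cycle N \<tau>t \<and> full_cycle N \<tau>b \<and> \<tau>t \<circ> inv \<tau>b = \<sigma>
              \<and> spin_parity (standard_perm N star \<tau>t \<tau>b) = s}
        = (\<lambda>\<tau>. (\<sigma> \<circ> \<tau>, \<tau>)) ` {\<tau>\<in>?F. ?par \<tau> = s}" (is "?L = ?R")
    proof
      show "?L \<subseteq> ?R"
      proof
        fix q assume "q \<in> ?L"
        then obtain \<tau>t \<tau>b where q: "q = (\<tau>t, \<tau>b)" "full_cycle N \<tau>t" "full_cycle N \<tau>b" "\<tau>t \<circ> inv \<tau>b = \<sigma>"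
          "spin_parity (standard_perm N star \<tau>t \<tau>b) = s" by blast
        have "inv \<tau>b \<circ> \<tau>b = id" using q(3) fc permutes_inv_o(2) by blast
        then have "\<tau>t = \<sigma> \<circ> \<tau>b" unfolding q(4)[symmetric] by (simp add: comp_assoc)
        then show "q \<in> ?R" using q fc by (auto simp: factor_set_def)
      qed
      show "?R \<subseteq> ?L"
      proof (rule image_subsetI)
        fix \<tau> assume \<tau>: "\<tau> \<in> {\<tau>\<in>?F. ?par \<tau> = s}"
        then have t: "\<tau> permutes ?S" "cyclic_on \<tau> ?S" "cyclic_on (\<sigma> \<circ> \<tau>) ?S" by (auto simp: factor_set_def)
        have "\<tau> \<circ> inv \<tau> = id" using t(1) permutes_inv_o(1) by blast
        then have "(\<sigma> \<circ> \<tau>) \<circ> inv \<tau> = \<sigma>" by (simp add: comp_assoc)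
        then show "(\<sigma> \<circ> \<tau>, \<tau>) \<in> ?L" using \<tau> t fc permutes_compose[OF t(1) B(1)] by simp
      qed
    qed
    moreover have "inj_on (\<lambda>\<tau>. (\<sigma> \<circ> \<tau>, \<tau>)) {\<tau>\<in>?F. ?par \<tau> = s}" by (rule inj_onI) simp
    ultimately show ?thesis by (simp add: spin_count_def bc card_image flip: N_def)
  qed
  have "spin_diff p = (\<Sum>\<tau>\<in>?F. - sg (?par \<tau>))"
    unfolding spin_diff_def count by (rule card_diff_bit) (simp add: finite_factor_set)
  then have "spin_diff p * 2 ^ spin_exponent p = (\<Sum>\<tau>\<in>?F. - sg (?par \<tau>) * 2 ^ spin_exponent p)"
    by (simp only: sum_distrib_right)
  also have "\<dots> = (\<Sum>\<tau>\<in>?F. theta_of ?S \<sigma> \<tau>)"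
  proof (intro sum.cong refl)
    fix \<tau> assume "\<tau> \<in> ?F"
    then have t: "\<tau> permutes ?S" "cyclic_on \<tau> ?S" "cyclic_on (\<sigma> \<circ> \<tau>) ?S" by (auto simp: factor_set_def)
    interpret factor_pair N star "\<sigma> \<circ> \<tau>" \<tau> \<sigma>
      by unfold_locales (use B t fc permutes_compose[OF t(1) B(1)] in auto)
    have "odd (card (orbit \<sigma> y))" if "y \<in> S" for y
      using orbit_card_cycle_type[of ?S y \<sigma>] that odd B(2) by (simp add: S_def)
    from theta_of_spin_parity[OF this]
    have "theta_of S \<sigma> \<tau> = - sg (spin_parity \<pi>) * 2 ^ ((N + card (orbit \<sigma> ` S) - 2) div 2)" .
    moreover have "(N + card (orbit \<sigma> ` S) - 2) div 2 = spin_exponent p"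
      using size_cycle_type[of \<sigma> ?S] B(2) unfolding S_def spin_exponent_def N_def[symmetric] by simp
    ultimately show "- sg (?par \<tau>) * 2 ^ spin_exponent p = theta_of ?S \<sigma> \<tau>"
      by (simp add: \<pi>_def S_def)
  qed
  also have "\<dots> = spin_sum S' \<sigma>'"
    unfolding spin_sum_def[symmetric] using B \<sigma>' by (intro spin_sum_cycle_type) auto
  finally show ?thesis by simp
qed

lemma spin_sum_even:
  assumes "finite S" "\<sigma> permutes S" "m \<in># cycle_type \<sigma> S" "even m"
  shows "spin_sum S \<sigma> = 0"
proof -
  obtain y where y: "y \<in> S" "card (orbit \<sigma> y) = m" using cycle_type_orbit[OF assms(1,3)] .
  have "theta_of S \<sigma> \<tau> = 0" if "\<tau> \<in> factor_set S \<sigma>" for \<tau>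
  proof -
    note D = factor_setD[OF assms(1,2) that]
    show ?thesis
      unfolding theta_of_def using y assms(4)
      by (intro theta_even_orbit[OF D(3,2) assms(2) _ y(1)]) auto
  qed
  then show ?thesis by (simp add: spin_sum_def)
qed

text \<open>Each cycle of length \<open>m\<close> is counted by its \<open>m\<close> elements. This
  is the origin of the coefficients of the merge terms.\<close>

lemma sum_orbit_card:
  assumes \<sigma>: "\<sigma> permutes T" "finite T" and B: "B \<subseteq> T" "\<And>b. b \<in> B \<Longrightarrow> \<sigma> b \<in> B"
  shows "(\<Sum>w\<in>B. f (card (orbit \<sigma> w)) :: int) = (\<Sum>m\<in>#cycle_type \<sigma> B. int m * f m)"
proof -
  have fin: "finite B" using B(1) \<sigma>(2) finite_subset by blast
  have p: "permutation \<sigma>" using \<sigma> permutation_permutes by blast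
  have "(\<Sum>w\<in>B. f (card (orbit \<sigma> w))) = (\<Sum>Ob\<in>orbit \<sigma> ` B. \<Sum>w | w \<in> B \<and> orbit \<sigma> w = Ob. f (card (orbit \<sigma> w)))"
    by (rule sum.image_gen[OF fin])
  also have "\<dots> = (\<Sum>Ob\<in>orbit \<sigma> ` B. int (card Ob) * f (card Ob))"
  proof (intro sum.cong refl)
    fix Ob assume "Ob \<in> orbit \<sigma> ` B"
    then obtain b where b: "b \<in> B" "Ob = orbit \<sigma> b" by blast
    have "orbit \<sigma> b \<subseteq> B" using orbit_subset_closed[of B \<sigma> b] B(2) b(1) by blast
    moreover have "orbit \<sigma> w = Ob" if "w \<in> Ob" for w
      using orbit_cyclic_eq3[OF cyclic_on_orbit[OF \<sigma>]] that b(2) by metis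
    moreover have "w \<in> orbit \<sigma> w" for w by (rule permutation_self_in_orbit[OF p])
    ultimately have "{w. w \<in> B \<and> orbit \<sigma> w = Ob} = Ob" using b(2) by blast
    then have "(\<Sum>w | w \<in> B \<and> orbit \<sigma> w = Ob. f (card (orbit \<sigma> w))) = (\<Sum>w\<in>Ob. f (card Ob))"
      using \<open>\<And>w. w \<in> Ob \<Longrightarrow> orbit \<sigma> w = Ob\<close> by (simp cong: sum.cong)
    then show "(\<Sum>w | w \<in> B \<and> orbit \<sigma> w = Ob. f (card (orbit \<sigma> w))) = int (card Ob) * f (card Ob)" by simp
  qed
  finally show ?thesis by (simp add: cycle_type_def sum_unfold_sum_mset multiset.map_comp comp_def)
qed

text \<open>In the merged cycle the distance from \<open>w\<close> to \<open>\<sigma> w\<close> is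
  the odd number \<open>n\<close>, so \<open>phi\<close> agrees with \<open>theta\<close> for every
  single factorization.\<close>

lemma spin_sum_merge:
  fixes x :: nat
  assumes fin: "finite S" and x: "x \<notin> S" and \<sigma>: "\<sigma> permutes insert x S"
    and n: "n = card (orbit \<sigma> x)" "odd n" and w: "w \<in> S" "w \<notin> orbit \<sigma> x"
  shows "(\<Sum>\<tau>\<in>factor_set S (reduced_perm \<sigma> x w). phi_of S (reduced_perm \<sigma> x w) (\<sigma> w) w \<tau>)
    = spin_sum S (reduced_perm \<sigma> x w)"
  unfolding spin_sum_def
proof (intro sum.cong refl)
  let ?r = "reduced_perm \<sigma> x w"
  fix \<tau> assume \<tau>: "\<tau> \<in> factor_set S ?r"
  note M = cycle_type_reduced_merge[OF fin x \<sigma> n(1) w]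
  have "permutation \<sigma>" using permutes_imp_permutation[OF finite.insertI[OF fin] \<sigma>] .
  then have "x \<in> orbit \<sigma> x" by (rule permutation_self_in_orbit)
  moreover have "\<sigma> w \<notin> orbit \<sigma> x" using orbit_closed[OF \<sigma> finite.insertI[OF fin]] w(2) by simp
  ultimately have "\<sigma> w \<noteq> x" by metis
  moreover have "\<sigma> w \<in> insert x S" using permutes_in_image[OF \<sigma>, of w] w(1) by simp
  ultimately have y: "\<sigma> w \<in> S" by simp
  note D = factor_setD[OF fin reduced_perm_permutes[OF \<sigma> x w(1)] \<tau>]
  show "phi_of S ?r (\<sigma> w) w \<tau> = theta_of S ?r \<tau>"
    unfolding phi_of_def theta_of_def
    by (rule phi_odd_distance[OF D(3,2) _ y w(1) n(2) M(2,3)]) simp_all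
qed

text \<open>If \<open>w\<close> is off the cycle of \<open>x\<close>, the two contributions are
  equal and the merge is doubled. Otherwise \<open>w = (\<sigma> ^^ a) x\<close>, where
  \<open>a = 0\<close> is \<open>x\<close> itself and \<open>a = n - 1\<close> its predecessor, both
  excluded; for the remaining splits the insertion sum vanishes.\<close>

lemma spin_sum_odd_cycle:
  fixes x :: nat
  assumes fin: "finite S" and x: "x \<notin> S" and ne: "S \<noteq> {}" and \<sigma>: "\<sigma> permutes insert x S"
    and n: "n = card (orbit \<sigma> x)" "odd n"
  shows "spin_sum (insert x S) \<sigma> = (\<Sum>w\<in>insert x S - orbit \<sigma> x. 2 * spin_sum S (reduced_perm \<sigma> x w))
    + (\<Sum>a | 1 \<le> a \<and> a + 2 \<le> n. spin_sum S (reduced_perm \<sigma> x ((\<sigma> ^^ a) x)))"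
proof -
  let ?T = "insert x S" and ?r = "reduced_perm \<sigma> x" and ?f = "\<lambda>a. (\<sigma> ^^ a) x"
  let ?phi = "\<lambda>w. \<Sum>\<tau>\<in>factor_set S (?r w). phi_of S (?r w) (\<sigma> w) w \<tau>"
  let ?A = "{a. 1 \<le> a \<and> a + 2 \<le> n}"
  have T: "finite ?T" using fin by simp
  have p: "permutation \<sigma>" using \<sigma> T permutation_permutes by blast
  note En = orbit_enum[OF p, of x, folded n(1)]
  have xO: "x \<in> orbit \<sigma> x" using permutation_self_in_orbit[OF p] .
  have OT: "orbit \<sigma> x \<subseteq> ?T" using permutes_orbit_subset[OF \<sigma>, of x] by simp
  have inj\<sigma>: "\<sigma> i = \<sigma> j \<longleftrightarrow> i = j" for i j using permutes_inj[OF \<sigma>] by (simp add: inj_eq)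
  have injf: "i = j" if "i < n" "j < n" "?f i = ?f j" for i j using inj_onD[OF En(2)] that by auto
  have last: "\<sigma> (?f (n - 1)) = x"
  proof -
    have "\<sigma> (?f (n - 1)) = ?f (Suc (n - 1))" by simp
    also have "\<dots> = x" using En(3,4) by simp
    finally show ?thesis .
  qed
  have A: "a < n" "a \<noteq> 0" "a \<noteq> n - 1" if "a \<in> ?A" for a using that by auto
  have W: "{w. w \<in> S \<and> \<sigma> w \<noteq> x} = (?T - orbit \<sigma> x) \<union> ?f ` ?A"
  proof
    show "{w. w \<in> S \<and> \<sigma> w \<noteq> x} \<subseteq> (?T - orbit \<sigma> x) \<union> ?f ` ?A"
    proof
      fix w assume w: "w \<in> {w. w \<in> S \<and> \<sigma> w \<noteq> x}"
      show "w \<in> (?T - orbit \<sigma> x) \<union> ?f ` ?A"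
      proof (cases "w \<in> orbit \<sigma> x")
        case True
        then obtain a where a: "a < n" "w = ?f a" using En(1) by auto
        have "a \<noteq> 0" using a w x by (cases a) auto
        moreover have "a \<noteq> n - 1" using a w last by auto
        ultimately show ?thesis using a by (intro UnI2 image_eqI[of _ _ a]) auto
      qed (use w in simp)
    qed
    show "(?T - orbit \<sigma> x) \<union> ?f ` ?A \<subseteq> {w. w \<in> S \<and> \<sigma> w \<noteq> x}"
    proof
      fix w assume "w \<in> (?T - orbit \<sigma> x) \<union> ?f ` ?A"
      then consider "w \<in> ?T" "w \<notin> orbit \<sigma> x" | a where "a \<in> ?A" "w = ?f a" by blast
      then show "w \<in> {w. w \<in> S \<and> \<sigma> w \<noteq> x}"
      proof cases
        case 1
        then have "w \<in> S" using xO by auto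
        moreover have "\<sigma> w \<noteq> x" using orbit_closed[OF \<sigma> T, of w x] 1 xO by auto
        ultimately show ?thesis by simp
      next
        case 2
        note a = A[OF 2(1)]
        have "w \<noteq> x" using injf[of a 0] a En(4) 2(2) by auto
        moreover have "w \<in> ?T" using OT En(1) a(1) 2(2) by blast
        moreover have "\<sigma> w \<noteq> x" using inj\<sigma>[of w "?f (n - 1)"] last injf[of a "n - 1"] a 2(2) by auto
        ultimately show ?thesis by simp
      qed
    qed
  qed
  have disj: "(?T - orbit \<sigma> x) \<inter> ?f ` ?A = {}"
    using En(1) A by blast
  have finA: "finite ?A" by (rule finite_subset[of _ "{..n}"]) auto
  have injA: "inj_on ?f ?A" by (rule inj_onI) (use injf A in blast)
  have "spin_sum ?T \<sigma> = (\<Sum>w\<in>(?T - orbit \<sigma> x) \<union> ?f ` ?A. spin_sum S (?r w) + ?phi w)"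
    unfolding spin_sum_recursion[OF fin x ne \<sigma>] W ..
  also have "\<dots> = (\<Sum>w\<in>?T - orbit \<sigma> x. spin_sum S (?r w) + ?phi w) + (\<Sum>w\<in>?f ` ?A. spin_sum S (?r w) + ?phi w)"
    using T finA disj by (intro sum.union_disjoint) auto
  also have "(\<Sum>w\<in>?T - orbit \<sigma> x. spin_sum S (?r w) + ?phi w) = (\<Sum>w\<in>?T - orbit \<sigma> x. 2 * spin_sum S (?r w))"
  proof (intro sum.cong refl)
    fix w assume w: "w \<in> ?T - orbit \<sigma> x"
    then have "w \<in> S" using xO by auto
    then show "spin_sum S (?r w) + ?phi w = 2 * spin_sum S (?r w)"
      using spin_sum_merge[OF fin x \<sigma> n, of w] w by simp
  qed
  also have "(\<Sum>w\<in>?f ` ?A. spin_sum S (?r w) + ?phi w) = (\<Sum>a\<in>?A. spin_sum S (?r (?f a)) + ?phi (?f a))"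
    using injA by (simp add: sum.reindex)
  also have "\<dots> = (\<Sum>a\<in>?A. spin_sum S (?r (?f a)))"
  proof (intro sum.cong refl)
    fix a assume a: "a \<in> ?A"
    then have "?f a \<in> {w. w \<in> S \<and> \<sigma> w \<noteq> x}" unfolding W by blast
    then have w: "?f a \<in> S" "\<sigma> (?f a) \<in> S" using permutes_in_image[OF \<sigma>, of "?f a"] by auto
    have "\<sigma> (?f a) \<notin> orbit (?r (?f a)) (?f a)"
      using cycle_type_reduced_split(2)[OF fin x \<sigma> n(1) _ _ refl, of a] a by simp
    then show "spin_sum S (?r (?f a)) + ?phi (?f a) = spin_sum S (?r (?f a))"
      using sum_phi_of_separated[OF fin reduced_perm_permutes[OF \<sigma> x w(1)] w(2) _ w(1)] by simp
  qed
  finally show ?thesis .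
qed

theorem theorem4p18:
  fixes ns :: "nat list"
  assumes "\<forall>n\<in>set ns. odd n"
    and "sum_list ns \<ge> 2"
  shows "spin_diff (mset ns) =
      (\<Sum>i = 1..<length ns. int (ns ! i) * spin_diff (part_merge (mset ns) (ns ! 0) (ns ! i)))
      + (\<Sum>a | 1 \<le> a \<and> a + 2 \<le> ns ! 0 \<and> odd a. spin_diff (part_split (mset ns) (ns ! 0) a))"
proof -
  define p where "p = mset ns"
  define n where "n = ns ! 0"
  define N where "N = sum_mset p"
  have ns: "ns = n # tl ns" using assms(2) by (cases ns) (auto simp: n_def)
  have p: "p = add_mset n (mset (tl ns))" unfolding p_def by (subst ns) simp
  have odd: "\<forall>m\<in>#p. odd m" using assms(1) by (simp add: p_def)
  then have pos: "\<forall>m\<in>#p. 0 < m" by (auto intro: odd_pos)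
  have N: "2 \<le> N" using assms(2) by (simp add: N_def p_def sum_mset_sum_list)
  obtain \<sigma> where \<sigma>: "\<sigma> permutes {1..N}" "cycle_type \<sigma> {1..N} = p"
    using cycle_type_exists[OF pos] unfolding N_def by blast
  have "n \<in># p" by (simp add: p)
  then obtain x where x: "x \<in> {1..N}" "card (orbit \<sigma> x) = n"
    using cycle_type_orbit[of "{1..N}" n \<sigma>] \<sigma>(2) by auto
  define S where "S = {1..N} - {x}"
  define e where "e = spin_exponent p"
  have S: "finite S" "x \<notin> S" "insert x S = {1..N}" using x by (auto simp: S_def)
  have cS: "card S = N - 1" using x(1) by (simp add: S_def)
  then have Sne: "S \<noteq> {}" using N by auto
  have \<sigma>T: "\<sigma> permutes insert x S" "cycle_type \<sigma> (insert x S) = p" using \<sigma> S(3) by simp_all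
  have oddn: "odd n" using odd \<open>n \<in># p\<close> by blast
  have T: "finite (insert x S)" using S(1) by simp
  have perm: "permutation \<sigma>" using T \<sigma>T(1) by (rule permutes_imp_permutation)
  have OT: "orbit \<sigma> x \<subseteq> insert x S" using permutes_orbit_subset[OF \<sigma>T(1), of x] by simp
  have clT: "\<sigma> b \<in> insert x S" if "b \<in> insert x S" for b using permutes_in_image[OF \<sigma>T(1)] that by blast
  let ?R = "insert x S - orbit \<sigma> x"
  have clR: "\<sigma> b \<in> ?R" if "b \<in> ?R" for b using that clT orbit_closed[OF \<sigma>T(1) T] by blast
  have rest: "cycle_type \<sigma> ?R = mset (tl ns)"
    using cycle_type_split_off[OF \<sigma>T(1) T order.refl clT OT] \<sigma>T(2) x(2) p by simp
  have merge: "2 * spin_sum S (reduced_perm \<sigma> x w)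
      = spin_diff (part_merge p n (card (orbit \<sigma> w))) * 2 ^ e" if w: "w \<in> ?R" for w
  proof -
    define m where "m = card (orbit \<sigma> w)"
    have "x \<in> orbit \<sigma> x" using perm by (rule permutation_self_in_orbit)
    then have w': "w \<in> S" "w \<notin> orbit \<sigma> x" using w by auto
    have m: "m \<in># mset (tl ns)" unfolding rest[symmetric] m_def using orbit_card_cycle_type[of ?R w \<sigma>] w T by simp
    then obtain R where R: "mset (tl ns) = add_mset m R" by (metis insert_DiffM)
    have pm: "part_merge p n m = add_mset (n + m - 1) R" by (simp add: part_merge_def p R)
    have mp: "m \<in># p" using m by (simp add: p)
    have om: "odd m" using odd mp by blast
    have rp: "reduced_perm \<sigma> x w permutes S" using reduced_perm_permutes[OF \<sigma>T(1) S(2) w'(1)] .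
    have ct: "cycle_type (reduced_perm \<sigma> x w) S = part_merge p n m"
      using cycle_type_reduced_merge(1)[OF S(1,2) \<sigma>T(1) x(2)[symmetric] w'] \<sigma>T(2) by (simp add: m_def)
    have "\<forall>k\<in>#part_merge p n m. odd k" unfolding pm using oddn om odd R p by auto
    from spin_diff_spin_sum[OF this _ rp S(1) ct]
    have "spin_sum S (reduced_perm \<sigma> x w) = spin_diff (part_merge p n m) * 2 ^ spin_exponent (part_merge p n m)"
      by (simp add: pm)
    \<comment> \<open>A merge lowers the sum and the number of parts by 1 each, so the exponent
      drops by 1; the factor 2 of the merge makes up for it.\<close>
    moreover have "Suc (spin_exponent (part_merge p n m)) = e"
    proof -
      have "sum_mset (part_merge p n m) = N - 1" using sum_mset_cycle_type[OF rp S(1)] ct cS by simp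
      then have "spin_exponent (part_merge p n m) = (N - 1 + Suc (size R) - 2) div 2" by (simp add: spin_exponent_def pm)
      moreover have "e = (N + Suc (Suc (size R)) - 2) div 2" by (simp add: e_def spin_exponent_def p R flip: N_def) (simp add: N_def p R)
      ultimately show ?thesis using N by linarith
    qed
    then have "(2 :: int) ^ e = 2 * 2 ^ spin_exponent (part_merge p n m)" by (metis power_Suc)
    ultimately show ?thesis by (simp add: m_def)
  qed
  have split: "spin_sum S (reduced_perm \<sigma> x ((\<sigma> ^^ a) x))
      = (if odd a then spin_diff (part_split p n a) * 2 ^ e else 0)" if a: "1 \<le> a" "a + 2 \<le> n" for a
  proof -
    let ?w = "(\<sigma> ^^ a) x"
    note C = cycle_type_reduced_split[OF S(1,2) \<sigma>T(1) x(2)[symmetric] a refl]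
    note En = orbit_enum[OF perm, of x, unfolded x(2)]
    have "?w \<noteq> x" using inj_onD[OF En(2), of a 0] a by auto
    moreover have "?w \<in> orbit \<sigma> x" unfolding En(1) using a by (intro imageI) simp
    then have "?w \<in> insert x S" using OT by blast
    ultimately have w: "?w \<in> S" by simp
    have rp: "reduced_perm \<sigma> x ?w permutes S" using reduced_perm_permutes[OF \<sigma>T(1) S(2) w] .
    have ct: "cycle_type (reduced_perm \<sigma> x ?w) S = part_split p n a" using C(1) \<sigma>T(2) by simp
    have ps: "part_split p n a = add_mset a (add_mset (n - a - 1) (mset (tl ns)))" by (simp add: part_split_def p)
    show ?thesis
    proof (cases "odd a")
      case True
      have "odd (n - a - 1)" using True oddn a by auto
      then have "\<forall>k\<in>#part_split p n a. odd k" unfolding ps using True odd p by auto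
      from spin_diff_spin_sum[OF this _ rp S(1) ct]
      have "spin_sum S (reduced_perm \<sigma> x ?w) = spin_diff (part_split p n a) * 2 ^ spin_exponent (part_split p n a)"
        by (simp add: ps)
      \<comment> \<open>A split lowers the sum by 1 and raises the number of parts by 1, so the
        exponent is unchanged.\<close>
      moreover have "spin_exponent (part_split p n a) = e"
      proof -
        have "sum_mset (part_split p n a) = N - 1" using sum_mset_cycle_type[OF rp S(1)] ct cS by simp
        moreover have "size (part_split p n a) = Suc (size p)" unfolding ps by (simp add: p)
        ultimately show ?thesis using N by (simp add: e_def spin_exponent_def N_def)
      qed
      ultimately show ?thesis using True by simp
    next
      case False
      \<comment> \<open>The part \<open>a\<close> itself is even here, so the whole sum
        vanishes.\<close>
      then show ?thesis using spin_sum_even[OF S(1) rp, of a] ct ps by simp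
    qed
  qed
  have "spin_diff p * 2 ^ e = spin_sum (insert x S) \<sigma>"
    using spin_diff_spin_sum[OF odd _ \<sigma>T(1) T \<sigma>T(2)] by (simp add: e_def p)
  also have "\<dots> = (\<Sum>w\<in>?R. 2 * spin_sum S (reduced_perm \<sigma> x w))
      + (\<Sum>a | 1 \<le> a \<and> a + 2 \<le> n. spin_sum S (reduced_perm \<sigma> x ((\<sigma> ^^ a) x)))"
    by (rule spin_sum_odd_cycle[OF S(1,2) Sne \<sigma>T(1) x(2)[symmetric] oddn])
  also have "(\<Sum>w\<in>?R. 2 * spin_sum S (reduced_perm \<sigma> x w))
      = (\<Sum>w\<in>?R. spin_diff (part_merge p n (card (orbit \<sigma> w)))) * 2 ^ e"
    unfolding sum_distrib_right by (intro sum.cong refl merge)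
  also have "(\<Sum>w\<in>?R. spin_diff (part_merge p n (card (orbit \<sigma> w))))
      = (\<Sum>m\<in>#mset (tl ns). int m * spin_diff (part_merge p n m))"
    unfolding rest[symmetric] by (rule sum_orbit_card[OF \<sigma>T(1) T Diff_subset clR])
  also have "\<dots> = (\<Sum>i = 1..<length ns. int (ns ! i) * spin_diff (part_merge p n (ns ! i)))"
  proof -
    have "(\<Sum>m\<in>#mset (tl ns). int m * spin_diff (part_merge p n m)) = (\<Sum>m\<leftarrow>tl ns. int m * spin_diff (part_merge p n m))"
      by (simp add: sum_mset_sum_list[symmetric])
    also have "\<dots> = (\<Sum>i<length (tl ns). int (tl ns ! i) * spin_diff (part_merge p n (tl ns ! i)))"
      by (simp add: sum_list_sum_nth atLeast0LessThan)
    also have "\<dots> = (\<Sum>i<length (tl ns). int (ns ! Suc i) * spin_diff (part_merge p n (ns ! Suc i)))"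
      by (simp add: nth_tl)
    also have "\<dots> = (\<Sum>i = 1..<length ns. int (ns ! i) * spin_diff (part_merge p n (ns ! i)))"
    proof -
      have "length ns = Suc (length (tl ns))" by (subst ns) simp
      then show ?thesis
        using sum.shift_bounds_Suc_ivl[of "\<lambda>i. int (ns ! i) * spin_diff (part_merge p n (ns ! i))" 0 "length (tl ns)"]
        by (simp add: atLeast0LessThan)
    qed
    finally show ?thesis .
  qed
  also have "(\<Sum>a | 1 \<le> a \<and> a + 2 \<le> n. spin_sum S (reduced_perm \<sigma> x ((\<sigma> ^^ a) x)))
     = (\<Sum>a | 1 \<le> a \<and> a + 2 \<le> n \<and> odd a. spin_diff (part_split p n a)) * 2 ^ e"
  proof -
    have fin: "finite {a. 1 \<le> a \<and> a + 2 \<le> n}" by (rule finite_subset[of _ "{..n}"]) auto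
    have "(\<Sum>a | 1 \<le> a \<and> a + 2 \<le> n. spin_sum S (reduced_perm \<sigma> x ((\<sigma> ^^ a) x)))
      = (\<Sum>a | 1 \<le> a \<and> a + 2 \<le> n. if odd a then spin_diff (part_split p n a) * 2 ^ e else 0)"
      using split by (intro sum.cong refl) auto
    also have "\<dots> = (\<Sum>a | a \<in> {a. 1 \<le> a \<and> a + 2 \<le> n} \<and> odd a. spin_diff (part_split p n a) * 2 ^ e)"
      by (rule sum.inter_filter[OF fin, symmetric])
    also have "{a. a \<in> {a. 1 \<le> a \<and> a + 2 \<le> n} \<and> odd a} = {a. 1 \<le> a \<and> a + 2 \<le> n \<and> odd a}" by auto
    finally show ?thesis by (simp only: sum_distrib_right)
  qed
  finally have "spin_diff p * 2 ^ e = ((\<Sum>i = 1..<length ns. int (ns ! i) * spin_diff (part_merge p n (ns ! i)))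
     + (\<Sum>a | 1 \<le> a \<and> a + 2 \<le> n \<and> odd a. spin_diff (part_split p n a))) * 2 ^ e"
    by (simp only: distrib_right)
  then show ?thesis unfolding p_def n_def by simp
qed

end
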